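(* For every integer $q\ge 2$, the Max Weight Independent Set problem is solvable in time $\mathcal{O}(n^{2q})$ on $n$-vertex $K_{2,q}$-induced-minor-free graphs.
   Context: All graphs are finite, simple and undirected. $K_{2,q}$ is the complete bipartite graph with parts of sizes $2$ and $q$. A graph $G$ is $H$-induced-minor-free if no graph isomorphic to $H$ can be obtained from $G$ by a sequence of vertex deletions and edge contractions. Max Weight Independent Set: given a graph $G$ and a weight function $w:V(G)\to\mathbb{Q}_+$ (nonnegative rationals), find an independent set $I$ in $G$ maximizing $\sum_{x\in I}w(x)$. *)

theory Defs
  imports
    "Graph_Theory.Graph_Theory"
    "Graph_Theory.Kuratowski"
    "HOL-Library.Landau_Symbols"
begin

section \<open>Graphs, induced minors and independent sets\<close>

text \<open>
  Finite simple undirected graphs are represented by the locale \<^locale>\<open>pair_graph\<close>: finite, loop-free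
  digraphs with a symmetric arc relation, an edge \<open>uv\<close> being the two arcs \<open>(u, v)\<close> and \<open>(v, u)\<close>.
\<close>

definition delete_vertex :: "'a \<Rightarrow> 'a pair_pre_digraph \<Rightarrow> 'a pair_pre_digraph" where
  "delete_vertex v G =
     \<lparr> pverts = pverts G - {v}, parcs = {(x, y) \<in> parcs G. x \<noteq> v \<and> y \<noteq> v} \<rparr>"

text \<open>The vertex arising from the contraction of the edge \<open>uv\<close> keeps the name \<open>u\<close>; the loop
  and the parallel edges that the identification would create are dropped.\<close>

definition contract_edge :: "'a \<Rightarrow> 'a \<Rightarrow> 'a pair_pre_digraph \<Rightarrow> 'a pair_pre_digraph" where
  "contract_edge u v G =
     (let f = (\<lambda>x. if x = v then u else x)
      in \<lparr> pverts = pverts G - {v},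
           parcs = {(f x, f y) | x y. (x, y) \<in> parcs G \<and> f x \<noteq> f y} \<rparr>)"

inductive minor_step :: "'a pair_pre_digraph \<Rightarrow> 'a pair_pre_digraph \<Rightarrow> bool" where
  deletion: "v \<in> pverts G \<Longrightarrow> minor_step G (delete_vertex v G)"
| contraction: "(u, v) \<in> parcs G \<Longrightarrow> minor_step G (contract_edge u v G)"

definition induced_minor_free :: "'b pair_pre_digraph \<Rightarrow> 'a pair_pre_digraph \<Rightarrow> bool" where
  "induced_minor_free H G \<longleftrightarrow>
     \<not> (\<exists>G'. minor_step\<^sup>*\<^sup>* G G' \<and> digraph_iso (with_proj G') (with_proj H))"

text \<open>\<open>K\<^bsub>2,q\<^esub>\<close> is a predicate that holds for all its isomorphic copies, so the quantifier over copies
  \<open>H\<close> on natural numbers below just selects a representative.\<close>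

definition K2q_induced_minor_free :: "nat \<Rightarrow> 'a pair_pre_digraph \<Rightarrow> bool" where
  "K2q_induced_minor_free q G \<longleftrightarrow>
     (\<forall>H :: nat pair_pre_digraph. K\<^bsub>2,q\<^esub> (with_proj H) \<longrightarrow> induced_minor_free H G)"

definition independent_set :: "'a pair_pre_digraph \<Rightarrow> 'a set \<Rightarrow> bool" where
  "independent_set G I \<longleftrightarrow> I \<subseteq> pverts G \<and> (\<forall>u\<in>I. \<forall>v\<in>I. (u, v) \<notin> parcs G)"

definition max_weight_independent_set ::
  "'a pair_pre_digraph \<Rightarrow> ('a \<Rightarrow> rat) \<Rightarrow> 'a set \<Rightarrow> bool" where
  "max_weight_independent_set G w I \<longleftrightarrow>
     independent_set G I \<and> (\<forall>J. independent_set G J \<longrightarrow> sum w J \<le> sum w I)"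

section \<open>A word RAM with rational weights\<close>

text \<open>
  Algorithms are programs of a structured language over the memory of a random access machine: a
  program uses finitely many registers and arrays of machine words and finitely many arrays of
  rationals. Every operation, memory access and test takes unit time.

  Words are natural numbers below a modulus \<open>M\<close> and support the usual word arithmetic modulo \<open>M\<close>
  (with truncated subtraction). Rationals can only be moved, added, subtracted and compared; in
  particular they cannot be multiplied, rounded, or converted to words, so no computation can be
  hidden in the digits of large numbers.
\<close>

datatype aexp =
    N nat
  | V string
  | Arr string aexp
  | Plus aexp aexp
  | Minus aexp aexp
  | Times aexp aexp
  | Div aexp aexp
  | Mod aexp aexp

datatype wexp =
    WZero
  | WArr string aexp
  | WPlus wexp wexp
  | WMinus wexp wexp

datatype bexp =
    Less aexp aexp
  | WLess wexp wexp
  | BNot bexp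
  | BAnd bexp bexp

datatype com =
    Skip
  | Assign string aexp
  | Store string aexp aexp
  | WStore string aexp wexp
  | Seq com com
  | If bexp com com
  | While bexp com

record state =
  reg :: "string \<Rightarrow> nat"
  arr :: "string \<Rightarrow> nat \<Rightarrow> nat"
  warr :: "string \<Rightarrow> nat \<Rightarrow> rat"

fun aval :: "nat \<Rightarrow> state \<Rightarrow> aexp \<Rightarrow> nat" where
  "aval M s (N c) = c mod M"
| "aval M s (V x) = reg s x"
| "aval M s (Arr a i) = arr s a (aval M s i)"
| "aval M s (Plus a b) = (aval M s a + aval M s b) mod M"
| "aval M s (Minus a b) = (aval M s a - aval M s b) mod M"
| "aval M s (Times a b) = (aval M s a * aval M s b) mod M"
| "aval M s (Div a b) = (aval M s a div aval M s b) mod M"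
| "aval M s (Mod a b) = (aval M s a mod aval M s b) mod M"

fun wval :: "nat \<Rightarrow> state \<Rightarrow> wexp \<Rightarrow> rat" where
  "wval M s WZero = 0"
| "wval M s (WArr a i) = warr s a (aval M s i)"
| "wval M s (WPlus a b) = wval M s a + wval M s b"
| "wval M s (WMinus a b) = wval M s a - wval M s b"

fun bval :: "nat \<Rightarrow> state \<Rightarrow> bexp \<Rightarrow> bool" where
  "bval M s (Less a b) \<longleftrightarrow> aval M s a < aval M s b"
| "bval M s (WLess a b) \<longleftrightarrow> wval M s a < wval M s b"
| "bval M s (BNot b) \<longleftrightarrow> \<not> bval M s b"
| "bval M s (BAnd b c) \<longleftrightarrow> bval M s b \<and> bval M s c"

fun acost :: "aexp \<Rightarrow> nat" where
  "acost (N c) = 1"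
| "acost (V x) = 1"
| "acost (Arr a i) = acost i + 1"
| "acost (Plus a b) = acost a + acost b + 1"
| "acost (Minus a b) = acost a + acost b + 1"
| "acost (Times a b) = acost a + acost b + 1"
| "acost (Div a b) = acost a + acost b + 1"
| "acost (Mod a b) = acost a + acost b + 1"

fun wcost :: "wexp \<Rightarrow> nat" where
  "wcost WZero = 1"
| "wcost (WArr a i) = acost i + 1"
| "wcost (WPlus a b) = wcost a + wcost b + 1"
| "wcost (WMinus a b) = wcost a + wcost b + 1"

fun bcost :: "bexp \<Rightarrow> nat" where
  "bcost (Less a b) = acost a + acost b + 1"
| "bcost (WLess a b) = wcost a + wcost b + 1"
| "bcost (BNot b) = bcost b + 1"
| "bcost (BAnd b c) = bcost b + bcost c + 1"

definition set_reg :: "string \<Rightarrow> nat \<Rightarrow> state \<Rightarrow> state" where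
  "set_reg x v s = s\<lparr>reg := (reg s)(x := v)\<rparr>"

definition set_arr :: "string \<Rightarrow> nat \<Rightarrow> nat \<Rightarrow> state \<Rightarrow> state" where
  "set_arr a i v s = s\<lparr>arr := (arr s)(a := (arr s a)(i := v))\<rparr>"

definition set_warr :: "string \<Rightarrow> nat \<Rightarrow> rat \<Rightarrow> state \<Rightarrow> state" where
  "set_warr a i v s = s\<lparr>warr := (warr s)(a := (warr s a)(i := v))\<rparr>"

text \<open>\<open>exec M c s t s'\<close>: with word modulus \<open>M\<close>, program \<open>c\<close> started in \<open>s\<close> halts in \<open>s'\<close> after
  \<open>t\<close> units of time.\<close>

inductive exec :: "nat \<Rightarrow> com \<Rightarrow> state \<Rightarrow> nat \<Rightarrow> state \<Rightarrow> bool" for M where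
  Skip: "exec M Skip s 1 s"
| Assign: "exec M (Assign x a) s (acost a + 1) (set_reg x (aval M s a) s)"
| Store: "exec M (Store x i a) s (acost i + acost a + 1)
            (set_arr x (aval M s i) (aval M s a) s)"
| WStore: "exec M (WStore x i a) s (acost i + wcost a + 1)
            (set_warr x (aval M s i) (wval M s a) s)"
| Seq: "exec M c s t s' \<Longrightarrow> exec M d s' t' s'' \<Longrightarrow> exec M (Seq c d) s (t + t') s''"
| IfTrue: "bval M s b \<Longrightarrow> exec M c s t s' \<Longrightarrow> exec M (If b c d) s (bcost b + 1 + t) s'"
| IfFalse: "\<not> bval M s b \<Longrightarrow> exec M d s t s' \<Longrightarrow> exec M (If b c d) s (bcost b + 1 + t) s'"
| WhileFalse: "\<not> bval M s b \<Longrightarrow> exec M (While b c) s (bcost b + 1) s"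
| WhileTrue: "bval M s b \<Longrightarrow> exec M c s t s' \<Longrightarrow> exec M (While b c) s' t' s''
            \<Longrightarrow> exec M (While b c) s (bcost b + 1 + t + t') s''"

lemma exec_deterministic:
  "exec M c s t s' \<Longrightarrow> exec M c s u s'' \<Longrightarrow> u = t \<and> s'' = s'"
proof (induction arbitrary: u s'' rule: exec.induct)
  case (WhileTrue s b c t s' t' s2)
  from WhileTrue.prems WhileTrue.hyps(1) obtain t1 r t2 where
    "exec M c s t1 r" "exec M (While b c) r t2 s''" "u = bcost b + 1 + t1 + t2"
    by (auto elim: exec.cases)
  with WhileTrue.IH show ?case by blast
next
  case (Seq c s t s' d t' s2)
  from Seq.prems obtain t1 r t2 where
    "exec M c s t1 r" "exec M d r t2 s''" "u = t1 + t2"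
    by (auto elim: exec.cases)
  with Seq.IH show ?case by blast
next
  case (IfTrue s b c t s' d)
  from IfTrue.prems IfTrue.hyps(1) obtain t1 where
    "exec M c s t1 s''" "u = bcost b + 1 + t1"
    by (auto elim: exec.cases)
  with IfTrue.IH show ?case by blast
next
  case (IfFalse s b d t s' c)
  from IfFalse.prems IfFalse.hyps(1) obtain t1 where
    "exec M d s t1 s''" "u = bcost b + 1 + t1"
    by (auto elim: exec.cases)
  with IfFalse.IH show ?case by blast
qed (auto elim: exec.cases)

section \<open>Solving Max Weight Independent Set\<close>

text \<open>
  The input graph has vertex set \<open>{0, \<dots>, n - 1}\<close> and is given by \<open>n\<close>, its adjacency matrix (row by
  row) and the weights. All other memory cells are initially zero.
\<close>

definition mwis_input :: "nat \<Rightarrow> nat pair_pre_digraph \<Rightarrow> (nat \<Rightarrow> rat) \<Rightarrow> state" where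
  "mwis_input n G w =
     \<lparr> reg = (\<lambda>_. 0)(''n'' := n),
       arr = (\<lambda>_ _. 0)(''adj'' :=
         (\<lambda>i. if i < n * n \<and> (i div n, i mod n) \<in> parcs G then 1 else 0)),
       warr = (\<lambda>_ _. 0)(''weight'' := (\<lambda>v. if v < n then w v else 0)) \<rparr>"

definition mwis_output :: "nat \<Rightarrow> state \<Rightarrow> nat set" where
  "mwis_output n s = {v. v < n \<and> arr s ''out'' v \<noteq> 0}"

text \<open>
  Solvability in time \<open>O(f(n))\<close> on the \<open>n\<close>-vertex graphs of a class \<open>\<G>\<close>: one program, with words of
  \<open>O(log n)\<close> bits (i.e. a modulus polynomial in \<open>n\<close>), works for all graphs of the class and all
  weights.
\<close>

definition mwis_solvable_in_time :: "nat pair_pre_digraph set \<Rightarrow> (nat \<Rightarrow> real) \<Rightarrow> bool" where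
  "mwis_solvable_in_time \<G> f \<longleftrightarrow>
     (\<exists>prog k T. (\<lambda>n. real (T n)) \<in> O(f) \<and>
        (\<forall>n G w. pair_graph G \<and> pverts G = {..<n} \<and> G \<in> \<G> \<and> (\<forall>v<n. 0 \<le> w v) \<longrightarrow>
           (\<exists>t s. exec ((n + 2) ^ k) prog (mwis_input n G w) t s \<and> t \<le> T n \<and>
                  max_weight_independent_set G w (mwis_output n s))))"

end

theory Submission
  imports Defs
begin

text \<open>
  Put \<open>k = q - 1\<close>. If \<open>A\<close> and \<open>B\<close> are disjoint connected vertex sets without edges between them, then an
  independent set in which every vertex has neighbours in both \<open>A\<close> and \<open>B\<close> has at most \<open>k\<close> elements:
  otherwise contracting \<open>A\<close> and \<open>B\<close> gives an induced minor \<open>K\<^bsub>2,q\<^esub>\<close>. So a neighbourhood \<open>N(C)\<close> of a connected set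
  \<open>C\<close> that is also dominated by a connected set (a hub) anticomplete to \<open>C\<close> has independence number at
  most \<open>k\<close>.

  The graph is taken apart by removing vertices while keeping the following invariant for every
  component \<open>C\<close> of the remaining graph: \<open>N(C)\<close> is the union of a clique \<open>K\<close> and a set \<open>F\<close> that is either a
  clique or dominated by a hub. If \<open>N(C)\<close> is a clique, remove any vertex of \<open>C\<close>. Otherwise pick
  nonadjacent \<open>x, y \<in> N(C)\<close>, both from \<open>F\<close> if possible and else \<open>x \<in> K\<close>, \<open>y \<in> F\<close>, and remove the minimal
  \<open>x\<close>-\<open>y\<close>-separator \<open>T \<subseteq> C \<inter> N(x)\<close> of the graph induced by \<open>C\<close> with \<open>x\<close> and \<open>y\<close>. Each new component misses \<open>x\<close> or
  \<open>y\<close>, so that \<open>x\<close>, or the component of \<open>y\<close>, extends a hub (or becomes one) and dominates \<open>T\<close> as well.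
  Hence every bag lies in \<open>K \<union> F \<union> T\<close> and has independence number at most \<open>2k + 1 = 2q - 1\<close>.

  Dynamic programming along the elimination tree indexes its tables by tuples of at most \<open>2q - 1\<close>
  vertices. Each vertex pushes its table into the table of its parent, which costs \<open>O(n\<^sup>2\<^sup>q\<^sup>-\<^sup>1)\<close> per vertex,
  and the order itself is computed in time \<open>O(n\<^sup>4)\<close>.
\<close>

section \<open>Induced minors and hubs\<close>

text \<open>Bags may be large, as large as G if G is complete; only their independence number is
  bounded. Tables therefore range over independent subsets of a bag, written as tuples of 2q - 1
  digits in base n + 1, some of them blank. The split of N(C) into K and F handles neighbourhoods
  for which no hub need exist: removing a vertex z below a clique N(C) leaves neighbourhoods covered
  by the two cliques N(C) and {z}. Hubs come in once these cliques are not completely joined and a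
  separator is removed. The separator is taken inside N(x) because two connected sets anticomplete
  to each other then dominate it, {x} and the component of y. This bounds its own independence
  number by k and leaves a dominating set for each new component, whichever of the two that
  component avoids. In the hub case, F, K and T contribute k, 1 and k. A push concerns one parent
  only; collecting from children in loops of fixed length would cost another factor n per cell. The
  assumption q >= 2 gives 4 <= 2q, which pays for the ordering.\<close>

definition restrict_verts :: "'a pair_pre_digraph \<Rightarrow> 'a set \<Rightarrow> 'a pair_pre_digraph" where
  "restrict_verts G X = \<lparr> pverts = pverts G \<inter> X, parcs = parcs G \<inter> X \<times> X \<rparr>"

text \<open>Vertices are deleted one after another; complements let the induction start at
  \<open>restrict_verts G UNIV\<close>, which equals \<open>G\<close>.\<close>

lemma restrict_verts_reachable:
  assumes "finite Y" "Y \<subseteq> pverts G"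
  shows "minor_step\<^sup>*\<^sup>* (restrict_verts G UNIV) (restrict_verts G (- Y))"
  using assms
proof (induction Y rule: finite_induct)
  case (insert v Y)
  have "delete_vertex v (restrict_verts G (- Y)) = restrict_verts G (- insert v Y)"
    by (auto simp: delete_vertex_def restrict_verts_def)
  moreover have "minor_step (restrict_verts G (- Y)) (delete_vertex v (restrict_verts G (- Y)))"
    using insert by (intro minor_step.deletion) (auto simp: restrict_verts_def)
  ultimately show ?case
    using insert by (metis insert_subset rtranclp.rtrancl_into_rtrancl)
qed simp

text \<open>For singletons \<open>A\<close> and \<open>B\<close> these conditions describe K_{2,m}
  with m = card \<open>I\<close>. In general, contracting the connected sets \<open>A\<close> and
  \<open>B\<close> is all that is left to do.\<close>

definition hub_pair :: "'a pair_pre_digraph \<Rightarrow> 'a set \<Rightarrow> 'a set \<Rightarrow> 'a set \<Rightarrow> bool" where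
  "hub_pair G A B I \<longleftrightarrow>
     finite (pverts G) \<and> pverts G = A \<union> B \<union> I \<and> A \<inter> B = {} \<and> I \<inter> (A \<union> B) = {} \<and> A \<noteq> {} \<and> B \<noteq> {} \<and>
     parcs G \<subseteq> pverts G \<times> pverts G \<and> sym (parcs G) \<and> irrefl (parcs G) \<and>
     (\<forall>a\<in>A. \<forall>b\<in>A. (a, b) \<in> (parcs G \<inter> A \<times> A)\<^sup>*) \<and> (\<forall>a\<in>B. \<forall>b\<in>B. (a, b) \<in> (parcs G \<inter> B \<times> B)\<^sup>*) \<and>
     parcs G \<inter> A \<times> B = {} \<and> parcs G \<inter> I \<times> I = {} \<and>
     (\<forall>i\<in>I. (\<exists>a\<in>A. (a, i) \<in> parcs G) \<and> (\<exists>b\<in>B. (b, i) \<in> parcs G))"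

lemma hub_pair_swap: "hub_pair G A B I \<Longrightarrow> hub_pair G B A I"
  unfolding hub_pair_def by (elim conjE, intro conjI; (assumption | auto dest: symD))

text \<open>A contraction can shrink an arc of a path to a point, so the image of an arc is only
  asked to lie in the reflexive transitive closure.\<close>

lemma rtrancl_map:
  assumes "(a, b) \<in> R\<^sup>*" "\<And>x y. (x, y) \<in> R \<Longrightarrow> (f x, f y) \<in> S\<^sup>*"
  shows "(f a, f b) \<in> S\<^sup>*"
  using assms(1) by (induction rule: rtrancl_induct) (auto intro: rtrancl_trans assms(2))

text \<open>Paths inside \<open>A\<close> are mapped to paths, so \<open>A - {v}\<close> stays
  connected. Arcs at \<open>v\<close> become arcs at \<open>u\<close>, which lies in
  \<open>A\<close> as well: no contact with \<open>I\<close> is lost and no arc to \<open>B\<close>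
  can arise.\<close>

lemma hub_pair_contract:
  assumes H: "hub_pair G A B I" and uv: "(u, v) \<in> parcs G" "u \<in> A" "v \<in> A"
  shows "hub_pair (contract_edge u v G) (A - {v}) B I"
proof -
  let ?f = "\<lambda>x. if x = v then u else x"
  let ?G = "contract_edge u v G"
  have sym: "sym (parcs G)" and irr: "irrefl (parcs G)" and sub: "parcs G \<subseteq> pverts G \<times> pverts G"
    and V: "pverts G = A \<union> B \<union> I" and d1: "A \<inter> B = {}" and d2: "I \<inter> (A \<union> B) = {}" and B: "B \<noteq> {}"
    and fin: "finite (pverts G)"
    and cA: "\<And>a b. a\<in>A \<Longrightarrow> b\<in>A \<Longrightarrow> (a, b) \<in> (parcs G \<inter> A \<times> A)\<^sup>*"
    and cB: "\<And>a b. a\<in>B \<Longrightarrow> b\<in>B \<Longrightarrow> (a, b) \<in> (parcs G \<inter> B \<times> B)\<^sup>*"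
    and nAB: "\<And>a b. a \<in> A \<Longrightarrow> b \<in> B \<Longrightarrow> (a, b) \<notin> parcs G"
    and nII: "\<And>a b. a \<in> I \<Longrightarrow> b \<in> I \<Longrightarrow> (a, b) \<notin> parcs G"
    and hA: "\<And>i. i \<in> I \<Longrightarrow> \<exists>a\<in>A. (a, i) \<in> parcs G" and hB: "\<And>i. i \<in> I \<Longrightarrow> \<exists>a\<in>B. (a, i) \<in> parcs G"
    using H unfolding hub_pair_def by blast+
  have uneqv: "u \<noteq> v" using irr uv by (auto simp: irrefl_def)
  have PV: "pverts ?G = pverts G - {v}" by (simp add: contract_edge_def Let_def)
  have PA: "parcs ?G = {(?f x, ?f y) | x y. (x, y) \<in> parcs G \<and> ?f x \<noteq> ?f y}"
    by (simp add: contract_edge_def Let_def)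
  have arcI: "(?f x, ?f y) \<in> parcs ?G" if "(x, y) \<in> parcs G" "?f x \<noteq> ?f y" for x y
    unfolding PA using that by blast
  have conA: "(a, b) \<in> (parcs ?G \<inter> (A - {v}) \<times> (A - {v}))\<^sup>*" if "a \<in> A - {v}" "b \<in> A - {v}" for a b
  proof -
    have "(?f a, ?f b) \<in> (parcs ?G \<inter> (A - {v}) \<times> (A - {v}))\<^sup>*"
    proof (rule rtrancl_map[of a b "parcs G \<inter> A \<times> A"])
      show "(a, b) \<in> (parcs G \<inter> A \<times> A)\<^sup>*" using cA that by blast
      fix x y assume xy: "(x, y) \<in> parcs G \<inter> A \<times> A"
      show "(?f x, ?f y) \<in> (parcs ?G \<inter> (A - {v}) \<times> (A - {v}))\<^sup>*"
      proof (cases "?f x = ?f y")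
        case False
        then have "(?f x, ?f y) \<in> parcs ?G \<inter> (A - {v}) \<times> (A - {v})"
          using xy arcI[of x y] uv uneqv by auto
        then show ?thesis by (rule r_into_rtrancl)
      qed (simp only: rtrancl.rtrancl_refl)
    qed
    then show ?thesis using that by simp
  qed
  have conB: "(a, b) \<in> (parcs ?G \<inter> B \<times> B)\<^sup>*" if "a \<in> B" "b \<in> B" for a b
  proof -
    have "parcs G \<inter> B \<times> B \<subseteq> parcs ?G \<inter> B \<times> B"
    proof safe
      fix x y assume xy: "(x, y) \<in> parcs G" "x \<in> B" "y \<in> B"
      then have "x \<noteq> v" "y \<noteq> v" "x \<noteq> y" using uv d1 irr by (auto simp: irrefl_def)
      then show "(x, y) \<in> parcs ?G" using arcI[of x y] xy by simp
    qed
    from rtrancl_mono[OF this] show ?thesis using cB[OF that] by blast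
  qed
  have symG: "(y, x) \<in> parcs G" if "(x, y) \<in> parcs G" for x y using sym that by (rule symD)
  have s: "sym (parcs ?G)"
  proof (rule symI)
    fix x y assume "(x, y) \<in> parcs ?G"
    then obtain x' y' where xy: "x = ?f x'" "y = ?f y'" "(x', y') \<in> parcs G" "?f x' \<noteq> ?f y'"
      unfolding PA by blast
    show "(y, x) \<in> parcs ?G"
      unfolding xy(1,2) by (rule arcI[OF symG[OF xy(3)] not_sym[OF xy(4)]])
  qed
  have ir: "irrefl (parcs ?G)" unfolding PA irrefl_def by auto
  have su: "parcs ?G \<subseteq> pverts ?G \<times> pverts ?G" unfolding PA PV using sub uv uneqv by auto
  have n1: "parcs ?G \<inter> (A - {v}) \<times> B = {}"
  proof -
    have False if "(x, y) \<in> parcs G" "?f x \<in> A - {v}" "?f y \<in> B" for x y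
    proof -
      have "y \<noteq> v" using that uv d1 by auto
      moreover have "x \<in> A" using that uv by (auto split: if_splits)
      ultimately show False using nAB that by auto
    qed
    then show ?thesis unfolding PA by blast
  qed
  have n2: "parcs ?G \<inter> I \<times> I = {}"
  proof -
    have False if "(x, y) \<in> parcs G" "?f x \<in> I" "?f y \<in> I" for x y
    proof -
      have "y \<noteq> v" "x \<noteq> v" using that uv d2 by auto
      then show False using nII that by auto
    qed
    then show ?thesis unfolding PA by blast
  qed
  have k1: "\<exists>a\<in>A - {v}. (a, i) \<in> parcs ?G" if "i \<in> I" for i
  proof -
    obtain a where a: "a \<in> A" "(a, i) \<in> parcs G" using hA[OF \<open>i \<in> I\<close>] by blast
    have "i \<noteq> v" "i \<notin> A" using that d2 uv by auto
    then have "i \<noteq> v" "?f a \<noteq> i" using a uv by auto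
    then have "(?f a, i) \<in> parcs ?G" using arcI[OF a(2)] by simp
    then show ?thesis using a uv uneqv by (metis Diff_iff singletonD)
  qed
  have k2: "\<exists>a\<in>B. (a, i) \<in> parcs ?G" if "i \<in> I" for i
  proof -
    obtain a where a: "a \<in> B" "(a, i) \<in> parcs G" using hB[OF \<open>i \<in> I\<close>] by blast
    have "i \<noteq> v" "i \<notin> B" "a \<noteq> v" using that d2 d1 uv a by auto
    moreover have "a \<noteq> i" using a calculation by auto
    ultimately have "(a, i) \<in> parcs ?G" using arcI[OF a(2)] by simp
    then show ?thesis using a by blast
  qed
  show ?thesis unfolding hub_pair_def
  proof (intro conjI ballI)
    show "finite (pverts ?G)" using fin PV by simp
    show "pverts ?G = A - {v} \<union> B \<union> I" using PV V uv d1 d2 by auto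
    show "A - {v} \<noteq> {}" using uv uneqv by auto
    show "(A - {v}) \<inter> B = {}" using d1 by blast
    show "I \<inter> (A - {v} \<union> B) = {}" using d2 by blast
  qed (rule B su s ir n1 n2 | (rule conA conB k1 k2, assumption+))+
qed

text \<open>The two sets shrink by one edge at a time; \<open>hub_pair_swap\<close> allows the step
  to be carried out for the first set only.\<close>

lemma hub_pair_minor:
  assumes "hub_pair G A B I"
  shows "\<exists>G' a b. minor_step\<^sup>*\<^sup>* G G' \<and> hub_pair G' {a} {b} I"
  using assms
proof (induction "card A + card B" arbitrary: G A B rule: less_induct)
  case less
  have step: ?case if H: "hub_pair G A' B' I" and c: "card A' + card B' = card A + card B"
    and two: "\<not> (\<exists>a. A' = {a})" for A' B'
  proof -
    have fin: "finite A'" and "A' \<noteq> {}" using H unfolding hub_pair_def by auto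
    then obtain a b where ab: "a \<in> A'" "b \<in> A'" "a \<noteq> b" using two by blast
    have "(a, b) \<in> (parcs G \<inter> A' \<times> A')\<^sup>*" using H ab unfolding hub_pair_def by blast
    \<comment> \<open>\<open>v\<close> is the second vertex on a path from \<open>a\<close> to
      \<open>b\<close> inside \<open>A'\<close>, which gives an edge to contract.\<close>
    then obtain v where v: "(a, v) \<in> parcs G" "v \<in> A'"
      using ab(3) by (meson IntD1 IntD2 SigmaD2 converse_rtranclE)
    have ms: "minor_step G (contract_edge a v G)" using v by (intro minor_step.contraction)
    have "card (A' - {v}) < card A'" using fin v(2) by (metis card_Diff1_less)
    then have "card (A' - {v}) + card B' < card A + card B" using c by linarith
    from less.hyps[OF this hub_pair_contract[OF H v(1) ab(1) v(2)]]
    obtain G' a' b' where "minor_step\<^sup>*\<^sup>* (contract_edge a v G) G'" "hub_pair G' {a'} {b'} I" by blast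
    then show ?thesis using converse_rtranclp_into_rtranclp[of minor_step, OF ms] by blast
  qed
  show ?case
  proof (cases "\<exists>a b. A = {a} \<and> B = {b}")
    case True then show ?thesis using less.prems by blast
  next
    case False
    then show ?thesis
      using step[OF less.prems refl] step[OF hub_pair_swap[OF less.prems] add.commute] by blast
  qed
qed

text \<open>\<open>K2q_induced_minor_free\<close> excludes every copy of K_{2,q}; the minor that is
  found is itself such a copy and is compared with itself.\<close>

lemma digraph_iso_with_proj_refl:
  assumes "pair_graph G"
  shows "digraph_iso (with_proj G) (with_proj G)"
proof -
  interpret pair_graph G by fact
  define h where "h = \<lparr> iso_verts = (\<lambda>v::'a. v), iso_arcs = (\<lambda>a::'a\<times>'a. a), iso_head = snd, iso_tail = fst \<rparr>"
  have "pre_digraph.digraph_isomorphism (with_proj G) h"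
    unfolding pre_digraph.digraph_isomorphism_def h_def
    using wf_digraph_axioms by auto
  moreover have "with_proj G = app_iso h (with_proj G)"
    by (simp add: app_iso_def h_def with_proj_def)
  ultimately show ?thesis unfolding digraph_iso_def by blast
qed

lemma K2q_free_hub_bound:
  fixes G :: "nat pair_pre_digraph"
  assumes G: "pair_graph G" and free: "K2q_induced_minor_free q G" and q: "q > 0"
    and AB: "A \<subseteq> pverts G" "B \<subseteq> pverts G" "A \<inter> B = {}" "parcs G \<inter> A \<times> B = {}"
    and cA: "\<And>a b. a\<in>A \<Longrightarrow> b\<in>A \<Longrightarrow> (a, b) \<in> (parcs G \<inter> A \<times> A)\<^sup>*"
    and cB: "\<And>a b. a\<in>B \<Longrightarrow> b\<in>B \<Longrightarrow> (a, b) \<in> (parcs G \<inter> B \<times> B)\<^sup>*"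
    and I: "independent_set G I" "I \<inter> (A \<union> B) = {}"
    and hubs: "\<And>i. i \<in> I \<Longrightarrow> \<exists>a\<in>A. (a, i) \<in> parcs G" "\<And>i. i \<in> I \<Longrightarrow> \<exists>b\<in>B. (b, i) \<in> parcs G"
  shows "card I < q"
proof (rule ccontr)
  interpret pair_graph G by fact
  assume "\<not> card I < q"
  \<comment> \<open>Exactly \<open>q\<close> common neighbours are kept and the others deleted, so
    that the minor is K_{2,q} and nothing larger.\<close>
  then obtain J where J: "J \<subseteq> I" "card J = q" "finite J"
    by (meson leI obtain_subset_with_card_n)
  let ?X = "A \<union> B \<union> J"
  have IV: "I \<subseteq> pverts G" using I(1) unfolding independent_set_def by blast
  have fin: "finite (pverts G)" by (rule pair_finite_verts)
  have XV: "?X \<subseteq> pverts G" using AB J IV by blast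
  \<comment> \<open>\<open>q > 0\<close> yields a common neighbour, whose own neighbours witness
    that \<open>A\<close> and \<open>B\<close> are nonempty.\<close>
  have J0: "J \<noteq> {}" using J q by auto
  have mono: "parcs G \<inter> A \<times> A \<subseteq> parcs G \<inter> ?X \<times> ?X \<inter> A \<times> A"
       "parcs G \<inter> B \<times> B \<subseteq> parcs G \<inter> ?X \<times> ?X \<inter> B \<times> B" by auto
  have "hub_pair (restrict_verts G ?X) A B J"
    unfolding hub_pair_def
  proof (intro conjI ballI)
    show "sym (parcs (restrict_verts G ?X))" 
      using pair_sym_arcs unfolding symmetric_def restrict_verts_def sym_def by auto
    show "irrefl (parcs (restrict_verts G ?X))"
      using pair_no_loops unfolding irrefl_def restrict_verts_def by force
    show "pverts (restrict_verts G ?X) = ?X" using XV by (auto simp: restrict_verts_def)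
    show "A \<noteq> {}" "B \<noteq> {}" using J0 J(1) hubs by blast+
    show "parcs (restrict_verts G ?X) \<inter> A \<times> B = {}" using AB by (auto simp: restrict_verts_def)
    show "parcs (restrict_verts G ?X) \<inter> J \<times> J = {}"
      using I(1) J(1) unfolding independent_set_def restrict_verts_def pair_pre_digraph.simps by blast
    show "A \<inter> B = {}" by fact
    show "J \<inter> (A \<union> B) = {}" using I J by blast
    show "finite (pverts (restrict_verts G ?X))" using fin by (auto simp: restrict_verts_def)
    show "parcs (restrict_verts G ?X) \<subseteq> pverts (restrict_verts G ?X) \<times> pverts (restrict_verts G ?X)"
      using XV by (auto simp: restrict_verts_def)
  next
    fix a b assume "a \<in> A" "b \<in> A"
    then show "(a, b) \<in> (parcs (restrict_verts G ?X) \<inter> A \<times> A)\<^sup>*"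
      using rtrancl_mono[OF mono(1)] cA by (auto simp: restrict_verts_def)
  next
    fix a b assume "a \<in> B" "b \<in> B"
    then show "(a, b) \<in> (parcs (restrict_verts G ?X) \<inter> B \<times> B)\<^sup>*"
      using rtrancl_mono[OF mono(2)] cB by (auto simp: restrict_verts_def)
  next
    fix i assume "i \<in> J"
    then show "\<exists>a\<in>A. (a, i) \<in> parcs (restrict_verts G ?X)" "\<exists>b\<in>B. (b, i) \<in> parcs (restrict_verts G ?X)"
      using hubs[of i] J by (auto simp: restrict_verts_def)
  qed
  then obtain G' a b where G': "minor_step\<^sup>*\<^sup>* (restrict_verts G ?X) G'" "hub_pair G' {a} {b} J"
    using hub_pair_minor by blast
  have "minor_step\<^sup>*\<^sup>* G (restrict_verts G ?X)"
  proof -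
    have "restrict_verts G UNIV = G" unfolding restrict_verts_def by (cases G) auto
    moreover have "restrict_verts G (- (pverts G - ?X)) = restrict_verts G ?X"
      using in_arcsD1 in_arcsD2 by (auto simp: restrict_verts_def)
    ultimately show ?thesis
      using restrict_verts_reachable[of "pverts G - ?X" G] fin by (metis Diff_subset finite_Diff)
  qed
  then have reach: "minor_step\<^sup>*\<^sup>* G G'" using G' by auto
  have K: "K\<^bsub>2,q\<^esub> (with_proj G')"
    unfolding complete_bipartite_digraph_pair_def
  proof (intro conjI exI)
    show "finite (pverts G')" using G' unfolding hub_pair_def by blast
    show "pverts G' = {a, b} \<union> J" using G' unfolding hub_pair_def by auto
    show "{a, b} \<inter> J = {}" using G' unfolding hub_pair_def by auto
    show "card {a, b} = 2" using G'(2) unfolding hub_pair_def by auto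
    show "card J = q" by fact
    have *: "parcs G' \<subseteq> pverts G' \<times> pverts G'" "pverts G' = {a} \<union> {b} \<union> J" "sym (parcs G')" "irrefl (parcs G')"
      "parcs G' \<inter> {a} \<times> {b} = {}" "parcs G' \<inter> J \<times> J = {}"
      "\<forall>i\<in>J. (a, i) \<in> parcs G' \<and> (b, i) \<in> parcs G'"
      using G'(2) unfolding hub_pair_def by auto
    have no: "(b, a) \<notin> parcs G'" "(a, b) \<notin> parcs G'"
      using *(5) symD[OF *(3)] by blast+
    have irr: "(x, x) \<notin> parcs G'" for x using *(4) by (simp add: irrefl_def)
    have "(x, y) \<in> {a, b} \<times> J \<union> J \<times> {a, b}" if xy: "(x, y) \<in> parcs G'" for x y
    proof -
      have "x \<in> {a} \<union> {b} \<union> J" "y \<in> {a} \<union> {b} \<union> J" using subsetD[OF *(1) xy] *(2) by auto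
      moreover have "\<not> (x \<in> J \<and> y \<in> J)" using *(6) xy by blast
      moreover have "x \<noteq> y" using irr xy by auto
      ultimately show ?thesis using no xy by auto
    qed
    moreover have "(x, y) \<in> parcs G'" if "x \<in> {a, b}" "y \<in> J" for x y
      using *(7) that by auto
    moreover have "(y, x) \<in> parcs G'" if "x \<in> {a, b}" "y \<in> J" for x y
      using *(7) that by (auto intro: symD[OF *(3)])
    ultimately show "parcs G' = {a, b} \<times> J \<union> J \<times> {a, b}" by auto
  qed
  then have "digraph_iso (with_proj G') (with_proj G')"
    by (intro digraph_iso_with_proj_refl pair_graphI_complete_bipartite)
  with K reach free show False
    unfolding K2q_induced_minor_free_def induced_minor_free_def by blast
qed

section \<open>Separators and elimination orders\<close>

locale fgraph =
  fixes V :: "'a set" and E :: "'a \<Rightarrow> 'a \<Rightarrow> bool"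
  assumes finV: "finite V" and symE: "E u v \<Longrightarrow> E v u" and irrE: "\<not> E v v"
    and EV: "E u v \<Longrightarrow> u \<in> V"
begin

lemma EV2: "E u v \<Longrightarrow> v \<in> V" using EV symE by blast

definition conn :: "'a set \<Rightarrow> bool" where
  "conn D \<longleftrightarrow> (\<forall>a\<in>D. \<forall>b\<in>D. (a, b) \<in> {(a, b). E a b \<and> a \<in> D \<and> b \<in> D}\<^sup>*)"

text \<open>Only the vertices after \<open>z\<close> have to lie in \<open>U\<close>. For
  \<open>z\<close> in \<open>U\<close> this is the component of \<open>z\<close>; for
  \<open>z\<close> outside \<open>U\<close>, as in \<open>side\<close>, it is \<open>z\<close> with
  everything accessible from it through \<open>U\<close>.\<close>

definition reach :: "'a set \<Rightarrow> 'a \<Rightarrow> 'a set" where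
  "reach U z = {b. (z, b) \<in> {(a, b). E a b \<and> b \<in> U}\<^sup>*}"

definition nbhd :: "'a set \<Rightarrow> 'a set" where
  "nbhd X = {u. u \<notin> X \<and> (\<exists>a\<in>X. E a u)}"

text \<open>Closure under edges of \<open>U\<close> replaces maximality; with connectedness it
  determines the component from any of its vertices, see \<open>is_comp_eq\<close>.\<close>

definition is_comp :: "'a set \<Rightarrow> 'a set \<Rightarrow> bool" where
  "is_comp U X \<longleftrightarrow> X \<subseteq> U \<and> X \<noteq> {} \<and> conn X \<and> (\<forall>a\<in>X. \<forall>b\<in>U. E a b \<longrightarrow> b \<in> X)"

definition indep :: "'a set \<Rightarrow> bool" where
  "indep I \<longleftrightarrow> I \<subseteq> V \<and> (\<forall>u\<in>I. \<forall>v\<in>I. \<not> E u v)"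

definition alpha_le :: "'a set \<Rightarrow> nat \<Rightarrow> bool" where
  "alpha_le X m \<longleftrightarrow> (\<forall>I. I \<subseteq> X \<longrightarrow> indep I \<longrightarrow> card I \<le> m)"

definition clique :: "'a set \<Rightarrow> bool" where
  "clique X \<longleftrightarrow> (\<forall>x\<in>X. \<forall>y\<in>X. x \<noteq> y \<longrightarrow> E x y)"

definition anti :: "'a set \<Rightarrow> 'a set \<Rightarrow> bool" where
  "anti A B \<longleftrightarrow> (\<forall>a\<in>A. \<forall>b\<in>B. \<not> E a b)"

definition hub :: "'a set \<Rightarrow> 'a set \<Rightarrow> bool" where
  "hub C F \<longleftrightarrow> (\<exists>D. D \<subseteq> V \<and> conn D \<and> D \<inter> C = {} \<and> anti D C \<and> (\<forall>f\<in>F. \<exists>d\<in>D. E d f))"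

lemma reach_refl: "z \<in> reach U z" by (simp add: reach_def)

lemma reach_step: "a \<in> reach U z \<Longrightarrow> E a b \<Longrightarrow> b \<in> U \<Longrightarrow> b \<in> reach U z"
  unfolding reach_def by (auto intro: rtrancl_into_rtrancl)

lemma reach_least:
  assumes "z \<in> X" "\<And>a b. a \<in> X \<Longrightarrow> b \<in> U \<Longrightarrow> E a b \<Longrightarrow> b \<in> X"
  shows "reach U z \<subseteq> X"
proof
  fix b assume "b \<in> reach U z"
  then have "(z, b) \<in> {(a, b). E a b \<and> b \<in> U}\<^sup>*" by (simp add: reach_def)
  then show "b \<in> X" by (induction rule: rtrancl_induct) (use assms in auto)
qed

lemma reach_subset: "reach U z \<subseteq> insert z U"
  by (rule reach_least) auto

lemma conn_star:
  assumes "\<And>b. b \<in> D \<Longrightarrow> (z, b) \<in> {(a, b). E a b \<and> a \<in> D \<and> b \<in> D}\<^sup>*"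
  shows "conn D"
proof -
  let ?R = "{(a, b). E a b \<and> a \<in> D \<and> b \<in> D}"
  have "sym ?R" by (auto intro!: symI symE)
  then have "sym (?R\<^sup>*)" by (rule sym_rtrancl)
  then show ?thesis unfolding conn_def using assms by (meson rtrancl_trans symD)
qed

lemma reach_conn: "conn (reach U z)"
proof (rule conn_star)
  fix b assume "b \<in> reach U z"
  then have "(z, b) \<in> {(a, b). E a b \<and> b \<in> U}\<^sup>*" by (simp add: reach_def)
  then show "(z, b) \<in> {(a, b). E a b \<and> a \<in> reach U z \<and> b \<in> reach U z}\<^sup>*"
  proof (induction rule: rtrancl_induct)
    case (step y w)
    then have "y \<in> reach U z" by (simp add: reach_def)
    with step(2) have "w \<in> reach U z" using reach_step by auto
    then show ?case using step \<open>y \<in> reach U z\<close> by (auto intro: rtrancl_into_rtrancl)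
  qed simp
qed

lemma conn_subset_closed:
  assumes "conn C" "z \<in> C" "z \<in> X" "\<And>a b. a \<in> X \<Longrightarrow> b \<in> C \<Longrightarrow> E a b \<Longrightarrow> b \<in> X"
  shows "C \<subseteq> X"
proof
  fix b assume "b \<in> C"
  then have "(z, b) \<in> {(a, b). E a b \<and> a \<in> C \<and> b \<in> C}\<^sup>*" using assms unfolding conn_def by blast
  then show "b \<in> X" by (induction rule: rtrancl_induct) (use assms in auto)
qed

lemma conn_singleton: "conn {x}" unfolding conn_def by simp

lemma conn_Un:
  assumes "conn A" "conn B" "a \<in> A" "b \<in> B" "E a b"
  shows "conn (A \<union> B)"
proof (rule conn_star)
  let ?R = "{(x, y). E x y \<and> x \<in> A \<union> B \<and> y \<in> A \<union> B}"
  have A: "{(x, y). E x y \<and> x \<in> A \<and> y \<in> A} \<subseteq> ?R" and B: "{(x, y). E x y \<and> x \<in> B \<and> y \<in> B} \<subseteq> ?R" by auto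
  fix c assume c: "c \<in> A \<union> B"
  show "(a, c) \<in> ?R\<^sup>*"
  proof (cases "c \<in> A")
    case True
    then have "(a, c) \<in> {(x, y). E x y \<and> x \<in> A \<and> y \<in> A}\<^sup>*" using assms unfolding conn_def by blast
    then show ?thesis using rtrancl_mono[OF A] by blast
  next
    case False
    then have "(b, c) \<in> {(x, y). E x y \<and> x \<in> B \<and> y \<in> B}\<^sup>*" using c assms unfolding conn_def by blast
    then have "(b, c) \<in> ?R\<^sup>*" using rtrancl_mono[OF B] by blast
    moreover have "(a, b) \<in> ?R" using assms by auto
    ultimately show ?thesis by (rule converse_rtrancl_into_rtrancl[rotated])
  qed
qed

lemma reach_is_comp: "z \<in> U \<Longrightarrow> is_comp U (reach U z)"
  unfolding is_comp_def using reach_subset[of U z] reach_refl[of z U] reach_conn reach_step by blast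

lemma is_comp_eq: "is_comp U X \<Longrightarrow> z \<in> X \<Longrightarrow> X = reach U z"
proof
  assume c: "is_comp U X" "z \<in> X"
  show "reach U z \<subseteq> X" by (rule reach_least) (use c in \<open>auto simp: is_comp_def\<close>)
  show "X \<subseteq> reach U z"
    by (rule conn_subset_closed[of X z]) (use c in \<open>auto simp: is_comp_def reach_refl intro: reach_step\<close>)
qed

lemma is_comp_disj: "is_comp U X \<Longrightarrow> is_comp U Y \<Longrightarrow> X = Y \<or> X \<inter> Y = {}"
  using is_comp_eq by blast

lemma is_comp_anti: "is_comp U X \<Longrightarrow> is_comp U Y \<Longrightarrow> X \<inter> Y = {} \<Longrightarrow> anti X Y"
  unfolding is_comp_def anti_def by blast

text \<open>Lets the separator lemmas speak about \<open>C - T\<close> alone, without the rest of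
  the remaining graph.\<close>

lemma is_comp_Diff: "is_comp U C \<Longrightarrow> X \<subseteq> C \<Longrightarrow> is_comp (U - T) X \<Longrightarrow> is_comp (C - T) X"
  unfolding is_comp_def by blast

lemma is_comp_Diff_other: "is_comp U X \<Longrightarrow> X \<inter> T = {} \<Longrightarrow> is_comp (U - T) X"
  unfolding is_comp_def by blast

lemma alpha_le_Un:
  assumes "alpha_le X a" "alpha_le Y b" shows "alpha_le (X \<union> Y) (a + b)"
  unfolding alpha_le_def
proof (intro allI impI)
  fix I assume I: "I \<subseteq> X \<union> Y" "indep I"
  then have fin: "finite I" using finV unfolding indep_def by (meson finite_subset)
  have "indep (I \<inter> X)" "indep (I \<inter> Y)" using I unfolding indep_def by blast+
  then have "card (I \<inter> X) \<le> a" "card (I \<inter> Y) \<le> b" using assms unfolding alpha_le_def by auto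
  moreover have "I = (I \<inter> X) \<union> (I \<inter> Y)" using I by blast
  then have "card I \<le> card (I \<inter> X) + card (I \<inter> Y)" by (metis card_Un_le)
  ultimately show "card I \<le> a + b" by linarith
qed

lemma alpha_le_mono: "alpha_le X a \<Longrightarrow> Y \<subseteq> X \<Longrightarrow> a \<le> b \<Longrightarrow> alpha_le Y b"
  unfolding alpha_le_def by (meson le_trans subset_trans)

lemma clique_alpha_le: "clique X \<Longrightarrow> alpha_le X 1"
  unfolding alpha_le_def
proof (intro allI impI)
  fix I assume *: "clique X" "I \<subseteq> X" "indep I"
  have "x = y" if "x \<in> I" "y \<in> I" for x y
    using * that unfolding clique_def indep_def by blast
  moreover have "finite I" using *(3) finV unfolding indep_def by (meson finite_subset)
  ultimately show "card I \<le> 1" by (simp add: card_le_Suc0_iff_eq)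
qed

lemma clique_subset: "clique X \<Longrightarrow> Y \<subseteq> X \<Longrightarrow> clique Y"
  unfolding clique_def by blast

end

text \<open>\<open>hub_card\<close> is all that the decomposition knows about the graph class; it
  will be used with k = q - 1. The bound \<open>k \<ge> 1\<close> pays for the cases in which two
  cliques share a bag: k + 2 and 2 are then at most 2k + 1.\<close>

locale hubbounded = fgraph +
  fixes k :: nat
  assumes k1: "k \<ge> 1"
    and hub_card: "\<lbrakk>conn A; conn B; A \<subseteq> V; B \<subseteq> V; A \<inter> B = {}; anti A B; indep I; I \<inter> (A \<union> B) = {};
      \<And>i. i \<in> I \<Longrightarrow> \<exists>a\<in>A. E a i; \<And>i. i \<in> I \<Longrightarrow> \<exists>b\<in>B. E b i\<rbrakk> \<Longrightarrow> card I \<le> k"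
begin

lemma hub_alpha_le:
  assumes "conn C" "C \<subseteq> V" "hub C F" "F \<subseteq> nbhd C"
  shows "alpha_le F k"
  unfolding alpha_le_def
proof (intro allI impI)
  fix I assume I: "I \<subseteq> F" "indep I"
  obtain D where D: "D \<subseteq> V" "conn D" "D \<inter> C = {}" "anti D C" "\<forall>f\<in>F. \<exists>d\<in>D. E d f"
    using assms unfolding hub_def by blast
  show "card I \<le> k"
  proof (rule hub_card[of D C])
    \<comment> \<open>A vertex of \<open>F\<close> has a neighbour in \<open>C\<close>, whereas no
      vertex of \<open>D\<close> has one; so \<open>F\<close> avoids \<open>D\<close>.\<close>
    show "I \<inter> (D \<union> C) = {}" using I assms(4) D(4) symE unfolding nbhd_def anti_def by blast
  qed (use I D assms in \<open>auto simp: nbhd_def\<close>)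
qed

text \<open>\<open>nbhd C - K\<close> is the part F. Only the trace of \<open>K\<close> on the
  neighbourhood counts, so a set \<open>K\<close> can be handed down to a smaller component whose
  neighbourhood has lost part of it.\<close>

definition good :: "'a set \<Rightarrow> 'a set \<Rightarrow> bool" where
  "good C K \<longleftrightarrow> clique (K \<inter> nbhd C) \<and> (clique (nbhd C - K) \<or> hub C (nbhd C - K))"

lemma nbhd_comp_Diff:
  assumes "is_comp (C - T) X"
  shows "nbhd X \<subseteq> nbhd C \<union> T"
  using assms unfolding nbhd_def is_comp_def by blast

section \<open>Separators between two nonadjacent neighbours of a component\<close>

definition side :: "'a set \<Rightarrow> 'a \<Rightarrow> 'a \<Rightarrow> 'a set" where
  "side C x y = reach {c \<in> C. \<not> E x c} y"

text \<open>The neighbours of \<open>x\<close> that touch the component of \<open>y\<close>. Each of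
  them sees both \<open>x\<close> and \<open>side C x y\<close>, so none can be spared in separating
  \<open>x\<close> from \<open>y\<close>, and the same double contact makes \<open>hub_card\<close>
  applicable.\<close>

definition sep :: "'a set \<Rightarrow> 'a \<Rightarrow> 'a \<Rightarrow> 'a set" where
  "sep C x y = {t \<in> C. E x t \<and> (\<exists>a\<in>side C x y. E a t)}"

context
  fixes C x y
  assumes C: "conn C" "C \<subseteq> V" and x: "x \<in> nbhd C" and y: "y \<in> nbhd C" and xy: "x \<noteq> y" "\<not> E x y"
begin

lemma side_subset: "side C x y \<subseteq> insert y {c \<in> C. \<not> E x c}"
  unfolding side_def by (rule reach_subset)

lemma side_y: "y \<in> side C x y" unfolding side_def by (rule reach_refl)

lemma side_conn: "conn (side C x y)" unfolding side_def by (rule reach_conn)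

lemma side_not_x: "a \<in> side C x y \<Longrightarrow> \<not> E x a" "x \<notin> side C x y"
  using side_subset xy x by (auto simp: nbhd_def)

text \<open>Inside \<open>C\<close>, a step out of \<open>side\<close> can only lead to a neighbour
  of \<open>x\<close>, and such a vertex belongs to \<open>sep\<close>.\<close>

lemma side_step: "a \<in> side C x y \<Longrightarrow> E a b \<Longrightarrow> b \<in> C \<Longrightarrow> b \<notin> sep C x y \<Longrightarrow> b \<in> side C x y"
  unfolding sep_def side_def by (auto intro: reach_step)

lemma V_xy: "x \<in> V" "y \<in> V"
  using x y EV2 unfolding nbhd_def by auto

text \<open>\<open>{x}\<close> and \<open>side C x y\<close> are connected, anticomplete to each
  other, and both dominate the separator.\<close>

lemma sep_alpha_le: "alpha_le (sep C x y) k"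
  unfolding alpha_le_def
proof (intro allI impI)
  fix I assume I: "I \<subseteq> sep C x y" "indep I"
  show "card I \<le> k"
  proof (rule hub_card[of "{x}" "side C x y"])
    show "side C x y \<subseteq> V" using side_subset C V_xy by auto
    show "I \<inter> ({x} \<union> side C x y) = {}" using I side_not_x irrE unfolding sep_def by blast
  qed (use I side_not_x V_xy side_conn conn_singleton in \<open>auto simp: sep_def anti_def\<close>)
qed

text \<open>If nothing separated, \<open>side\<close> would swallow the connected set
  \<open>C\<close>, including a neighbour of \<open>x\<close>. This guarantees that every round
  removes a vertex.\<close>

lemma sep_nonempty: "sep C x y \<noteq> {}"
proof
  assume e: "sep C x y = {}"
  obtain c where c: "c \<in> C" "E c y" using y by (auto simp: nbhd_def)
  then have "c \<in> side C x y" using side_step[of y c] side_y symE e by blast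
  then have "C \<subseteq> side C x y"
    using conn_subset_closed[of C c "side C x y"] c C side_step e by blast
  moreover obtain d where "d \<in> C" "E d x" using x by (auto simp: nbhd_def)
  ultimately show False using side_not_x symE by blast
qed

lemma sep_subset: "sep C x y \<subseteq> C" unfolding sep_def by blast

text \<open>Outside \<open>sep\<close>, edges of \<open>C\<close> do not leave \<open>side\<close>,
  so a component is inside it or disjoint from it. Inside, it has no neighbour \<open>x\<close>;
  disjoint, it has no edge to \<open>side\<close> and in particular none to
  \<open>y\<close>.\<close>

lemma sep_dichotomy:
  assumes X: "is_comp (C - sep C x y) X"
  shows "X \<subseteq> side C x y \<and> x \<notin> nbhd X \<or> X \<inter> side C x y = {} \<and> anti (side C x y) X \<and> y \<notin> nbhd X"
proof (cases "X \<inter> side C x y = {}")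
  case True
  have XC: "X \<subseteq> C - sep C x y" using X by (simp add: is_comp_def)
  have "anti (side C x y) X" unfolding anti_def using True XC side_step by blast
  then show ?thesis using True side_y symE unfolding nbhd_def anti_def by blast
next
  case False
  then obtain z where z: "z \<in> X" "z \<in> side C x y" by blast
  have "X \<subseteq> side C x y"
    using conn_subset_closed[of X z "side C x y"] z X side_step unfolding is_comp_def by blast
  then show ?thesis using side_not_x symE unfolding nbhd_def by blast
qed

lemma side_sub_V: "side C x y \<subseteq> V" using side_subset C V_xy by auto

text \<open>Both \<open>x\<close> and \<open>y\<close> lie in the part dominated by the old hub
  \<open>D\<close>, so an edge joins \<open>D\<close> to whichever of \<open>{x}\<close> and
  \<open>side\<close> is anticomplete to \<open>X\<close>; either one dominates the separator.
  Cutting \<open>K\<close> down to \<open>nbhd C\<close> puts the whole separator into the dominated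
  part, even if \<open>K\<close> happens to contain vertices of \<open>C\<close>.\<close>

lemma good_sep_hub:
  assumes g: "good C K" and h: "hub C (nbhd C - K)" and xK: "x \<notin> K" and yK: "y \<notin> K"
    and X: "is_comp (C - sep C x y) X"
  shows "good X (K \<inter> nbhd C)"
proof -
  obtain D where D: "D \<subseteq> V" "conn D" "D \<inter> C = {}" "anti D C" "\<forall>f\<in>nbhd C - K. \<exists>d\<in>D. E d f"
    using h unfolding hub_def by blast
  have XC: "X \<subseteq> C" using X by (auto simp: is_comp_def)
  have nX: "nbhd X \<subseteq> nbhd C \<union> sep C x y" by (rule nbhd_comp_Diff[OF X])
  obtain dx where dx: "dx \<in> D" "E dx x" using D x xK by blast
  obtain dy where dy: "dy \<in> D" "E dy y" using D y yK by blast
  have "hub X (nbhd X - K \<inter> nbhd C)"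
  proof (cases "x \<in> nbhd X")
    case False
    show ?thesis unfolding hub_def
    proof (intro exI conjI ballI)
      show "D \<union> {x} \<subseteq> V" using D V_xy by simp
      show "conn (D \<union> {x})" using conn_Un[OF D(2) conn_singleton dx(1)] dx by auto
      show "(D \<union> {x}) \<inter> X = {}" using D XC x by (auto simp: nbhd_def)
      then show "anti (D \<union> {x}) X"
        using D(4) False XC symE unfolding anti_def nbhd_def by blast
      fix f assume f: "f \<in> nbhd X - K \<inter> nbhd C"
      then have "f \<in> nbhd C - K \<or> E x f" using nX by (auto simp: sep_def)
      then show "\<exists>d\<in>D \<union> {x}. E d f" using D(5) by blast
    qed
  next
    case True
    then have an: "anti (side C x y) X" "X \<inter> side C x y = {}" using sep_dichotomy[OF X] by auto
    show ?thesis unfolding hub_def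
    proof (intro exI conjI ballI)
      show "D \<union> side C x y \<subseteq> V" using D side_sub_V by simp
      show "conn (D \<union> side C x y)" by (rule conn_Un[OF D(2) side_conn dy(1) side_y dy(2)])
      show "(D \<union> side C x y) \<inter> X = {}" using D XC an by blast
      show "anti (D \<union> side C x y) X"
        using D(4) XC an unfolding anti_def by blast
      fix f assume f: "f \<in> nbhd X - K \<inter> nbhd C"
      then have "f \<in> nbhd C - K \<or> (\<exists>a\<in>side C x y. E a f)" using nX by (auto simp: sep_def)
      then show "\<exists>d\<in>D \<union> side C x y. E d f" using D(5) by blast
    qed
  qed
  moreover have "clique (K \<inter> nbhd C \<inter> nbhd X)"
    by (rule clique_subset[of "K \<inter> nbhd C"]) (use g in \<open>auto simp: good_def\<close>)
  ultimately show ?thesis unfolding good_def by blast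
qed

text \<open>On the side of \<open>y\<close>, the hub \<open>{x}\<close> dominates the clique part
  containing \<open>x\<close> and the separator, so the two parts swap roles and the old F becomes
  the new clique. On the other side the clique part is kept: \<open>y\<close> dominates the old F
  and the rest of \<open>side\<close> helps to dominate the separator.\<close>

lemma good_sep_cliques:
  assumes K: "clique (K \<inter> nbhd C)" and F: "clique (nbhd C - K)" and xK: "x \<in> K" and yK: "y \<notin> K"
    and X: "is_comp (C - sep C x y) X"
  shows "good X (if X \<inter> side C x y \<noteq> {} then nbhd C - K \<inter> nbhd C else K \<inter> nbhd C)"
proof -
  have XC: "X \<subseteq> C" using X by (auto simp: is_comp_def)
  have nX: "nbhd X \<subseteq> nbhd C \<union> sep C x y" by (rule nbhd_comp_Diff[OF X])
  show ?thesis
  proof (cases "X \<inter> side C x y = {}")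
    case False
    then have xn: "x \<notin> nbhd X" using sep_dichotomy[OF X] by blast
    have "hub X (nbhd X - (nbhd C - K \<inter> nbhd C))"
      unfolding hub_def
    proof (intro exI conjI ballI)
      show "{x} \<subseteq> V" using V_xy by simp
      show "conn {x}" by (rule conn_singleton)
      show "{x} \<inter> X = {}" using XC x by (auto simp: nbhd_def)
      then show "anti {x} X" using xn symE unfolding anti_def nbhd_def by blast
      fix f assume f: "f \<in> nbhd X - (nbhd C - K \<inter> nbhd C)"
      \<comment> \<open>The only vertex of the clique that \<open>x\<close> does not dominate is
        \<open>x\<close> itself, and it is no neighbour of \<open>X\<close> any more.\<close>
      have "f \<noteq> x" using f xn by blast
      moreover have "f \<in> K \<inter> nbhd C \<or> E x f" using f nX by (auto simp: sep_def)
      ultimately have "E x f" using K xK x unfolding clique_def by (metis IntI)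
      then show "\<exists>d\<in>{x}. E d f" by simp
    qed
    moreover have "clique ((nbhd C - K \<inter> nbhd C) \<inter> nbhd X)"
      by (rule clique_subset[OF F]) blast
    ultimately show ?thesis using False unfolding good_def by auto
  next
    case True
    then have yn: "y \<notin> nbhd X" "anti (side C x y) X" using sep_dichotomy[OF X] side_y
      using X by (auto simp: is_comp_def)
    have "hub X (nbhd X - K \<inter> nbhd C)"
      unfolding hub_def
    proof (intro exI conjI ballI)
      show "side C x y \<subseteq> V" by (rule side_sub_V)
      show "conn (side C x y)" by (rule side_conn)
      show "side C x y \<inter> X = {}" using True by blast
      show "anti (side C x y) X" by fact
      fix f assume f: "f \<in> nbhd X - K \<inter> nbhd C"
      then have "f \<noteq> y" using yn by blast
      moreover have "f \<in> nbhd C - K \<or> (\<exists>a\<in>side C x y. E a f)" using f nX by (auto simp: sep_def)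
      moreover have "E y f" if "f \<in> nbhd C - K" using F yK y that \<open>f \<noteq> y\<close> unfolding clique_def by (metis DiffI)
      ultimately show "\<exists>d\<in>side C x y. E d f" using side_y by blast
    qed
    moreover have "clique (K \<inter> nbhd C \<inter> nbhd X)"
      by (rule clique_subset[OF K]) blast
    ultimately show ?thesis using True unfolding good_def by auto
  qed
qed

end

text \<open>\<open>z\<close> is the only possible new neighbour, so the old clique serves as
  \<open>K\<close> and at most one vertex is left over.\<close>

lemma good_singleton:
  assumes "clique (nbhd C)" "is_comp (C - {z}) X"
  shows "good X (nbhd C)"
proof -
  have "nbhd X - nbhd C \<subseteq> {z}" using nbhd_comp_Diff[OF assms(2)] by blast
  then have "clique (nbhd X - nbhd C)" unfolding clique_def by blast
  then show ?thesis unfolding good_def using clique_subset[OF assms(1)] by blast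
qed

section \<open>Bags and the invariant of the elimination order\<close>

definition bag :: "'a set \<Rightarrow> 'a \<Rightarrow> 'a set" where
  "bag W v = insert v (nbhd (reach (V - W) v))"

text \<open>A separator is removed vertex by vertex, so \<open>W'\<close> may contain only part of
  \<open>T\<close>. The component of \<open>v\<close> stays inside \<open>C\<close>; a neighbour of
  it within \<open>C\<close> must already be removed and so lies in \<open>T\<close>, and any other
  neighbour belongs to \<open>nbhd C\<close>. One bound for \<open>nbhd C \<union> T\<close> thus
  serves all these bags.\<close>

lemma bag_subset:
  assumes C: "is_comp (V - W) C" and T: "T \<subseteq> C" and W': "W \<subseteq> W'" "W' \<subseteq> W \<union> T" and v: "v \<in> T"
  shows "bag W' v \<subseteq> nbhd C \<union> T"
proof -
  have CV: "C \<subseteq> V - W" using C by (simp add: is_comp_def)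
  have R: "reach (V - W') v \<subseteq> C"
    by (rule reach_least) (use C v T W' in \<open>auto 4 4 simp: is_comp_def\<close>)
  have "u \<in> nbhd C \<union> T" if u: "u \<in> nbhd (reach (V - W') v)" for u
  proof (cases "u \<in> C")
    case True
    from u obtain a where a: "a \<in> reach (V - W') v" "E a u" "u \<notin> reach (V - W') v" by (auto simp: nbhd_def)
    then have "u \<notin> V - W'" using reach_step by blast
    then show ?thesis using True CV W' by blast
  next
    case False
    then show ?thesis using u R by (auto simp: nbhd_def)
  qed
  then show ?thesis unfolding bag_def using v by blast
qed

definition elim_ok :: "nat \<Rightarrow> 'a list \<Rightarrow> bool" where
  "elim_ok L rs \<longleftrightarrow> (\<forall>i<length rs. alpha_le (bag (set (take i rs)) (rs ! i)) L)"

lemma elim_ok_append: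
  assumes "elim_ok L rs" "is_comp (V - set rs) C" "set ts \<subseteq> C" "alpha_le (nbhd C \<union> set ts) L"
  shows "elim_ok L (rs @ ts)"
  unfolding elim_ok_def
proof (intro allI impI)
  fix i assume i: "i < length (rs @ ts)"
  show "alpha_le (bag (set (take i (rs @ ts))) ((rs @ ts) ! i)) L"
  proof (cases "i < length rs")
    case True
    then show ?thesis using assms(1) unfolding elim_ok_def by (simp add: nth_append)
  next
    case False
    then have "bag (set (take i (rs @ ts))) ((rs @ ts) ! i) \<subseteq> nbhd C \<union> set ts"
      using i set_take_subset[of "i - length rs" ts]
      by (intro bag_subset[OF assms(2,3)]) (auto simp: nth_append)
    then show ?thesis using alpha_le_mono[OF assms(4)] by blast
  qed
qed

text \<open>\<open>K\<close> is attached to vertices instead of components: components split, but a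
  vertex keeps its entry, and any vertex of a component can be asked for it.\<close>

definition order_inv :: "('a \<Rightarrow> 'a set) \<Rightarrow> 'a list \<Rightarrow> bool" where
  "order_inv K rs \<longleftrightarrow> distinct rs \<and> set rs \<subseteq> V \<and> elim_ok (2 * k + 1) rs \<and>
     (\<forall>c\<in>V - set rs. good (reach (V - set rs) c) (K c))"

lemma order_inv_Nil: "order_inv (\<lambda>_. {}) []"
  unfolding order_inv_def
proof (intro conjI ballI)
  fix c assume c: "c \<in> V - set []"
  have "reach V c \<subseteq> V" using reach_subset[of V c] c by auto
  then have "nbhd (reach V c) = {}" unfolding nbhd_def using reach_step EV2 by blast
  then show "good (reach (V - set []) c) {}" by (simp add: good_def clique_def)
qed (auto simp: elim_ok_def)

text \<open>Removing \<open>ts\<close> from \<open>C\<close> leaves the other components and their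
  sets \<open>K\<close> untouched; only the components of \<open>C - set ts\<close> need a new
  argument, which is assumption \<open>new\<close>. Assumption \<open>al\<close> bounds the bags of
  the removed vertices.\<close>

lemma order_inv_step:
  assumes inv: "order_inv K rs" and z: "z \<in> V - set rs" and C: "C = reach (V - set rs) z"
    and ts: "distinct ts" "set ts \<subseteq> C" and al: "alpha_le (nbhd C \<union> set ts) (2 * k + 1)"
    and new: "\<And>X c. is_comp (C - set ts) X \<Longrightarrow> c \<in> X \<Longrightarrow> good X (K' c)"
    and old: "\<And>c. c \<notin> C \<Longrightarrow> K' c = K c"
  shows "order_inv K' (rs @ ts)"
  unfolding order_inv_def
proof (intro conjI ballI)
  have comp: "is_comp (V - set rs) C" using reach_is_comp[OF z] C by simp
  then have CV: "C \<subseteq> V - set rs" by (simp add: is_comp_def)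
  show "distinct (rs @ ts)" using inv ts CV unfolding order_inv_def by auto
  show "set (rs @ ts) \<subseteq> V" using inv ts CV unfolding order_inv_def by auto
  show "elim_ok (2 * k + 1) (rs @ ts)"
    using elim_ok_append[OF _ comp ts(2) al] inv unfolding order_inv_def by blast
  fix c assume c: "c \<in> V - set (rs @ ts)"
  let ?X = "reach (V - set rs - set ts) c"
  have eq: "V - set (rs @ ts) = V - set rs - set ts" by auto
  have X: "is_comp (V - set rs - set ts) ?X" using reach_is_comp[of c "V - set rs - set ts"] c by auto
  show "good (reach (V - set (rs @ ts)) c) (K' c)"
  proof (cases "c \<in> C")
    case True
    have "?X \<subseteq> C" by (rule reach_least) (use True comp in \<open>auto simp: is_comp_def\<close>)
    then show ?thesis unfolding eq using new[OF is_comp_Diff[OF comp _ X]] reach_refl by blast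
  next
    case False
    let ?Y = "reach (V - set rs) c"
    have Y: "is_comp (V - set rs) ?Y" using reach_is_comp[of c "V - set rs"] c by auto
    then have "?Y \<inter> C = {}" using is_comp_disj[OF Y comp] False reach_refl by blast
    then have "is_comp (V - set rs - set ts) ?Y" using is_comp_Diff_other[OF Y] ts by blast
    then have "?X = ?Y" using is_comp_eq reach_refl by blast
    then show ?thesis unfolding eq using inv c old[OF False] unfolding order_inv_def by auto
  qed
qed

lemma order_inv_hub:
  assumes inv: "order_inv K rs" and z: "z \<in> V - set rs" and C: "C = reach (V - set rs) z"
    and x: "x \<in> nbhd C - K z" and y: "y \<in> nbhd C - K z" and xy: "x \<noteq> y" "\<not> E x y"
    and ts: "distinct ts" "set ts = sep C x y"
  shows "order_inv (\<lambda>c. if c \<in> C then K z \<inter> nbhd C else K c) (rs @ ts)"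
proof -
  have C': "conn C" "C \<subseteq> V" "z \<in> C" using C reach_conn reach_subset[of "V - set rs" z] z reach_refl by auto
  have g: "good C (K z)" using inv z C unfolding order_inv_def by blast
  moreover have "\<not> clique (nbhd C - K z)" using x y xy unfolding clique_def by blast
  ultimately have h: "hub C (nbhd C - K z)" unfolding good_def by blast
  have x': "x \<in> nbhd C" "x \<notin> K z" and y': "y \<in> nbhd C" "y \<notin> K z" using x y by auto
  have "alpha_le (nbhd C - K z) k" using hub_alpha_le[OF C'(1,2) h] by blast
  moreover have "alpha_le (K z \<inter> nbhd C) 1" using g clique_alpha_le unfolding good_def by blast
  \<comment> \<open>The summands stand for the hub-dominated part, the clique part and the
    separator.\<close>
  ultimately have "alpha_le ((nbhd C - K z) \<union> (K z \<inter> nbhd C) \<union> sep C x y) (k + 1 + k)"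
    by (intro alpha_le_Un sep_alpha_le C' x' y' xy)
  then have al: "alpha_le (nbhd C \<union> set ts) (2 * k + 1)" by (rule alpha_le_mono) (use ts in auto)
  show ?thesis
  proof (rule order_inv_step[OF inv z C ts(1) _ al])
    show "set ts \<subseteq> C" using ts sep_subset[OF C'(1,2) x'(1) y'(1) xy] by simp
    fix X c assume X: "is_comp (C - set ts) X" "c \<in> X"
    then have "c \<in> C" by (auto simp: is_comp_def)
    then show "good X (if c \<in> C then K z \<inter> nbhd C else K c)"
      using good_sep_hub[OF C'(1,2) x'(1) y'(1) xy g h x'(2) y'(2)] X ts by simp
  qed simp
qed

lemma order_inv_cliques:
  assumes inv: "order_inv K rs" and z: "z \<in> V - set rs" and C: "C = reach (V - set rs) z"
    and x: "x \<in> nbhd C \<inter> K z" and y: "y \<in> nbhd C - K z" and xy: "\<not> E x y"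
    and F: "clique (nbhd C - K z)"
    and ts: "distinct ts" "set ts = sep C x y"
  shows "order_inv (\<lambda>c. if c \<in> C then if c \<in> side C x y then nbhd C - K z \<inter> nbhd C else K z \<inter> nbhd C else K c)
     (rs @ ts)"
proof -
  have C': "conn C" "C \<subseteq> V" "z \<in> C" using C reach_conn reach_subset[of "V - set rs" z] z reach_refl by auto
  have K: "clique (K z \<inter> nbhd C)" using inv z C unfolding order_inv_def good_def by blast
  have x': "x \<in> nbhd C" "x \<in> K z" and y': "y \<in> nbhd C" "y \<notin> K z" and ne: "x \<noteq> y" using x y by auto
  \<comment> \<open>Two cliques and the separator: k + 2 is at most 2k + 1 because of
    \<open>k1\<close>.\<close>
  have "alpha_le ((nbhd C - K z) \<union> (K z \<inter> nbhd C) \<union> sep C x y) (1 + 1 + k)"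
    by (intro alpha_le_Un sep_alpha_le C' x' y' xy ne clique_alpha_le K F)
  then have al: "alpha_le (nbhd C \<union> set ts) (2 * k + 1)" by (rule alpha_le_mono) (use ts k1 in auto)
  show ?thesis
  proof (rule order_inv_step[OF inv z C ts(1) _ al])
    show "set ts \<subseteq> C" using ts sep_subset[OF C'(1,2) x'(1) y'(1) ne xy] by simp
    fix X c assume X: "is_comp (C - set ts) X" "c \<in> X"
    then have "c \<in> C" by (auto simp: is_comp_def)
    \<comment> \<open>By the dichotomy one vertex decides on which side its component lies, so the
      new entry can be computed for each vertex separately.\<close>
    moreover have "c \<in> side C x y \<longleftrightarrow> X \<inter> side C x y \<noteq> {}"
      using sep_dichotomy[OF C'(1,2) x'(1) y'(1) ne xy, of X] X ts by auto
    ultimately show "good X (if c \<in> C then if c \<in> side C x y then nbhd C - K z \<inter> nbhd C else K z \<inter> nbhd C else K c)"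
      using good_sep_cliques[OF C'(1,2) x'(1) y'(1) ne xy K F x'(2) y'(2), of X] X ts by simp
  qed simp
qed

lemma order_inv_single:
  assumes inv: "order_inv K rs" and z: "z \<in> V - set rs" and C: "C = reach (V - set rs) z"
    and S: "clique (nbhd C)"
  shows "order_inv (\<lambda>c. if c \<in> C then nbhd C else K c) (rs @ [z])"
proof -
  have zC: "z \<in> C" using C reach_refl by simp
  have "clique {z}" by (simp add: clique_def)
  then have "alpha_le (nbhd C \<union> {z}) (1 + 1)" by (intro alpha_le_Un clique_alpha_le S)
  then have al: "alpha_le (nbhd C \<union> set [z]) (2 * k + 1)" by (rule alpha_le_mono) (use k1 in auto)
  show ?thesis
  proof (rule order_inv_step[OF inv z C _ _ al])
    fix X c assume X: "is_comp (C - set [z]) X" "c \<in> X"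
    then show "good X (if c \<in> C then nbhd C else K c)"
      using good_singleton[OF S, of z X] by (auto simp: is_comp_def)
  qed (use zC in auto)
qed

end

section \<open>Weights along the elimination tree\<close>

locale wgraph = fgraph V E for V :: "'a set" and E +
  fixes w :: "'a \<Rightarrow> rat"
begin

definition opt :: "'a set \<Rightarrow> rat" where
  "opt X = Max (sum w ` {I. I \<subseteq> X \<and> indep I})"

text \<open>Unlike in \<open>nbhd\<close>, the set itself is not subtracted; this makes
  \<open>NN\<close> distribute over unions.\<close>

definition NN :: "'a set \<Rightarrow> 'a set" where
  "NN J = {u. \<exists>j\<in>J. E j u}"

lemma finite_indeps: "finite {I. I \<subseteq> X \<and> indep I}"
  by (rule finite_subset[of _ "Pow V"]) (auto simp: indep_def finV)

lemma indep_empty: "indep {}" by (simp add: indep_def)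

lemma indep_finite: "indep I \<Longrightarrow> finite I"
  unfolding indep_def using finV by (meson finite_subset)

lemma opt_ge: "I \<subseteq> X \<Longrightarrow> indep I \<Longrightarrow> sum w I \<le> opt X"
  unfolding opt_def by (rule Max_ge) (auto simp: finite_indeps)

lemma opt_ex: "\<exists>I. I \<subseteq> X \<and> indep I \<and> sum w I = opt X"
proof -
  have "opt X \<in> sum w ` {I. I \<subseteq> X \<and> indep I}"
    unfolding opt_def by (rule Max_in) (use finite_indeps indep_empty in auto)
  then obtain I where "I \<subseteq> X" "indep I" "opt X = sum w I" by blast
  then show ?thesis by auto
qed

lemma is_comp_mono: "is_comp U X \<Longrightarrow> X \<subseteq> U' \<Longrightarrow> U' \<subseteq> U \<Longrightarrow> is_comp U' X"
  unfolding is_comp_def by blast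

lemma NN_insert: "NN (insert v J) = NN {v} \<union> NN J"
  unfolding NN_def by blast

text \<open>Only neighbours of \<open>C\<close> can forbid vertices of \<open>C\<close>. Hence a
  choice made outside \<open>C\<close> matters to \<open>C\<close> only through its trace on
  \<open>nbhd C\<close>, and a table for \<open>C\<close> is indexed by subsets of
  \<open>nbhd C\<close>.\<close>

lemma Diff_NN_nbhd:
  assumes "J \<inter> C = {}"
  shows "C - NN J = C - NN (J \<inter> nbhd C)"
proof -
  have "j \<in> nbhd C" if "u \<in> C" "j \<in> J" "E j u" for u j
    using that assms symE[OF that(3)] unfolding nbhd_def by auto
  then show ?thesis unfolding NN_def by auto
qed

lemma opt_mono: "X \<subseteq> Y \<Longrightarrow> opt X \<le> opt Y"
  using opt_ex[of X] opt_ge by (metis subset_trans)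

lemma opt_empty: "opt {} = 0"
  using opt_ex[of "{}"] by (metis subset_empty sum.empty)

lemma indep_subset: "indep I \<Longrightarrow> J \<subseteq> I \<Longrightarrow> indep J"
  unfolding indep_def by blast

lemma indep_Un: "indep I \<Longrightarrow> indep J \<Longrightarrow> anti I J \<Longrightarrow> indep (I \<union> J)"
  unfolding indep_def anti_def using symE by blast

lemma opt_Un:
  assumes "anti X Y" "X \<inter> Y = {}"
  shows "opt (X \<union> Y) = opt X + opt Y"
proof (rule antisym)
  obtain I where I: "I \<subseteq> X \<union> Y" "indep I" "sum w I = opt (X \<union> Y)" using opt_ex by blast
  have "sum w ((I \<inter> X) \<union> (I \<inter> Y)) = sum w (I \<inter> X) + sum w (I \<inter> Y)"
    using assms indep_finite[OF I(2)] by (intro sum.union_disjoint) auto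
  moreover have "I = (I \<inter> X) \<union> (I \<inter> Y)" using I(1) by blast
  ultimately have "sum w I = sum w (I \<inter> X) + sum w (I \<inter> Y)" by simp
  also have "\<dots> \<le> opt X + opt Y"
    by (intro add_mono opt_ge) (auto intro: indep_subset[OF I(2)])
  finally show "opt (X \<union> Y) \<le> opt X + opt Y" using I by simp
next
  obtain I where I: "I \<subseteq> X" "indep I" "sum w I = opt X" using opt_ex by blast
  obtain J where J: "J \<subseteq> Y" "indep J" "sum w J = opt Y" using opt_ex by blast
  have "anti I J" using assms I J unfolding anti_def by blast
  moreover have "sum w (I \<union> J) = sum w I + sum w J"
    using I J assms by (intro sum.union_disjoint indep_finite) auto
  ultimately show "opt X + opt Y \<le> opt (X \<union> Y)"
    using opt_ge[OF _ indep_Un[OF I(2) J(2)], of "X \<union> Y"] I J by fastforce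
qed

lemma opt_UN:
  assumes "finite A" "\<And>i j. i \<in> A \<Longrightarrow> j \<in> A \<Longrightarrow> i \<noteq> j \<Longrightarrow> anti (X i) (X j) \<and> X i \<inter> X j = {}"
  shows "opt (\<Union>i\<in>A. X i) = (\<Sum>i\<in>A. opt (X i))"
  using assms
proof (induction A rule: finite_induct)
  case (insert a A)
  have "anti (X a) (\<Union>i\<in>A. X i)" "X a \<inter> (\<Union>i\<in>A. X i) = {}"
    using insert.prems insert.hyps unfolding anti_def by blast+
  then have "opt (X a \<union> (\<Union>i\<in>A. X i)) = opt (X a) + opt (\<Union>i\<in>A. X i)" by (rule opt_Un)
  moreover have "opt (\<Union>i\<in>A. X i) = (\<Sum>i\<in>A. opt (X i))"
    by (rule insert.IH) (use insert.prems in blast)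
  ultimately show ?case using insert.hyps by simp
qed (simp add: opt_empty)

lemma opt_insert:
  assumes "v \<in> V" "v \<notin> X"
  shows "opt (insert v X) = max (opt X) (w v + opt (X - NN {v}))"
proof (rule antisym)
  obtain I where I: "I \<subseteq> insert v X" "indep I" "sum w I = opt (insert v X)" using opt_ex by blast
  show "opt (insert v X) \<le> max (opt X) (w v + opt (X - NN {v}))"
  proof (cases "v \<in> I")
    case True
    have "I - {v} \<subseteq> X - NN {v}" using I True unfolding indep_def NN_def by blast
    then have "sum w (I - {v}) \<le> opt (X - NN {v})" using opt_ge indep_subset[OF I(2)] by blast
    moreover have "sum w I = w v + sum w (I - {v})" using True indep_finite[OF I(2)] by (rule sum.remove[rotated])
    ultimately show ?thesis using I by simp
  next
    case False
    then have "sum w I \<le> opt X" using I opt_ge by blast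
    then show ?thesis using I by simp
  qed
next
  obtain I where I: "I \<subseteq> X - NN {v}" "indep I" "sum w I = opt (X - NN {v})" using opt_ex by blast
  have "v \<notin> I" using I assms by blast
  moreover have "indep (insert v I)"
    using I assms irrE symE unfolding indep_def NN_def by blast
  ultimately have "w v + opt (X - NN {v}) \<le> opt (insert v X)"
    using opt_ge[of "insert v I" "insert v X"] I indep_finite[OF I(2)] by auto
  then show "max (opt X) (w v + opt (X - NN {v})) \<le> opt (insert v X)"
    using opt_mono[of X "insert v X"] by auto
qed

end

locale elimination = wgraph +
  fixes rs :: "'a list"
  assumes dist: "distinct rs" and set_rs: "set rs = V"
begin

abbreviation "W i \<equiv> set (take i rs)"
abbreviation "CC i \<equiv> reach (V - W i) (rs ! i)"
abbreviation "NB i \<equiv> nbhd (CC i)"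
abbreviation "nn \<equiv> length rs"

text \<open>The parent is the vertex of \<open>NB i\<close> removed last. Since \<open>NB i\<close>
  lies among the vertices before position \<open>i\<close>, a position without parent is one with
  empty \<open>NB i\<close>, the root of a tree.\<close>

definition par :: "nat \<Rightarrow> nat \<Rightarrow> bool" where
  "par i p \<longleftrightarrow> p < nn \<and> rs ! p \<in> NB i \<and> (\<forall>j<nn. rs ! j \<in> NB i \<longrightarrow> j \<le> p)"

lemma nth_in_W: "i < nn \<Longrightarrow> rs ! i \<in> W j \<longleftrightarrow> i < j"
  using dist by (auto simp: in_set_conv_nth nth_eq_iff_index_eq)

lemma nth_V: "i < nn \<Longrightarrow> rs ! i \<in> V" using set_rs by auto

lemma V_nth: "v \<in> V \<Longrightarrow> \<exists>i<nn. v = rs ! i" using set_rs by (metis in_set_conv_nth)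

lemma W_Suc: "i < nn \<Longrightarrow> W (Suc i) = insert (rs ! i) (W i)"
  by (simp add: take_Suc_conv_app_nth)

lemma W_mono: "i \<le> j \<Longrightarrow> W i \<subseteq> W j" by (rule set_take_subset_set_take)

lemma CC_comp: "i < nn \<Longrightarrow> is_comp (V - W i) (CC i)"
  using nth_in_W[of i i] nth_V by (intro reach_is_comp) auto

lemma CC_sub: "i < nn \<Longrightarrow> CC i \<subseteq> V - W i" using CC_comp unfolding is_comp_def by blast

lemma nth_CC: "rs ! i \<in> CC i" by (rule reach_refl)

lemma NB_sub: "i < nn \<Longrightarrow> NB i \<subseteq> W i"
proof
  fix u assume "i < nn" "u \<in> NB i"
  then obtain a where "a \<in> CC i" "E a u" "u \<notin> CC i" unfolding nbhd_def by auto
  then show "u \<in> W i" using reach_step EV2 by blast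
qed

lemma par_less: "i < nn \<Longrightarrow> par i p \<Longrightarrow> p < i"
  unfolding par_def using NB_sub nth_in_W by blast

lemma par_unique: "par i p \<Longrightarrow> par i p' \<Longrightarrow> p = p'"
  unfolding par_def by (meson le_antisym)

text \<open>All neighbours of \<open>CC i\<close> have positions up to \<open>p\<close>, so it has
  been a component ever since position \<open>p\<close> was removed.\<close>

lemma par_comp:
  assumes i: "i < nn" and p: "par i p"
  shows "is_comp (V - W (Suc p)) (CC i)"
proof -
  have pi: "p < i" using par_less i p by blast
  have sub: "CC i \<subseteq> V - W (Suc p)" using CC_sub[OF i] W_mono[of "Suc p" i] pi by auto
  have "b \<in> CC i" if b: "a \<in> CC i" "b \<in> V - W (Suc p)" "E a b" for a b
  proof (rule ccontr)
    assume "b \<notin> CC i"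
    then have nb: "b \<in> NB i" using b unfolding nbhd_def by blast
    obtain j where j: "j < nn" "b = rs ! j" using V_nth b by blast
    then have "j \<le> p" using p nb unfolding par_def by blast
    then show False using b j nth_in_W[of j "Suc p"] by simp
  qed
  then show ?thesis unfolding is_comp_def using sub reach_refl reach_conn by blast
qed

lemma par_sub:
  assumes i: "i < nn" and p: "par i p"
  shows "CC i \<subseteq> CC p - {rs ! p}"
proof -
  have pi: "p < i" "p < nn" using par_less i p unfolding par_def by auto
  obtain a where a: "a \<in> CC i" "E a (rs ! p)" using p unfolding par_def nbhd_def by blast
  have sub: "CC i \<subseteq> V - W p" using CC_sub[OF i] W_mono[of p i] pi by auto
  have aC: "a \<in> CC p" using reach_step[OF reach_refl[of "rs ! p"] symE[OF a(2)]] a sub by blast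
  have "CC i \<subseteq> CC p"
    by (rule conn_subset_closed[OF reach_conn a(1) aC]) (use sub reach_step in blast)
  moreover have "rs ! p \<notin> CC i" using p unfolding par_def nbhd_def by blast
  ultimately show ?thesis by blast
qed

text \<open>Removing \<open>rs ! p\<close> isolates a component around \<open>u\<close>. It is
  \<open>CC j\<close> for its earliest position \<open>j\<close>; it touches \<open>rs ! p\<close>
  because \<open>CC p\<close> is connected, and its other neighbours come before \<open>p\<close>.
  So \<open>j\<close> is a child of \<open>p\<close>.\<close>

lemma children_cover:
  assumes p: "p < nn" and u: "u \<in> CC p - {rs ! p}"
  shows "\<exists>i<nn. par i p \<and> u \<in> CC i"
proof -
  let ?X = "reach (V - W (Suc p)) u"
  have uV: "u \<in> V - W (Suc p)" using u CC_sub[OF p] W_Suc[OF p] by auto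
  have X: "is_comp (V - W (Suc p)) ?X" by (rule reach_is_comp[OF uV])
  define j where "j = (LEAST j. j < nn \<and> rs ! j \<in> ?X)"
  have ex: "\<exists>j. j < nn \<and> rs ! j \<in> ?X" using V_nth[of u] uV reach_refl by blast
  have j: "j < nn" "rs ! j \<in> ?X" using LeastI_ex[OF ex] unfolding j_def by auto
  have jmin: "j \<le> i" if "i < nn" "rs ! i \<in> ?X" for i
    unfolding j_def by (rule Least_le) (use that in auto)
  have pj: "p < j"
  proof (rule ccontr)
    assume "\<not> p < j"
    then have "rs ! j \<in> W (Suc p)" using nth_in_W[OF j(1)] by simp
    then show False using j(2) X unfolding is_comp_def by blast
  qed
  have XW: "?X \<subseteq> V - W j"
  proof
    fix x assume x: "x \<in> ?X"
    then have xV: "x \<in> V" using X unfolding is_comp_def by blast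
    then obtain i where i: "i < nn" "x = rs ! i" using V_nth by blast
    then have "j \<le> i" using jmin x by blast
    then show "x \<in> V - W j" using xV i nth_in_W by auto
  qed
  have "is_comp (V - W j) ?X"
    by (rule is_comp_mono[OF X XW]) (use W_mono[of "Suc p" j] pj in auto)
  then have eq: "?X = CC j" using is_comp_eq[OF _ j(2)] by blast
  have XC: "?X \<subseteq> CC p"
    by (rule reach_least) (use u W_Suc[OF p] reach_step in auto)
  have "rs ! p \<notin> ?X" using X nth_in_W[OF p] unfolding is_comp_def by auto
  moreover have "\<exists>a\<in>?X. E a (rs ! p)"
  proof (rule ccontr)
    assume no: "\<not> (\<exists>a\<in>?X. E a (rs ! p))"
    have "CC p \<subseteq> ?X"
    proof (rule conn_subset_closed[OF reach_conn])
      show "u \<in> CC p" using u by blast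
      show "u \<in> ?X" by (rule reach_refl)
      fix a b assume ab: "a \<in> ?X" "b \<in> CC p" "E a b"
      then have "b \<noteq> rs ! p" using no by blast
      then have "b \<in> V - W (Suc p)" using ab CC_sub[OF p] W_Suc[OF p] by auto
      then show "b \<in> ?X" using ab reach_step by blast
    qed
    then show False using nth_CC \<open>rs ! p \<notin> ?X\<close> by blast
  qed
  ultimately have "rs ! p \<in> NB j" unfolding eq nbhd_def by blast
  moreover have "i \<le> p" if i: "i < nn" "rs ! i \<in> NB j" for i
  proof (rule ccontr)
    assume "\<not> i \<le> p"
    then have "rs ! i \<in> V - W (Suc p)" using nth_in_W[OF i(1)] nth_V[OF i(1)] by auto
    moreover obtain a where "a \<in> ?X" "E a (rs ! i)" "rs ! i \<notin> ?X" using i eq unfolding nbhd_def by auto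
    ultimately show False using reach_step by blast
  qed
  ultimately have "par j p" unfolding par_def using p by blast
  then show ?thesis using j(1) reach_refl[of u] eq by blast
qed

text \<open>The components of the children partition \<open>CC p - {rs ! p}\<close> and have no
  edges between them, so optima add up.\<close>

lemma acc_opt:
  assumes p: "p < nn"
  shows "(\<Sum>i | i < nn \<and> par i p. opt (CC i - NN J)) = opt (CC p - {rs ! p} - NN J)"
proof -
  let ?A = "{i. i < nn \<and> par i p}"
  have "CC p - {rs ! p} = (\<Union>i\<in>?A. CC i)" using children_cover[OF p] par_sub by blast
  then have eq: "CC p - {rs ! p} - NN J = (\<Union>i\<in>?A. CC i - NN J)" by blast
  show ?thesis unfolding eq
  proof (rule opt_UN[symmetric])
    fix i j assume ij: "i \<in> ?A" "j \<in> ?A" "i \<noteq> j"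
    \<comment> \<open>Equal components would put each of the two vertices outside the prefix before
      the other, which forces equal positions.\<close>
    have ne: "CC i \<noteq> CC j"
    proof
      assume eq: "CC i = CC j"
      have "rs ! i \<notin> W j" "rs ! j \<notin> W i"
        using nth_CC[of i] nth_CC[of j] CC_sub[of i] CC_sub[of j] ij eq by auto
      then show False using nth_in_W ij by auto
    qed
    have c: "is_comp (V - W (Suc p)) (CC i)" "is_comp (V - W (Suc p)) (CC j)" using par_comp ij by auto
    then have d: "CC i \<inter> CC j = {}" using is_comp_disj ne by blast
    then have "anti (CC i) (CC j)" using is_comp_anti c by blast
    then show "anti (CC i - NN J) (CC j - NN J) \<and> (CC i - NN J) \<inter> (CC j - NN J) = {}"
      using d unfolding anti_def by blast
  qed simp
qed

lemma NN_restrict: "J \<inter> CC i = {} \<Longrightarrow> CC i - NN J = CC i - NN (J \<inter> NB i)"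
  by (rule Diff_NN_nbhd)

text \<open>Both branches ask for optima on \<open>CC i - {rs ! i}\<close>, which are sums over the
  children by \<open>acc_opt\<close>. This is why the tables store these sums and not the optima on
  \<open>CC i\<close>.\<close>

lemma CC_opt:
  assumes i: "i < nn"
  shows "opt (CC i - NN J) =
    (if rs ! i \<in> NN J then opt (CC i - {rs ! i} - NN J)
     else max (opt (CC i - {rs ! i} - NN J)) (w (rs ! i) + opt (CC i - {rs ! i} - NN (insert (rs ! i) J))))"
proof (cases "rs ! i \<in> NN J")
  case True
  then have "CC i - NN J = CC i - {rs ! i} - NN J" by blast
  then show ?thesis using True by simp
next
  case False
  then have eq: "CC i - NN J = insert (rs ! i) (CC i - {rs ! i} - NN J)" using nth_CC by blast
  have eq2: "CC i - {rs ! i} - NN J - NN {rs ! i} = CC i - {rs ! i} - NN (insert (rs ! i) J)"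
    using NN_insert[of "rs ! i" J] by auto
  show ?thesis unfolding eq using opt_insert[OF nth_V[OF i], of "CC i - {rs ! i} - NN J"] False eq2 by simp
qed

text \<open>On a tie the vertex is left out; the strict comparison is the one that the program
  makes.\<close>

definition picks :: "nat \<Rightarrow> 'a set \<Rightarrow> bool" where
  "picks i J \<longleftrightarrow> rs ! i \<notin> NN J \<and>
     opt (CC i - {rs ! i} - NN J) < w (rs ! i) + opt (CC i - {rs ! i} - NN (insert (rs ! i) J))"

text \<open>The rest \<open>R\<close> of the remaining graph has no edge to \<open>CC i\<close>. The
  optimum therefore splits into a part on \<open>CC i\<close>, which depends on \<open>I\<close>
  only through \<open>J\<close>, and a part on \<open>R\<close> that the decision about
  \<open>rs ! i\<close> does not affect.\<close>

lemma greedy_step: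
  assumes i: "i < nn" and I: "I \<subseteq> W i" "indep I" and J: "J = I \<inter> NB i"
  shows "opt (V - W i - NN I) =
    (if picks i J then w (rs ! i) + opt (V - W (Suc i) - NN (insert (rs ! i) I))
     else opt (V - W (Suc i) - NN I))"
    and "picks i J \<Longrightarrow> indep (insert (rs ! i) I)"
proof -
  define v where "v = rs ! i"
  define C where "C = CC i"
  define U where "U = V - W i"
  define R where "R = U - C - NN I"
  have comp: "is_comp U C" unfolding U_def C_def by (rule CC_comp[OF i])
  have CU: "C \<subseteq> U" using comp by (simp add: is_comp_def)
  have vC: "v \<in> C" unfolding v_def C_def by (rule nth_CC)
  have U': "V - W (Suc i) = U - {v}" unfolding U_def v_def W_Suc[OF i] by auto
  have IC: "I \<inter> C = {}" using I CU unfolding U_def by blast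
  have J': "J = I \<inter> nbhd C" using J unfolding C_def .
  have r1: "C - NN I = C - NN J" unfolding J' by (rule Diff_NN_nbhd[OF IC])
  then have r2: "v \<in> NN I \<longleftrightarrow> v \<in> NN J" using vC by auto
  have r3: "C - {v} - NN I = C - {v} - NN J" using r1 by auto
  have r4: "C - {v} - NN (insert v I) = C - {v} - NN (insert v J)"
    using r3 NN_insert[of v I] NN_insert[of v J] by auto
  have R: "anti C R" using comp unfolding is_comp_def anti_def R_def by blast
  \<comment> \<open>Taking \<open>v\<close> forbids no vertex of \<open>R\<close>.\<close>
  have Rv: "R \<inter> NN {v} = {}" using R vC unfolding anti_def NN_def by auto
  have s1: "U - NN I = (C - NN I) \<union> R" using CU unfolding R_def by auto
  have s2: "U - {v} - NN I = (C - {v} - NN I) \<union> R" using CU vC unfolding R_def by auto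
  have s3: "U - {v} - NN (insert v I) = (C - {v} - NN (insert v I)) \<union> R"
    using s2 Rv unfolding NN_insert[of v I] by auto
  have o: "opt (Y \<union> R) = opt Y + opt R" if "Y \<subseteq> C" for Y
  proof (rule opt_Un)
    show "anti Y R" using that R unfolding anti_def by blast
    show "Y \<inter> R = {}" using that unfolding R_def by blast
  qed
  have "opt (U - NN I) = opt (C - NN J) + opt R"
    unfolding s1 r1[symmetric] by (rule o) blast
  moreover have "opt (U - {v} - NN I) = opt (C - {v} - NN J) + opt R"
    unfolding s2 r3[symmetric] by (rule o) blast
  moreover have "opt (U - {v} - NN (insert v I)) = opt (C - {v} - NN (insert v J)) + opt R"
    unfolding s3 r4[symmetric] by (rule o) blast
  moreover note CC_opt[OF i, of J, folded v_def C_def]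
  moreover have ch: "picks i J \<longleftrightarrow> v \<notin> NN J \<and> opt (C - {v} - NN J) < w v + opt (C - {v} - NN (insert v J))"
    unfolding picks_def v_def C_def ..
  ultimately have "opt (U - NN I) =
    (if picks i J then w v + opt (U - {v} - NN (insert v I)) else opt (U - {v} - NN I))"
    by auto
  then show "opt (V - W i - NN I) =
    (if picks i J then w (rs ! i) + opt (V - W (Suc i) - NN (insert (rs ! i) I))
     else opt (V - W (Suc i) - NN I))" unfolding U' U_def v_def .
  show "indep (insert (rs ! i) I)" if "picks i J"
  proof -
    have "v \<notin> NN I" using that ch r2 by simp
    then show ?thesis using I(2) irrE symE nth_V[OF i] unfolding indep_def NN_def v_def by blast
  qed
qed

end

section \<open>A loop language for the word RAM\<close>

text \<open>Counting loops with bounds fixed by the input size always terminate, so the meaning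
  becomes a function and the running time can be read off the syntax.\<close>

datatype fcom =
    FSkip
  | FAssign string aexp
  | FStore string aexp aexp
  | FWStore string aexp wexp
  | FSeq fcom fcom (infixr ";;" 60)
  | FIf bexp fcom fcom
  | FFor string aexp fcom

fun compile :: "fcom \<Rightarrow> com" where
  "compile FSkip = Skip"
| "compile (FAssign x a) = Assign x a"
| "compile (FStore x i a) = Store x i a"
| "compile (FWStore x i a) = WStore x i a"
| "compile (c ;; d) = Seq (compile c) (compile d)"
| "compile (FIf b c d) = If b (compile c) (compile d)"
| "compile (FFor x e c) =
     Seq (Assign x (N 0)) (While (Less (V x) e) (Seq (compile c) (Assign x (Plus (V x) (N 1)))))"

text \<open>Loop bounds are polynomials in the input size, which is kept in the register \<open>n\<close>; \<open>okb\<close> says that their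
  evaluation modulo \<open>M\<close> does not wrap around.\<close>

fun bd :: "nat \<Rightarrow> aexp \<Rightarrow> nat" where
  "bd n (N c) = c"
| "bd n (V x) = n"
| "bd n (Plus a b) = bd n a + bd n b"
| "bd n (Times a b) = bd n a * bd n b"
| "bd n _ = 0"

fun okb :: "nat \<Rightarrow> nat \<Rightarrow> aexp \<Rightarrow> bool" where
  "okb M n (N c) \<longleftrightarrow> c < M"
| "okb M n (V x) \<longleftrightarrow> x = ''n'' \<and> n < M"
| "okb M n (Plus a b) \<longleftrightarrow> okb M n a \<and> okb M n b \<and> bd n a + bd n b < M"
| "okb M n (Times a b) \<longleftrightarrow> okb M n a \<and> okb M n b \<and> bd n a * bd n b < M"
| "okb M n _ \<longleftrightarrow> False"

lemma okb_less: "okb M n e \<Longrightarrow> bd n e < M"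
  by (induction e) auto

lemma okb_aval: "okb M n e \<Longrightarrow> reg s ''n'' = n \<Longrightarrow> aval M s e = bd n e"
  by (induction e) auto

text \<open>The counter is set explicitly after each round, as the compiled increment does, and ends
  at the bound. Loop bounds are evaluated without modulus; \<open>okb\<close> makes this agree with
  the machine.\<close>

fun sem :: "nat \<Rightarrow> fcom \<Rightarrow> state \<Rightarrow> state" where
  "sem M FSkip s = s"
| "sem M (FAssign x a) s = set_reg x (aval M s a) s"
| "sem M (FStore x i a) s = set_arr x (aval M s i) (aval M s a) s"
| "sem M (FWStore x i a) s = set_warr x (aval M s i) (wval M s a) s"
| "sem M (c ;; d) s = sem M d (sem M c s)"
| "sem M (FIf b c d) s = (if bval M s b then sem M c s else sem M d s)"
| "sem M (FFor x e c) s =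
     rec_nat (set_reg x 0 s) (\<lambda>i r. set_reg x (Suc i) (sem M c r)) (bd (reg s ''n'') e)"

text \<open>The sets of assigned registers and arrays yield frame rules for the simplifier, so that
  after each block only changed cells need an argument.\<close>

fun asg :: "fcom \<Rightarrow> string set" where
  "asg FSkip = {}"
| "asg (FAssign x a) = {x}"
| "asg (FStore x i a) = {}"
| "asg (FWStore x i a) = {}"
| "asg (c ;; d) = asg c \<union> asg d"
| "asg (FIf b c d) = asg c \<union> asg d"
| "asg (FFor x e c) = insert x (asg c)"

fun sto :: "fcom \<Rightarrow> string set" where
  "sto FSkip = {}"
| "sto (FAssign x a) = {}"
| "sto (FStore x i a) = {x}"
| "sto (FWStore x i a) = {}"
| "sto (c ;; d) = sto c \<union> sto d"
| "sto (FIf b c d) = sto c \<union> sto d"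
| "sto (FFor x e c) = sto c"

fun wsto :: "fcom \<Rightarrow> string set" where
  "wsto FSkip = {}"
| "wsto (FAssign x a) = {}"
| "wsto (FStore x i a) = {}"
| "wsto (FWStore x i a) = {x}"
| "wsto (c ;; d) = wsto c \<union> wsto d"
| "wsto (FIf b c d) = wsto c \<union> wsto d"
| "wsto (FFor x e c) = wsto c"

fun wf :: "fcom \<Rightarrow> bool" where
  "wf (c ;; d) \<longleftrightarrow> wf c \<and> wf d"
| "wf (FIf b c d) \<longleftrightarrow> wf c \<and> wf d"
| "wf (FFor x e c) \<longleftrightarrow> wf c \<and> x \<notin> asg c"
| "wf _ \<longleftrightarrow> True"

fun okc :: "nat \<Rightarrow> nat \<Rightarrow> fcom \<Rightarrow> bool" where
  "okc M n (c ;; d) \<longleftrightarrow> okc M n c \<and> okc M n d"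
| "okc M n (FIf b c d) \<longleftrightarrow> okc M n c \<and> okc M n d"
| "okc M n (FFor x e c) \<longleftrightarrow> okc M n c \<and> okb M n e"
| "okc M n _ \<longleftrightarrow> True"

text \<open>A loop round costs \<open>acost e + 3\<close> for the test and its branching, 4 for the
  increment, and the body. The last, failing test is charged as one more round, and the leading 2
  initialises the counter. A conditional is charged for both branches, which leaves the degree
  unchanged.\<close>

fun tb :: "nat \<Rightarrow> fcom \<Rightarrow> nat" where
  "tb n FSkip = 1"
| "tb n (FAssign x a) = acost a + 1"
| "tb n (FStore x i a) = acost i + acost a + 1"
| "tb n (FWStore x i a) = acost i + wcost a + 1"
| "tb n (c ;; d) = tb n c + tb n d"
| "tb n (FIf b c d) = bcost b + 1 + tb n c + tb n d"
| "tb n (FFor x e c) = 2 + (bd n e + 1) * (acost e + 7 + tb n c)"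

lemma set_simps [simp]:
  "reg (set_reg x v s) = (reg s)(x := v)" "arr (set_reg x v s) = arr s" "warr (set_reg x v s) = warr s"
  "reg (set_arr a i v s) = reg s" "arr (set_arr a i v s) = (arr s)(a := (arr s a)(i := v))"
  "warr (set_arr a i v s) = warr s"
  "reg (set_warr a i q s) = reg s" "arr (set_warr a i q s) = arr s"
  "warr (set_warr a i q s) = (warr s)(a := (warr s a)(i := q))"
  by (auto simp: set_reg_def set_arr_def set_warr_def)

lemma sem_For_inv:
  assumes "bd (reg s ''n'') e = m"
    and "P 0 (set_reg x 0 s)"
    and "\<And>i r. i < m \<Longrightarrow> P i r \<Longrightarrow> reg r x = i \<Longrightarrow> P (Suc i) (set_reg x (Suc i) (sem M c r))"
  shows "P m (sem M (FFor x e c) s)"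
proof -
  let ?f = "rec_nat (set_reg x 0 s) (\<lambda>i r. set_reg x (Suc i) (sem M c r))"
  have "i \<le> m \<Longrightarrow> P i (?f i) \<and> reg (?f i) x = i" for i
    by (induction i) (use assms(2,3) in auto)
  then show ?thesis using assms(1) by simp
qed

lemma sem_reg [simp]: "y \<notin> asg c \<Longrightarrow> reg (sem M c s) y = reg s y"
proof (induction c arbitrary: s)
  case (FFor x e c)
  have "reg (rec_nat (set_reg x 0 s) (\<lambda>i r. set_reg x (Suc i) (sem M c r)) m) y = reg s y" for m
    by (induction m) (use FFor in auto)
  then show ?case by simp
qed auto

lemma sem_arr [simp]: "a \<notin> sto c \<Longrightarrow> arr (sem M c s) a = arr s a"
proof (induction c arbitrary: s)
  case (FFor x e c)
  have "arr (rec_nat (set_reg x 0 s) (\<lambda>i r. set_reg x (Suc i) (sem M c r)) m) a = arr s a" for m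
    by (induction m) (use FFor in auto)
  then show ?case by simp
qed auto

lemma sem_warr [simp]: "a \<notin> wsto c \<Longrightarrow> warr (sem M c s) a = warr s a"
proof (induction c arbitrary: s)
  case (FFor x e c)
  have "warr (rec_nat (set_reg x 0 s) (\<lambda>i r. set_reg x (Suc i) (sem M c r)) m) a = warr s a" for m
    by (induction m) (use FFor in auto)
  then show ?case by simp
qed auto

text \<open>\<open>f i\<close> is the state before round \<open>i\<close>. Derivations of
  \<open>exec\<close> are built from the last round backwards, hence the induction on the number of
  rounds still to run.\<close>

lemma exec_While:
  assumes "\<And>i. i < m \<Longrightarrow> bval M (f i) b \<and> (\<exists>t. exec M c (f i) t (f (Suc i)) \<and> t \<le> T)"
    and "\<not> bval M (f m) b"
  shows "\<exists>t. exec M (While b c) (f 0) t (f m) \<and> t \<le> m * (bcost b + 1 + T) + bcost b + 1"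
proof -
  have "i \<le> m \<Longrightarrow> \<exists>t. exec M (While b c) (f (m - i)) t (f m) \<and> t \<le> i * (bcost b + 1 + T) + bcost b + 1" for i
  proof (induction i)
    case 0
    show ?case using exec.WhileFalse[OF assms(2)] by auto
  next
    case (Suc i)
    let ?j = "m - Suc i"
    have j: "?j < m" "Suc ?j = m - i" using Suc.prems by auto
    obtain t where t: "exec M c (f ?j) t (f (m - i))" "t \<le> T" "bval M (f ?j) b"
      using assms(1)[OF j(1)] j(2) by auto
    obtain t' where t': "exec M (While b c) (f (m - i)) t' (f m)" "t' \<le> i * (bcost b + 1 + T) + bcost b + 1"
      using Suc by auto
    have "exec M (While b c) (f ?j) (bcost b + 1 + t + t') (f m)"
      by (rule exec.WhileTrue[OF t(3,1) t'(1)])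
    then show ?case using t(2) t'(2) by (intro exI conjI) auto
  qed
  from this[of m] show ?thesis by simp
qed

theorem exec_compile:
  assumes "wf c" "okc M n c" "''n'' \<notin> asg c" "reg s ''n'' = n" "1 < M"
  shows "\<exists>t. exec M (compile c) s t (sem M c s) \<and> t \<le> tb n c"
  using assms
proof (induction c arbitrary: s)
  case FSkip
  show ?case unfolding compile.simps sem.simps tb.simps by (intro exI conjI, rule exec.Skip) simp
next
  case (FAssign x a)
  show ?case unfolding compile.simps sem.simps tb.simps by (intro exI conjI, rule exec.Assign) simp
next
  case (FStore x i a)
  show ?case unfolding compile.simps sem.simps tb.simps by (intro exI conjI, rule exec.Store) simp
next
  case (FWStore x i a)
  show ?case unfolding compile.simps sem.simps tb.simps by (intro exI conjI, rule exec.WStore) simp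
next
  case (FSeq c d)
  obtain t where t: "exec M (compile c) s t (sem M c s)" "t \<le> tb n c" using FSeq by auto
  have "reg (sem M c s) ''n'' = n" using FSeq.prems by simp
  then obtain u where u: "exec M (compile d) (sem M c s) u (sem M d (sem M c s))" "u \<le> tb n d"
    using FSeq.IH(2)[of "sem M c s"] FSeq.prems by auto
  from exec.Seq[OF t(1) u(1)] show ?case using t(2) u(2) by (auto intro!: exI[of _ "t + u"])
next
  case (FIf b c d)
  show ?case
  proof (cases "bval M s b")
    case True
    obtain t where t: "exec M (compile c) s t (sem M c s)" "t \<le> tb n c" using FIf by auto
    from exec.IfTrue[OF True t(1)] show ?thesis using t(2) True by (fastforce intro!: exI[of _ "bcost b + 1 + t"])
  next
    case False
    obtain t where t: "exec M (compile d) s t (sem M d s)" "t \<le> tb n d" using FIf by auto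
    from exec.IfFalse[OF False t(1)] show ?thesis using t(2) False by (fastforce intro!: exI[of _ "bcost b + 1 + t"])
  qed
next
  case (FFor x e c)
  define f where "f = rec_nat (set_reg x 0 s) (\<lambda>i r. set_reg x (Suc i) (sem M c r))"
  define m where "m = bd n e"
  have ok: "okb M n e" "x \<noteq> ''n''" using FFor.prems by auto
  \<comment> \<open>The counter never exceeds \<open>m\<close>, so its increment modulo
    \<open>M\<close> is exact.\<close>
  have mM: "m < M" using okb_less[OF ok(1)] by (simp add: m_def)
  have f: "reg (f i) x = i \<and> reg (f i) ''n'' = n" for i
    by (induction i) (use FFor.prems ok in \<open>auto simp: f_def\<close>)
  have e: "aval M (f i) e = m" for i using okb_aval[OF ok(1)] f by (simp add: m_def)
  have loop: "\<exists>t. exec M (While (Less (V x) e) (Seq (compile c) (Assign x (Plus (V x) (N 1))))) (f 0) t (f m) \<and>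
      t \<le> m * (bcost (Less (V x) e) + 1 + (tb n c + 4)) + bcost (Less (V x) e) + 1"
  proof (rule exec_While)
    show "\<not> bval M (f m) (Less (V x) e)" using e f by simp
    fix i assume i: "i < m"
    obtain t where t: "exec M (compile c) (f i) t (sem M c (f i))" "t \<le> tb n c"
      using FFor.IH[of "f i"] FFor.prems f by auto
    have x: "reg (sem M c (f i)) x = i" using FFor.prems f by simp
    have "set_reg x (aval M (sem M c (f i)) (Plus (V x) (N 1))) (sem M c (f i)) = f (Suc i)"
      using x i mM by (simp add: f_def)
    then have "exec M (Assign x (Plus (V x) (N 1))) (sem M c (f i)) 4 (f (Suc i))"
      using exec.Assign[of M x "Plus (V x) (N 1)" "sem M c (f i)"] by (simp add: eval_nat_numeral)
    from exec.Seq[OF t(1) this] t(2)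
    show "bval M (f i) (Less (V x) e) \<and>
       (\<exists>t. exec M (Seq (compile c) (Assign x (Plus (V x) (N 1)))) (f i) t (f (Suc i)) \<and> t \<le> tb n c + 4)"
      using e f i by (auto intro!: exI[of _ "t + 4"])
  qed
  then obtain t where t: "exec M (While (Less (V x) e) (Seq (compile c) (Assign x (Plus (V x) (N 1))))) (f 0) t (f m)"
     "t \<le> m * (acost e + 7 + tb n c) + acost e + 3" by (auto simp: algebra_simps)
  have "exec M (Assign x (N 0)) s 2 (f 0)"
    using exec.Assign[of M x "N 0" s] FFor.prems by (simp add: f_def numeral_2_eq_2)
  from exec.Seq[OF this t(1)] have "exec M (compile (FFor x e c)) s (2 + t) (sem M (FFor x e c) s)"
    using FFor.prems by (simp add: f_def m_def)
  moreover have "2 + t \<le> tb n (FFor x e c)" using t(2) by (simp add: m_def)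
  ultimately show ?case by blast
qed

section \<open>Polynomial bounds on the running time\<close>

fun bdeg :: "aexp \<Rightarrow> nat" where
  "bdeg (N c) = 0"
| "bdeg (V x) = 1"
| "bdeg (Plus a b) = max (bdeg a) (bdeg b)"
| "bdeg (Times a b) = bdeg a + bdeg b"
| "bdeg _ = 0"

text \<open>A loop with a constant bound, such as the one over the \<open>L\<close> digits of a
  tuple, has degree 0 and does not raise the exponent.\<close>

fun deg :: "fcom \<Rightarrow> nat" where
  "deg (c ;; d) = max (deg c) (deg d)"
| "deg (FIf b c d) = max (deg c) (deg d)"
| "deg (FFor x e c) = bdeg e + deg c"
| "deg _ = 0"

text \<open>The base \<open>n + 2\<close> is positive for every \<open>n\<close>, so powers increase
  with the exponent and constants can be absorbed.\<close>

lemma poly_max: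
  assumes "f \<le> K * (n + 2) ^ a" "g \<le> L * (n + 2) ^ b"
  shows "f + g \<le> (K + L) * (n + 2 :: nat) ^ max a b"
proof -
  have "K * (n + 2) ^ a \<le> K * (n + 2) ^ max a b" "L * (n + 2) ^ b \<le> L * (n + 2) ^ max a b"
    by (auto intro!: mult_le_mono power_increasing)
  then show ?thesis using assms unfolding add_mult_distrib by linarith
qed

lemma poly_times:
  assumes "f \<le> K * (n + 2) ^ a" "g \<le> L * (n + 2) ^ b"
  shows "f * g \<le> (K * L) * (n + 2 :: nat) ^ (a + b)"
proof -
  have "f * g \<le> (K * (n + 2) ^ a) * (L * (n + 2) ^ b)" using assms by (rule mult_le_mono)
  then show ?thesis by (simp only: power_add ac_simps)
qed

lemma bd_poly: "\<exists>K. \<forall>n. bd n e \<le> K * (n + 2) ^ bdeg e"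
proof (induction e)
  case (N c) then show ?case by auto
next
  case (V x) then show ?case by (auto intro!: exI[of _ 1])
next
  case (Plus a b)
  then obtain K L where "\<forall>n. bd n a \<le> K * (n + 2) ^ bdeg a" "\<forall>n. bd n b \<le> L * (n + 2) ^ bdeg b" by blast
  then show ?case using poly_max by (intro exI[of _ "K + L"]) auto
next
  case (Times a b)
  then obtain K L where "\<forall>n. bd n a \<le> K * (n + 2) ^ bdeg a" "\<forall>n. bd n b \<le> L * (n + 2) ^ bdeg b" by blast
  then show ?case using poly_times by (intro exI[of _ "K * L"]) auto
qed auto

lemma const_poly: "(c::nat) \<le> c * (n + 2) ^ a" by simp

theorem tb_poly: "\<exists>K. \<forall>n. tb n c \<le> K * (n + 2) ^ deg c"
proof (induction c)
  case (FSeq c d)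
  then obtain K L where "\<forall>n. tb n c \<le> K * (n + 2) ^ deg c" "\<forall>n. tb n d \<le> L * (n + 2) ^ deg d" by blast
  then show ?case using poly_max by (intro exI[of _ "K + L"]) auto
next
  case (FIf b c d)
  then obtain K L where KL: "\<forall>n. tb n c \<le> K * (n + 2) ^ deg c" "\<forall>n. tb n d \<le> L * (n + 2) ^ deg d" by blast
  have "tb n (FIf b c d) \<le> (bcost b + 1 + (K + L)) * (n + 2) ^ deg (FIf b c d)" for n
  proof -
    have "tb n c + tb n d \<le> (K + L) * (n + 2) ^ max (deg c) (deg d)"
      using KL by (intro poly_max) auto
    moreover have "bcost b + 1 \<le> (bcost b + 1) * (n + 2) ^ max (deg c) (deg d)" by (rule const_poly)
    moreover have "(bcost b + 1 + (K + L)) * (n + 2) ^ max (deg c) (deg d)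
       = (bcost b + 1) * (n + 2) ^ max (deg c) (deg d) + (K + L) * (n + 2) ^ max (deg c) (deg d)"
      by (rule add_mult_distrib)
    ultimately show ?thesis unfolding tb.simps deg.simps by linarith
  qed
  then show ?case by blast
next
  case (FFor x e c)
  then obtain K where K: "\<forall>n. tb n c \<le> K * (n + 2) ^ deg c" by blast
  obtain L where L: "\<forall>n. bd n e \<le> L * (n + 2) ^ bdeg e" using bd_poly by blast
  have "tb n (FFor x e c) \<le> (2 + (L + 1) * (acost e + 7 + K)) * (n + 2) ^ deg (FFor x e c)" for n
  proof -
    have "bd n e + 1 \<le> (L + 1) * (n + 2) ^ bdeg e"
      using spec[OF L, of n] const_poly[of 1 n "bdeg e"] unfolding add_mult_distrib by linarith
    moreover have "acost e + 7 + tb n c \<le> (acost e + 7 + K) * (n + 2) ^ deg c"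
      using spec[OF K, of n] const_poly[of "acost e + 7" n "deg c"] unfolding add_mult_distrib by linarith
    ultimately have "(bd n e + 1) * (acost e + 7 + tb n c) \<le>
        ((L + 1) * (acost e + 7 + K)) * (n + 2) ^ (bdeg e + deg c)" by (rule poly_times)
    moreover have "2 \<le> 2 * (n + 2) ^ (bdeg e + deg c)" by (rule const_poly)
    ultimately show ?thesis unfolding tb.simps deg.simps add_mult_distrib[of 2] by linarith
  qed
  then show ?case by blast
qed (auto intro: const_poly)

section \<open>Verified program blocks\<close>

abbreviation NZ :: "aexp \<Rightarrow> bexp" where "NZ e \<equiv> Less (N 0) e"
abbreviation EQ :: "aexp \<Rightarrow> aexp \<Rightarrow> bexp" where "EQ a b \<equiv> BAnd (BNot (Less a b)) (BNot (Less b a))"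
abbreviation At :: "string \<Rightarrow> aexp \<Rightarrow> aexp \<Rightarrow> aexp" where "At a i j \<equiv> Arr a (Plus (Times i (V ''n'')) j)"
abbreviation "len \<equiv> V ''n''"

text \<open>\<open>X\<close> and \<open>A\<close> list what a block may change. The block lemmas ask
  for the value of a test in every such state \<open>r\<close>, because tests are evaluated in the
  middle of a loop.\<close>

definition agree :: "string set \<Rightarrow> string set \<Rightarrow> state \<Rightarrow> state \<Rightarrow> bool" where
  "agree X A s r \<longleftrightarrow> (\<forall>z. z \<notin> X \<longrightarrow> reg r z = reg s z) \<and> (\<forall>a. a \<notin> A \<longrightarrow> arr r a = arr s a) \<and> warr r = warr s"

lemma agreeD:
  "agree X A s r \<Longrightarrow> z \<notin> X \<Longrightarrow> reg r z = reg s z"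
  "agree X A s r \<Longrightarrow> a \<notin> A \<Longrightarrow> arr r a = arr s a"
  "agree X A s r \<Longrightarrow> warr r = warr s"
  unfolding agree_def by auto

lemma agree_refl: "agree X A s s" by (simp add: agree_def)

lemma agree_set_reg: "agree X A s r \<Longrightarrow> x \<in> X \<Longrightarrow> agree X A s (set_reg x v r)"
  by (auto simp: agree_def)

lemma agree_set_arr: "agree X A s r \<Longrightarrow> a \<in> A \<Longrightarrow> agree X A s (set_arr a i v r)"
  by (auto simp: agree_def)

lemma agree_trans: "agree X A s r \<Longrightarrow> agree X A r r' \<Longrightarrow> agree X A s r'"
  by (auto simp: agree_def)

lemma agree_sem: "asg c \<subseteq> X \<Longrightarrow> sto c \<subseteq> A \<Longrightarrow> wsto c = {} \<Longrightarrow> agree X A s (sem M c s)"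
  unfolding agree_def
  by (intro conjI allI impI ext; (rule sem_reg sem_arr[THEN fun_cong] sem_warr[THEN fun_cong]; blast)?)

definition fill :: "string \<Rightarrow> string \<Rightarrow> bexp \<Rightarrow> fcom" where
  "fill x a b = FFor x len (FIf b (FStore a (V x) (N 1)) (FStore a (V x) (N 0)))"

definition fill_ex :: "string \<Rightarrow> string \<Rightarrow> string \<Rightarrow> bexp \<Rightarrow> fcom" where
  "fill_ex x y a b = FFor x len (FStore a (V x) (N 0) ;; FFor y len (FIf b (FStore a (V x) (N 1)) FSkip))"

definition fill_rows :: "string \<Rightarrow> string \<Rightarrow> string \<Rightarrow> bexp \<Rightarrow> bexp \<Rightarrow> fcom" where
  "fill_rows x y a bx b = FFor x len (FIf bx (FFor y len
     (FIf b (FStore a (Plus (Times (V x) len) (V y)) (N 1)) (FStore a (Plus (Times (V x) len) (V y)) (N 0)))) FSkip)"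

definition find_pair :: "string \<Rightarrow> string \<Rightarrow> string \<Rightarrow> string \<Rightarrow> string \<Rightarrow> nat \<Rightarrow> bexp \<Rightarrow> fcom" where
  "find_pair x y m x' y' k b = FFor x len (FFor y len
     (FIf b (FAssign m (N k) ;; FAssign x' (V x) ;; FAssign y' (V y)) FSkip))"

text \<open>A round that marks nothing new has reached a closed set, and at most n vertices can be
  marked, so n rounds over all pairs suffice. These three nested loops, run once per round of a
  phase, are where the n^4 comes from.\<close>

definition closure :: "string \<Rightarrow> string \<Rightarrow> fcom" where
  "closure cl al = FFor ''r'' len (FFor ''u'' len (FFor ''v'' len
     (FIf (BAnd (NZ (Arr cl (V ''u''))) (BAnd (NZ (At ''adj'' (V ''u'') (V ''v''))) (NZ (Arr al (V ''v'')))))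
        (FStore cl (V ''v'') (N 1)) FSkip)))"

lemma block_frames [simp]:
  "asg (fill x a b) = {x}" "sto (fill x a b) = {a}" "wsto (fill x a b) = {}"
  "asg (fill_ex x y a b) = {x, y}" "sto (fill_ex x y a b) = {a}" "wsto (fill_ex x y a b) = {}"
  "asg (fill_rows x y a bx b) = {x, y}" "sto (fill_rows x y a bx b) = {a}" "wsto (fill_rows x y a bx b) = {}"
  "asg (find_pair x y m x' y' k b) = {x, y, m, x', y'}" "sto (find_pair x y m x' y' k b) = {}"
  "wsto (find_pair x y m x' y' k b) = {}"
  "asg (closure cl al) = {''r'', ''u'', ''v''}" "sto (closure cl al) = {cl}" "wsto (closure cl al) = {}"
  by (auto simp: fill_def fill_ex_def fill_rows_def find_pair_def closure_def)

locale ram = fgraph "{..<n}" E for n :: nat and E :: "nat \<Rightarrow> nat \<Rightarrow> bool" +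
  fixes M :: nat
  assumes M2: "2 < M" and nnM: "n * n + n < M"
begin

lemma M1: "1 < M" using M2 by simp

definition aset :: "state \<Rightarrow> string \<Rightarrow> nat set" where
  "aset s a = {u. u < n \<and> arr s a u \<noteq> 0}"

definition rows :: "state \<Rightarrow> string \<Rightarrow> nat \<Rightarrow> nat set" where
  "rows s a c = {u. u < n \<and> arr s a (c * n + u) \<noteq> 0}"

definition inp :: "state \<Rightarrow> bool" where
  "inp s \<longleftrightarrow> reg s ''n'' = n \<and> (\<forall>u<n. \<forall>v<n. arr s ''adj'' (u * n + v) \<noteq> 0 \<longleftrightarrow> E u v)"

lemma nM: "n < M" using nnM by simp

lemma idx_less: "u < n \<Longrightarrow> v < n \<Longrightarrow> u * n + v < n * n"
proof -
  assume "u < n" "v < n"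
  then have "u * n + n \<le> n * n" using mult_le_mono1[of "Suc u" n n] by simp
  then show ?thesis using \<open>v < n\<close> by linarith
qed

lemma aval_idx [simp]:
  "reg r ''n'' = n \<Longrightarrow> aval M r i < n \<Longrightarrow> aval M r j < n \<Longrightarrow>
     aval M r (Plus (Times i len) j) = aval M r i * n + aval M r j"
proof -
  assume *: "reg r ''n'' = n" "aval M r i < n" "aval M r j < n"
  have "aval M r i * n + aval M r j < M" using idx_less[OF *(2,3)] nnM by linarith
  then show ?thesis using *(1) by simp
qed

declare aval.simps(4) [simp del]

lemma aval_Plus: "aval M r a + aval M r b < M \<Longrightarrow> aval M r (Plus a b) = aval M r a + aval M r b"
  by (simp add: aval.simps(4))

lemma idx_inj: "v < n \<Longrightarrow> v' < n \<Longrightarrow> u * n + v = u' * n + v' \<longleftrightarrow> u = u' \<and> v = (v' :: nat)"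
proof -
  assume "v < n" "v' < n"
  then have "(u * n + v) div n = u" "(u * n + v) mod n = v" "(u' * n + v') div n = u'" "(u' * n + v') mod n = v'"
    by auto
  then show ?thesis by metis
qed

lemma aset_fill:
  assumes s: "reg s ''n'' = n" "x \<noteq> ''n''"
    and b: "\<And>u r. u < n \<Longrightarrow> agree {x} {a} s r \<Longrightarrow> reg r x = u \<Longrightarrow> bval M r b = Q u"
  shows "aset (sem M (fill x a b) s) a = {u. u < n \<and> Q u}"
proof -
  let ?P = "\<lambda>i r. agree {x} {a} s r \<and> (\<forall>u<i. arr r a u \<noteq> 0 \<longleftrightarrow> Q u)"
  have "?P n (sem M (fill x a b) s)"
    unfolding fill_def
  proof (rule sem_For_inv[where P = ?P])
    show "bd (reg s ''n'') len = n" using s by simp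
    show "?P 0 (set_reg x 0 s)" by (auto simp: agree_def)
    fix i r assume i: "i < n" and P: "?P i r" and x: "reg r x = i"
    have "bval M r b = Q i" using b P x i by blast
    then show "?P (Suc i) (set_reg x (Suc i) (sem M (FIf b (FStore a (V x) (N 1)) (FStore a (V x) (N 0))) r))"
      using P x M1 by (auto intro!: agree_set_reg agree_set_arr simp: less_Suc_eq)
  qed
  then show ?thesis unfolding aset_def by auto
qed

lemma aset_fill_ex:
  assumes s: "reg s ''n'' = n" "x \<noteq> ''n''" "y \<noteq> ''n''" "x \<noteq> y"
    and b: "\<And>u v r. u < n \<Longrightarrow> v < n \<Longrightarrow> agree {x, y} {a} s r \<Longrightarrow> reg r x = u \<Longrightarrow> reg r y = v \<Longrightarrow> bval M r b = Q u v"
  shows "aset (sem M (fill_ex x y a b) s) a = {u. u < n \<and> (\<exists>v<n. Q u v)}"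
proof -
  let ?P = "\<lambda>i r. agree {x, y} {a} s r \<and> (\<forall>u<i. arr r a u \<noteq> 0 \<longleftrightarrow> (\<exists>v<n. Q u v))"
  let ?c = "FFor y len (FIf b (FStore a (V x) (N 1)) FSkip)"
  have "?P n (sem M (fill_ex x y a b) s)"
    unfolding fill_ex_def
  proof (rule sem_For_inv[where P = ?P])
    show "bd (reg s ''n'') len = n" using s by simp
    show "?P 0 (set_reg x 0 s)" by (auto simp: agree_def)
    fix i r assume i: "i < n" and P: "?P i r" and x: "reg r x = i"
    let ?r = "set_arr a i 0 r"
    let ?P' = "\<lambda>j q. agree {x, y} {a} s q \<and> reg q x = i \<and> (\<forall>u<i. arr q a u = arr r a u) \<and>
        (arr q a i \<noteq> 0 \<longleftrightarrow> (\<exists>v<j. Q i v))"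
    have "?P' n (sem M ?c ?r)"
    proof (rule sem_For_inv[where P = ?P'])
      show "bd (reg ?r ''n'') len = n" using s P by (simp add: agree_def)
      show "?P' 0 (set_reg y 0 ?r)" using P x s by (auto intro!: agree_set_reg agree_set_arr)
      fix j q assume j: "j < n" and P': "?P' j q" and y: "reg q y = j"
      have "bval M q b = Q i j" using b[OF i j] P' y by blast
      then show "?P' (Suc j) (set_reg y (Suc j) (sem M (FIf b (FStore a (V x) (N 1)) FSkip) q))"
        using P' s M1 by (auto intro!: agree_set_reg agree_set_arr simp: less_Suc_eq)
    qed
    moreover have "sem M (FStore a (V x) (N 0)) r = ?r" using x by simp
    ultimately show "?P (Suc i) (set_reg x (Suc i) (sem M (FStore a (V x) (N 0) ;; ?c) r))"
      unfolding sem.simps(5) using P by (auto intro!: agree_set_reg simp: less_Suc_eq simp del: sem.simps)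
  qed
  then show ?thesis unfolding aset_def by auto
qed

lemma rows_fill_rows:
  assumes s: "reg s ''n'' = n" "x \<noteq> ''n''" "y \<noteq> ''n''" "x \<noteq> y"
    and bx: "\<And>u r. u < n \<Longrightarrow> agree {x, y} {a} s r \<Longrightarrow> reg r x = u \<Longrightarrow> bval M r bx = R u"
    and b: "\<And>u v r. u < n \<Longrightarrow> v < n \<Longrightarrow> agree {x, y} {a} s r \<Longrightarrow> reg r x = u \<Longrightarrow> reg r y = v \<Longrightarrow> bval M r b = Q u v"
    and c: "c < n"
  shows "rows (sem M (fill_rows x y a bx b) s) a c = (if R c then {v. v < n \<and> Q c v} else rows s a c)"
proof -
  let ?new = "\<lambda>u v. if R u then Q u v else arr s a (u * n + v) \<noteq> 0"
  let ?old = "\<lambda>u v. arr s a (u * n + v) \<noteq> 0"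
  let ?P = "\<lambda>i r. agree {x, y} {a} s r \<and>
     (\<forall>u<n. \<forall>v<n. arr r a (u * n + v) \<noteq> 0 \<longleftrightarrow> (if u < i then ?new u v else ?old u v))"
  let ?s = "FIf b (FStore a (Plus (Times (V x) len) (V y)) (N 1)) (FStore a (Plus (Times (V x) len) (V y)) (N 0))"
  have "?P n (sem M (fill_rows x y a bx b) s)"
    unfolding fill_rows_def
  proof (rule sem_For_inv[where P = ?P])
    show "bd (reg s ''n'') len = n" using s by simp
    show "?P 0 (set_reg x 0 s)" by (auto simp: agree_def)
    fix i r assume i: "i < n" and P: "?P i r" and x: "reg r x = i"
    have bx': "bval M r bx = R i" using bx P x i by blast
    show "?P (Suc i) (set_reg x (Suc i) (sem M (FIf bx (FFor y len ?s) FSkip) r))"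
    proof (cases "R i")
      case False
      then show ?thesis using bx' P by (auto intro!: agree_set_reg simp: less_Suc_eq)
    next
      case True
      let ?P' = "\<lambda>j q. agree {x, y} {a} s q \<and> reg q x = i \<and>
         (\<forall>u<n. \<forall>v<n. arr q a (u * n + v) \<noteq> 0 \<longleftrightarrow> (if u < i \<or> u = i \<and> v < j then ?new u v else ?old u v))"
      have "?P' n (sem M (FFor y len ?s) r)"
      proof (rule sem_For_inv[where P = ?P'])
        show "bd (reg r ''n'') len = n" using s P by (simp add: agree_def)
        show "?P' 0 (set_reg y 0 r)" using P x s by (auto intro!: agree_set_reg)
        fix j q assume j: "j < n" and P': "?P' j q" and y: "reg q y = j"
        have "bval M q b = Q i j" using b[OF i j] P' y by blast
        moreover have "aval M q (Plus (Times (V x) len) (V y)) = i * n + j"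
          using P' y i j s by (subst aval_idx) (auto simp: agree_def)
        ultimately have q: "sem M ?s q = set_arr a (i * n + j) (if Q i j then 1 else 0) q"
          using M1 by simp
        show "?P' (Suc j) (set_reg y (Suc j) (sem M ?s q))"
          unfolding q using P' s True i j
          by (auto intro!: agree_set_reg agree_set_arr simp: less_Suc_eq idx_inj)
      qed
      then show ?thesis using bx' True by (auto intro!: agree_set_reg simp: less_Suc_eq simp del: sem.simps(7))
    qed
  qed
  then show ?thesis unfolding rows_def using c by auto
qed

text \<open>The loops do not stop at a hit and later pairs overwrite earlier ones, so the invariant
  only claims that the registers hold some suitable pair once one has been scanned.\<close>

lemma find_pair:
  assumes s: "reg s ''n'' = n" and d: "distinct [x, y, m, x', y', ''n'']" and k: "k < M"
    and b: "\<And>u v r. u < n \<Longrightarrow> v < n \<Longrightarrow> agree {x, y, m, x', y'} {} s r \<Longrightarrow> reg r x = u \<Longrightarrow> reg r y = v \<Longrightarrow> bval M r b = Q u v"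
    and r: "r = sem M (find_pair x y m x' y' k b) s"
  shows "(\<exists>u<n. \<exists>v<n. Q u v) \<Longrightarrow> reg r m = k \<and> reg r x' < n \<and> reg r y' < n \<and> Q (reg r x') (reg r y')"
    and "\<not> (\<exists>u<n. \<exists>v<n. Q u v) \<Longrightarrow> reg r m = reg s m \<and> reg r x' = reg s x' \<and> reg r y' = reg s y'"
proof -
  let ?G = "\<lambda>B r. agree {x, y, m, x', y'} {} s r \<and>
     (if B then reg r m = k \<and> reg r x' < n \<and> reg r y' < n \<and> Q (reg r x') (reg r y')
      else reg r m = reg s m \<and> reg r x' = reg s x' \<and> reg r y' = reg s y')"
  let ?c = "FIf b (FAssign m (N k) ;; FAssign x' (V x) ;; FAssign y' (V y)) FSkip"
  have "?G (\<exists>u<n. \<exists>v<n. Q u v) r"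
    unfolding r find_pair_def
  proof (rule sem_For_inv[where P = "\<lambda>i r. ?G (\<exists>u<i. \<exists>v<n. Q u v) r"])
    show "bd (reg s ''n'') len = n" using s by simp
    show "?G (\<exists>u<0. \<exists>v<n. Q u v) (set_reg x 0 s)" using d by (auto simp: agree_def)
    fix i r assume i: "i < n" and P: "?G (\<exists>u<i. \<exists>v<n. Q u v) r" and x: "reg r x = i"
    have "?G ((\<exists>u<i. \<exists>v<n. Q u v) \<or> (\<exists>v<n. Q i v)) (sem M (FFor y len ?c) r) \<and> reg (sem M (FFor y len ?c) r) x = i"
    proof (rule sem_For_inv[where P = "\<lambda>j r. ?G ((\<exists>u<i. \<exists>v<n. Q u v) \<or> (\<exists>v<j. Q i v)) r \<and> reg r x = i"])
      have "reg r ''n'' = reg s ''n''"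
        by (rule agreeD(1)[of "{x, y, m, x', y'}" "{}"]) (use P d in auto)
      then show "bd (reg r ''n'') len = n" using s by simp
      show "?G ((\<exists>u<i. \<exists>v<n. Q u v) \<or> (\<exists>v<0. Q i v)) (set_reg y 0 r) \<and> reg (set_reg y 0 r) x = i"
        using P x d by (auto intro!: agree_set_reg)
      fix j q assume j: "j < n" and P': "?G ((\<exists>u<i. \<exists>v<n. Q u v) \<or> (\<exists>v<j. Q i v)) q \<and> reg q x = i" and y: "reg q y = j"
      have ag: "agree {x, y, m, x', y'} {} s q" using P' by blast
      have bq: "bval M q b = Q i j" using b[OF i j ag] P' y by blast
      show "?G ((\<exists>u<i. \<exists>v<n. Q u v) \<or> (\<exists>v<Suc j. Q i v)) (set_reg y (Suc j) (sem M ?c q)) \<and>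
         reg (set_reg y (Suc j) (sem M ?c q)) x = i"
      proof (cases "Q i j")
        case True
        then have ex: "((\<exists>u<i. \<exists>v<n. Q u v) \<or> (\<exists>v<Suc j. Q i v)) = True" by auto
        show ?thesis unfolding ex using True bq P' y d i j k ag by (auto intro!: agree_set_reg)
      next
        case False
        then have ex: "(\<exists>v<Suc j. Q i v) = (\<exists>v<j. Q i v)" by (auto simp: less_Suc_eq)
        show ?thesis unfolding ex using False bq P' d by (auto intro!: agree_set_reg)
      qed
    qed
    moreover have "((\<exists>u<i. \<exists>v<n. Q u v) \<or> (\<exists>v<n. Q i v)) = (\<exists>u<Suc i. \<exists>v<n. Q u v)"
      by (auto simp: less_Suc_eq)
    ultimately show "?G (\<exists>u<Suc i. \<exists>v<n. Q u v) (set_reg x (Suc i) (sem M (FFor y len ?c) r))"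
      using d by (auto intro!: agree_set_reg simp del: sem.simps)
  qed
  then show "(\<exists>u<n. \<exists>v<n. Q u v) \<Longrightarrow> reg r m = k \<and> reg r x' < n \<and> reg r y' < n \<and> Q (reg r x') (reg r y')"
    and "\<not> (\<exists>u<n. \<exists>v<n. Q u v) \<Longrightarrow> reg r m = reg s m \<and> reg r x' = reg s x' \<and> reg r y' = reg s y'" by auto
qed

lemma aset_closure:
  assumes s: "inp s" and d: "cl \<noteq> al" "cl \<noteq> ''adj''" and seed: "aset s cl = {z}" "z < n"
  shows "aset (sem M (closure cl al) s) cl = reach (aset s al) z"
proof -
  define U where "U = aset s al"
  define R where "R = reach U z"
  let ?A = "agree {''r'', ''u'', ''v''} {cl} s"
  let ?b = "BAnd (NZ (Arr cl (V ''u''))) (BAnd (NZ (At ''adj'' (V ''u'') (V ''v''))) (NZ (Arr al (V ''v''))))"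
  let ?c = "FIf ?b (FStore cl (V ''v'') (N 1)) FSkip"
  have Un: "U \<subseteq> {..<n}" by (auto simp: U_def aset_def)
  then have Rn: "R \<subseteq> {..<n}" using reach_subset[of U z] seed unfolding R_def by auto
  have zR: "z \<in> R" unfolding R_def by (rule reach_refl)
  have Rs: "b \<in> R" if "a \<in> R" "E a b" "b \<in> U" for a b using that reach_step unfolding R_def by blast
  have inner: "?A q' \<and> reg q' ''u'' = i \<and> X \<subseteq> aset q' cl \<and> aset q' cl \<subseteq> R \<and>
      (i \<in> X \<longrightarrow> (\<forall>v\<in>U. E i v \<longrightarrow> v \<in> aset q' cl))"
    if q: "?A q" "reg q ''u'' = i" "i < n" "X \<subseteq> aset q cl" "aset q cl \<subseteq> R" and q': "q' = sem M (FFor ''v'' len ?c) q"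
    for q q' i X
  proof -
    let ?P = "\<lambda>j q'. ?A q' \<and> reg q' ''u'' = i \<and> X \<subseteq> aset q' cl \<and> aset q' cl \<subseteq> R \<and>
      (i \<in> X \<longrightarrow> (\<forall>v\<in>U. v < j \<longrightarrow> E i v \<longrightarrow> v \<in> aset q' cl))"
    have "?P n q'" unfolding q'
    proof (rule sem_For_inv[where P = ?P])
      show "bd (reg q ''n'') len = n" using q s by (auto simp: agree_def inp_def)
      show "?P 0 (set_reg ''v'' 0 q)" using q by (auto intro!: agree_set_reg simp: aset_def)
      fix j p assume j: "j < n" and P: "?P j p" and v: "reg p ''v'' = j"
      have pn: "reg p ''n'' = n" "arr p ''adj'' = arr s ''adj''" "arr p al = arr s al"
        using P s d by (auto simp: agree_def inp_def)
      have "aval M p (At ''adj'' (V ''u'') (V ''v'')) = arr s ''adj'' (i * n + j)"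
        using P v pn j q by simp
      then have "bval M p ?b \<longleftrightarrow> i \<in> aset p cl \<and> E i j \<and> j \<in> U"
        using P v pn j q(3) s by (simp add: inp_def aset_def U_def)
      moreover define p' where "p' = set_arr cl j 1 p"
      ultimately have sp: "sem M ?c p = (if i \<in> aset p cl \<and> E i j \<and> j \<in> U then p' else p)"
        using v M1 by simp
      have as: "aset p' cl = insert j (aset p cl)" "reg p' = reg p" using j by (auto simp: aset_def p'_def)
      have ag: "?A p'" unfolding p'_def using P by (auto intro!: agree_set_arr)
      have as2: "aset (set_reg y k p) cl = aset p cl" for y k p by (simp add: aset_def)
      show "?P (Suc j) (set_reg ''v'' (Suc j) (sem M ?c p))"
      proof (cases "i \<in> aset p cl \<and> E i j \<and> j \<in> U")
        case True
        then have "j \<in> R" using Rs P by blast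
        with True show ?thesis unfolding sp as2 using P ag as
          by (auto intro!: agree_set_reg simp: less_Suc_eq)
      next
        case False
        then show ?thesis unfolding sp as2 using P by (auto intro!: agree_set_reg simp: less_Suc_eq)
      qed
    qed
    then show ?thesis using Un by auto
  qed
  \<comment> \<open>Marks set during a round may already be used in the same round. So a round is
    described by two bounds: it marks at least the neighbours in \<open>U\<close> of the vertices
    marked before, and never leaves \<open>R\<close>.\<close>
  have middle: "?A q' \<and> X \<subseteq> aset q' cl \<and> aset q' cl \<subseteq> R \<and> (\<forall>a\<in>X. \<forall>v\<in>U. E a v \<longrightarrow> v \<in> aset q' cl)"
    if q: "?A q" "X = aset q cl" "X \<subseteq> R" and q': "q' = sem M (FFor ''u'' len (FFor ''v'' len ?c)) q" for q q' X
  proof -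
    let ?P = "\<lambda>i q'. ?A q' \<and> X \<subseteq> aset q' cl \<and> aset q' cl \<subseteq> R \<and>
       (\<forall>a\<in>X. a < i \<longrightarrow> (\<forall>v\<in>U. E a v \<longrightarrow> v \<in> aset q' cl))"
    have "?P n q'" unfolding q'
    proof (rule sem_For_inv[where P = ?P])
      show "bd (reg q ''n'') len = n" using q s by (auto simp: agree_def inp_def)
      show "?P 0 (set_reg ''u'' 0 q)" using q by (auto intro!: agree_set_reg simp: aset_def)
      fix i p assume i: "i < n" and P: "?P i p" and u: "reg p ''u'' = i"
      have as2: "aset (set_reg y k p) cl = aset p cl" for y k p by (simp add: aset_def)
      have pX: "aset p cl \<subseteq> aset p cl" "aset p cl \<subseteq> R" "?A p" using P by auto
      note in1 = inner[OF pX(3) u i pX(1,2) refl]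
      show "?P (Suc i) (set_reg ''u'' (Suc i) (sem M (FFor ''v'' len ?c) p))"
        unfolding as2 using in1 P by (auto intro!: agree_set_reg simp: less_Suc_eq simp del: sem.simps)
    qed
    then show ?thesis using q(3) Rn by auto
  qed
  \<comment> \<open>Each round before completion adds a vertex. After \<open>n\<close> rounds the
    second disjunct would require more than \<open>n\<close> marked vertices.\<close>
  let ?P = "\<lambda>i q. ?A q \<and> z \<in> aset q cl \<and> aset q cl \<subseteq> R \<and> (aset q cl = R \<or> i < card (aset q cl))"
  have "?P n (sem M (closure cl al) s)"
    unfolding closure_def
  proof (rule sem_For_inv[where P = ?P])
    show "bd (reg s ''n'') len = n" using s by (auto simp: inp_def)
    have as2: "aset (set_reg y k p) cl = aset p cl" for y k p by (simp add: aset_def)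
    show "?P 0 (set_reg ''r'' 0 s)" unfolding as2 using seed zR by (auto intro!: agree_set_reg agree_refl)
    fix i p assume i: "i < n" and P: "?P i p" and r: "reg p ''r'' = i"
    let ?q = "sem M (FFor ''u'' len (FFor ''v'' len ?c)) p"
    have P1: "?A p" "aset p cl \<subseteq> R" using P by auto
    note m = middle[OF P1(1) refl P1(2) refl]
    have "aset ?q cl = R \<or> Suc i < card (aset ?q cl)"
    proof (cases "aset p cl = aset ?q cl")
      case True
      have "R \<subseteq> aset p cl" unfolding R_def
        by (rule reach_least) (use m P True in auto)
      then show ?thesis using m by blast
    next
      case False
      have fin: "finite (aset ?q cl)" by (auto simp: aset_def)
      have "aset p cl \<subset> aset ?q cl" using m False by blast
      then have "card (aset p cl) < card (aset ?q cl)" using fin by (rule psubset_card_mono[rotated])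
      moreover have "aset p cl = R \<Longrightarrow> aset ?q cl = R" using m by blast
      ultimately show ?thesis using P by auto
    qed
    then show "?P (Suc i) (set_reg ''r'' (Suc i) ?q)"
      unfolding as2 using m P by (auto intro!: agree_set_reg simp del: sem.simps)
  qed
  moreover have "aset q cl \<subseteq> {..<n}" for q by (auto simp: aset_def)
  then have "card (aset q cl) \<le> n" for q using card_mono[of "{..<n}" "aset q cl"] by simp
  ultimately show ?thesis unfolding R_def[symmetric] U_def[symmetric] by (meson not_le)
qed

end

section \<open>Computing the elimination order\<close>

definition IN :: "string \<Rightarrow> string \<Rightarrow> bexp" where "IN a x = NZ (Arr a (V x))"
definition ADJ :: "string \<Rightarrow> string \<Rightarrow> bexp" where "ADJ x y = NZ (At ''adj'' (V x) (V y))"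
definition SAME :: "string \<Rightarrow> string \<Rightarrow> bexp" where "SAME x y = EQ (V x) (V y)"

definition comp_code :: fcom where
  "comp_code =
     fill ''u'' ''C'' (SAME ''u'' ''z'') ;;
     closure ''C'' ''al'' ;;
     fill_ex ''u'' ''v'' ''S'' (BAnd (IN ''C'' ''v'') (BAnd (ADJ ''v'' ''u'') (BNot (IN ''al'' ''u''))))"

text \<open>The array \<open>al\<close> is overwritten here; \<open>pick_code\<close> recomputes it
  from \<open>pos\<close> at the start of every round.\<close>

definition sep_code :: fcom where
  "sep_code =
     fill ''u'' ''al'' (BAnd (IN ''C'' ''u'') (BNot (ADJ ''x'' ''u''))) ;;
     fill ''u'' ''A'' (SAME ''u'' ''y'') ;;
     closure ''A'' ''al'' ;;
     fill_ex ''u'' ''v'' ''T'' (BAnd (BAnd (IN ''C'' ''u'') (ADJ ''x'' ''u'')) (BAnd (IN ''A'' ''v'') (ADJ ''v'' ''u'')))"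

text \<open>\<open>mode\<close> 1 means that both vertices are in F, 2 that x is in K and y in F, 0
  that N(C) is a clique. The second search runs only after the first has failed, so that mode 2
  guarantees F to be a clique. By symmetry the test \<open>u < v\<close> loses no pair; it excludes
  u = v.\<close>

definition find_code :: fcom where
  "find_code =
     FAssign ''mode'' (N 0) ;;
     find_pair ''u'' ''v'' ''mode'' ''x'' ''y'' 1
       (BAnd (BAnd (IN ''S'' ''u'') (BNot (IN ''K'' ''u'')))
         (BAnd (BAnd (IN ''S'' ''v'') (BNot (IN ''K'' ''v''))) (BAnd (Less (V ''u'') (V ''v'')) (BNot (ADJ ''u'' ''v''))))) ;;
     FIf (NZ (V ''mode'')) FSkip (find_pair ''u'' ''v'' ''mode'' ''x'' ''y'' 2
       (BAnd (IN ''K'' ''u'') (BAnd (BAnd (IN ''S'' ''v'') (BNot (IN ''K'' ''v''))) (BNot (ADJ ''u'' ''v'')))))"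

text \<open>The new entries \<open>kk\<close> of \<open>order_inv_hub\<close>,
  \<open>order_inv_cliques\<close> and \<open>order_inv_single\<close> for modes 1, 2 and 0. In mode
  2 the two passes concern disjoint sets of rows. Rows of vertices about to be removed are written
  too but never read again.\<close>

definition rows_code :: fcom where
  "rows_code =
     FIf (NZ (V ''mode''))
       (FIf (Less (N 1) (V ''mode''))
         (fill_rows ''u'' ''v'' ''kk'' (BAnd (IN ''C'' ''u'') (IN ''A'' ''u'')) (BAnd (IN ''S'' ''v'') (BNot (IN ''K'' ''v''))) ;;
          fill_rows ''u'' ''v'' ''kk'' (BAnd (IN ''C'' ''u'') (BNot (IN ''A'' ''u''))) (IN ''K'' ''v''))
         (fill_rows ''u'' ''v'' ''kk'' (IN ''C'' ''u'') (IN ''K'' ''v'')))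
       (fill_rows ''u'' ''v'' ''kk'' (IN ''C'' ''u'') (IN ''S'' ''v''))"

definition order_code :: fcom where
  "order_code = FFor ''u'' len (FIf (IN ''T'' ''u'')
     (FStore ''ord'' (V ''cnt'') (V ''u'') ;; FAssign ''cnt'' (Plus (V ''cnt'') (N 1)) ;; FStore ''pos'' (V ''u'') (V ''cnt'')) FSkip)"

definition pick_code :: fcom where
  "pick_code =
     fill ''u'' ''al'' (BNot (IN ''pos'' ''u'')) ;;
     comp_code ;;
     fill ''u'' ''K'' (BAnd (NZ (At ''kk'' (V ''z'') (V ''u''))) (IN ''S'' ''u'')) ;;
     find_code ;;
     FIf (NZ (V ''mode'')) sep_code (fill ''u'' ''T'' (SAME ''u'' ''z'')) ;;
     rows_code ;;
     order_code"

text \<open>The value n of \<open>z\<close> means that no vertex is left. Every round before that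
  removes at least one vertex, so n rounds suffice and the remaining ones are idle.\<close>

definition order_phase :: fcom where
  "order_phase = FFor ''it'' len
     (FAssign ''z'' len ;;
      FFor ''u'' len (FIf (BNot (IN ''pos'' ''u'')) (FAssign ''z'' (V ''u'')) FSkip) ;;
      FIf (Less (V ''z'') len) pick_code FSkip)"

lemma code_frames [simp]:
  "asg comp_code = {''u'', ''v'', ''r''}" "sto comp_code = {''C'', ''S''}" "wsto comp_code = {}"
  "asg sep_code = {''u'', ''v'', ''r''}" "sto sep_code = {''al'', ''A'', ''T''}" "wsto sep_code = {}"
  "asg find_code = {''u'', ''v'', ''mode'', ''x'', ''y''}" "sto find_code = {}" "wsto find_code = {}"
  "asg rows_code = {''u'', ''v''}" "sto rows_code = {''kk''}" "wsto rows_code = {}"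
  "asg order_code = {''u'', ''cnt''}" "sto order_code = {''ord'', ''pos''}" "wsto order_code = {}"
  by (auto simp: comp_code_def sep_code_def find_code_def rows_code_def order_code_def)

lemma pick_frames [simp]:
  "asg pick_code = {''u'', ''v'', ''r'', ''mode'', ''x'', ''y'', ''cnt''}"
  "sto pick_code = {''al'', ''C'', ''S'', ''K'', ''A'', ''T'', ''kk'', ''ord'', ''pos''}" "wsto pick_code = {}"
  by (auto simp: pick_code_def)

lemma order_phase_frames [simp]:
  "asg order_phase = {''u'', ''v'', ''r'', ''mode'', ''x'', ''y'', ''cnt'', ''it'', ''z''}"
  "sto order_phase = {''al'', ''C'', ''S'', ''K'', ''A'', ''T'', ''kk'', ''ord'', ''pos''}" "wsto order_phase = {}"
  by (auto simp: order_phase_def)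

section \<open>Correctness of the ordering phase\<close>

context ram
begin

lemma bval_IN: "agree X A s r \<Longrightarrow> a \<notin> A \<Longrightarrow> reg r x < n \<Longrightarrow> bval M r (IN a x) \<longleftrightarrow> reg r x \<in> aset s a"
  by (auto simp: IN_def aset_def agree_def)

lemma bval_ADJ: "inp s \<Longrightarrow> agree X A s r \<Longrightarrow> ''n'' \<notin> X \<Longrightarrow> ''adj'' \<notin> A \<Longrightarrow> reg r x < n \<Longrightarrow> reg r y < n \<Longrightarrow>
    bval M r (ADJ x y) \<longleftrightarrow> E (reg r x) (reg r y)"
  by (simp add: ADJ_def inp_def agree_def)

lemma bval_SAME: "bval M r (SAME x y) \<longleftrightarrow> reg r x = reg r y"
  by (auto simp: SAME_def)

lemma aset_sem [simp]: "a \<notin> sto c \<Longrightarrow> aset (sem M c s) a = aset s a"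
  by (simp add: aset_def)

lemma rows_sem [simp]: "a \<notin> sto c \<Longrightarrow> rows (sem M c s) a = rows s a"
  by (simp add: rows_def fun_eq_iff)

lemma inp_sem [simp]: "''n'' \<notin> asg c \<Longrightarrow> ''adj'' \<notin> sto c \<Longrightarrow> inp (sem M c s) = inp s"
  by (simp add: inp_def)

lemma inp_n: "inp s \<Longrightarrow> reg s ''n'' = n" by (simp add: inp_def)

lemma aset_sub: "aset s a \<subseteq> {..<n}" by (auto simp: aset_def)

lemma comp_code:
  assumes s: "inp s" and z: "reg s ''z'' \<in> aset s ''al''"
  defines "r \<equiv> sem M comp_code s" and "C \<equiv> reach (aset s ''al'') (reg s ''z'')"
  shows "aset r ''C'' = C" "aset r ''S'' = nbhd C"
proof -
  let ?z = "reg s ''z''"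
  define s1 where "s1 = sem M (fill ''u'' ''C'' (SAME ''u'' ''z'')) s"
  define s2 where "s2 = sem M (closure ''C'' ''al'') s1"
  define c3 where "c3 = fill_ex ''u'' ''v'' ''S'' (BAnd (IN ''C'' ''v'') (BAnd (ADJ ''v'' ''u'') (BNot (IN ''al'' ''u''))))"
  have r: "r = sem M c3 s2" by (simp add: r_def comp_code_def s1_def s2_def c3_def)
  have zn: "?z < n" using z aset_sub by auto
  have i1: "inp s1" "inp s2" using s by (simp_all add: s1_def s2_def)
  have al: "aset s1 ''al'' = aset s ''al''" "aset s2 ''al'' = aset s ''al''" by (simp_all add: s1_def s2_def)
  have "aset s1 ''C'' = {u. u < n \<and> u = ?z}" unfolding s1_def
    by (rule aset_fill) (use s in \<open>auto simp: inp_n bval_SAME agree_def\<close>)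
  then have "aset s1 ''C'' = {?z}" using zn by auto
  then have C2: "aset s2 ''C'' = C" unfolding s2_def C_def al(1)[symmetric]
    by (intro aset_closure i1 zn) auto
  then show C: "aset r ''C'' = C" unfolding r c3_def by simp
  have "aset r ''S'' = {u. u < n \<and> (\<exists>v<n. v \<in> C \<and> E v u \<and> u \<notin> aset s ''al'')}"
    unfolding r c3_def
  proof (rule aset_fill_ex)
    fix u v r assume *: "u < n" "v < n" "agree {''u'', ''v''} {''S''} s2 r" "reg r ''u'' = u" "reg r ''v'' = v"
    show "bval M r (BAnd (IN ''C'' ''v'') (BAnd (ADJ ''v'' ''u'') (BNot (IN ''al'' ''u'')))) =
        (v \<in> C \<and> E v u \<and> u \<notin> aset s ''al'')"
      using * by (simp add: bval_IN[OF *(3)] bval_ADJ[OF i1(2) *(3)] C2 al)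
  qed (use i1 in \<open>auto simp: inp_n\<close>)
  also have "\<dots> = nbhd C"
  proof -
    have CU: "C \<subseteq> aset s ''al''" unfolding C_def using reach_subset z by blast
    \<comment> \<open>\<open>C\<close> is closed under edges into the remaining vertices, so a
      neighbour is outside \<open>C\<close> exactly if it has been removed.\<close>
    have "u \<notin> C \<longleftrightarrow> u \<notin> aset s ''al''" if "v \<in> C" "E v u" for u v
      using that CU reach_step unfolding C_def by blast
    then show ?thesis using CU aset_sub EV2 unfolding nbhd_def by blast
  qed
  finally show "aset r ''S'' = nbhd C" .
qed

text \<open>The array \<open>pos\<close> holds the position in the elimination order plus one; \<open>0\<close> marks vertices that are
  not yet removed.\<close>

definition rep :: "nat list \<Rightarrow> state \<Rightarrow> bool" where
  "rep rs s \<longleftrightarrow> distinct rs \<and> set rs \<subseteq> {..<n} \<and> reg s ''cnt'' = length rs \<and>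
     (\<forall>i<length rs. arr s ''ord'' i = rs ! i \<and> arr s ''pos'' (rs ! i) = Suc i) \<and>
     (\<forall>u<n. u \<notin> set rs \<longrightarrow> arr s ''pos'' u = 0)"

lemma rep_length: "rep rs s \<Longrightarrow> length rs \<le> n"
  unfolding rep_def by (metis card_lessThan card_mono distinct_card finite_lessThan)

lemma rep_pos: "rep rs s \<Longrightarrow> aset s ''pos'' = set rs"
  unfolding rep_def aset_def by (force simp: in_set_conv_nth)

lemma rep_snoc:
  assumes rep: "rep rs s" and u: "u < n" "u \<notin> set rs"
    and r: "reg r ''cnt'' = Suc (length rs)" "arr r ''ord'' = (arr s ''ord'')(length rs := u)"
      "arr r ''pos'' = (arr s ''pos'')(u := Suc (length rs))"
  shows "rep (rs @ [u]) r"
  using assms unfolding rep_def by (auto simp: nth_append less_Suc_eq)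

lemma order_code:
  assumes s: "inp s" and rep: "rep rs s" and T: "aset s ''T'' \<inter> set rs = {}"
  shows "\<exists>ts. distinct ts \<and> set ts = aset s ''T'' \<and> rep (rs @ ts) (sem M order_code s)"
proof -
  let ?P = "\<lambda>i r. agree {''u'', ''cnt''} {''ord'', ''pos''} s r \<and>
     (\<exists>ts. distinct ts \<and> set ts = aset s ''T'' \<inter> {..<i} \<and> rep (rs @ ts) r)"
  let ?c = "FIf (IN ''T'' ''u'')
     (FStore ''ord'' (V ''cnt'') (V ''u'') ;; FAssign ''cnt'' (Plus (V ''cnt'') (N 1)) ;; FStore ''pos'' (V ''u'') (V ''cnt'')) FSkip"
  have rep_set_reg: "rep rs (set_reg ''u'' i r) = rep rs r" for rs i r by (simp add: rep_def)
  have "?P n (sem M order_code s)" unfolding order_code_def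
  proof (rule sem_For_inv[where P = ?P])
    show "bd (reg s ''n'') len = n" using s by (simp add: inp_n)
    show "?P 0 (set_reg ''u'' 0 s)" using rep by (auto intro!: exI[of _ "[]"] agree_set_reg agree_refl simp: rep_set_reg)
    fix i r assume i: "i < n" and P: "?P i r" and u: "reg r ''u'' = i"
    from P obtain ts where ts: "distinct ts" "set ts = aset s ''T'' \<inter> {..<i}" "rep (rs @ ts) r" by blast
    have ag: "agree {''u'', ''cnt''} {''ord'', ''pos''} s r" using P by blast
    have b: "bval M r (IN ''T'' ''u'') \<longleftrightarrow> i \<in> aset s ''T''" using bval_IN[OF ag, of "''T''" "''u''"] u i by simp
    show "?P (Suc i) (set_reg ''u'' (Suc i) (sem M ?c r))"
    proof (cases "i \<in> aset s ''T''")
      case False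
      have "aset s ''T'' \<inter> {..<Suc i} = aset s ''T'' \<inter> {..<i}" using False by (auto simp: less_Suc_eq)
      then show ?thesis using b False ts ag by (auto simp: rep_set_reg intro!: agree_set_reg)
    next
      case True
      have len: "length (rs @ ts) \<le> n" by (rule rep_length[OF ts(3)])
      have cnt: "reg r ''cnt'' = length (rs @ ts)" using ts(3) unfolding rep_def by blast
      \<comment> \<open>With at least one vertex, n * n + n is at least n + 1, the largest value the
        counter can take.\<close>
      have "1 \<le> n * n" using i by (simp add: Suc_le_eq)
      then have "length rs + length ts + 1 < M" using len nnM unfolding length_append by linarith
      then have m: "(length rs + length ts + 1) mod M = length rs + length ts + 1" "1 mod M = 1"
        using M1 by (auto intro!: mod_less)
      let ?q = "sem M ?c r"
      have q: "reg ?q ''cnt'' = Suc (length (rs @ ts))" "arr ?q ''ord'' = (arr r ''ord'')(length (rs @ ts) := i)"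
        "arr ?q ''pos'' = (arr r ''pos'')(i := Suc (length (rs @ ts)))" "reg ?q ''n'' = reg r ''n''"
        using b True cnt u m by (auto simp: aval.simps(4) simp del: One_nat_def)
      have iT: "i \<notin> set (rs @ ts)" using True T ts(2) by auto
      have rep': "rep (rs @ (ts @ [i])) ?q" using rep_snoc[OF ts(3) i iT q(1-3)] by simp
      have ag': "agree {''u'', ''cnt''} {''ord'', ''pos''} s ?q"
        by (rule agree_trans[OF ag]) (rule agree_sem, auto)
      have "set (ts @ [i]) = aset s ''T'' \<inter> {..<Suc i}" using ts(2) True by (simp add: lessThan_Suc)
      moreover have "distinct (ts @ [i])" using ts(1) iT by simp
      ultimately show ?thesis
        using rep' agree_set_reg[OF ag', of "''u''"] unfolding rep_set_reg by blast
    qed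
  qed
  then show ?thesis using aset_sub[of s "''T''"] by (auto simp: Int_absorb2)
qed

end

locale ram_hub = ram n E M + hubbounded "{..<n}" E k for n E M k
begin

lemma order_inv_cong: "order_inv K rs \<Longrightarrow> (\<And>c. c < n \<Longrightarrow> K c = K' c) \<Longrightarrow> order_inv K' rs"
  unfolding order_inv_def by auto

lemma sep_code:
  assumes s: "inp s" and x: "reg s ''x'' < n" and y: "reg s ''y'' < n" and C: "C = aset s ''C''"
  defines "r \<equiv> sem M sep_code s"
  shows "aset r ''A'' = side C (reg s ''x'') (reg s ''y'')" "aset r ''T'' = sep C (reg s ''x'') (reg s ''y'')"
proof -
  let ?x = "reg s ''x''" and ?y = "reg s ''y''"
  define s1 where "s1 = sem M (fill ''u'' ''al'' (BAnd (IN ''C'' ''u'') (BNot (ADJ ''x'' ''u'')))) s"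
  define s2 where "s2 = sem M (fill ''u'' ''A'' (SAME ''u'' ''y'')) s1"
  define s3 where "s3 = sem M (closure ''A'' ''al'') s2"
  define c4 where "c4 = fill_ex ''u'' ''v'' ''T'' (BAnd (BAnd (IN ''C'' ''u'') (ADJ ''x'' ''u'')) (BAnd (IN ''A'' ''v'') (ADJ ''v'' ''u'')))"
  have r: "r = sem M c4 s3" by (simp add: r_def sep_code_def s1_def s2_def s3_def c4_def)
  have i: "inp s1" "inp s2" "inp s3" using s by (simp_all add: s1_def s2_def s3_def)
  have C1: "aset s1 ''C'' = C" "aset s2 ''C'' = C" "aset s3 ''C'' = C" unfolding C by (simp_all add: s1_def s2_def s3_def)
  have xy: "reg s1 ''x'' = ?x" "reg s2 ''x'' = ?x" "reg s3 ''x'' = ?x" "reg s1 ''y'' = ?y" by (simp_all add: s1_def s2_def s3_def)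
  have "aset s1 ''al'' = {u. u < n \<and> (u \<in> C \<and> \<not> E ?x u)}" unfolding s1_def
  proof (rule aset_fill)
    fix u r assume *: "u < n" "agree {''u''} {''al''} s r" "reg r ''u'' = u"
    then have "reg r ''x'' = ?x" by (simp add: agree_def)
    then show "bval M r (BAnd (IN ''C'' ''u'') (BNot (ADJ ''x'' ''u''))) = (u \<in> C \<and> \<not> E ?x u)"
      using * x by (simp add: bval_IN[OF *(2)] bval_ADJ[OF s *(2)] C)
  qed (use s in \<open>auto simp: inp_n\<close>)
  then have al1: "aset s1 ''al'' = {c \<in> C. \<not> E ?x c}" using aset_sub C by auto
  then have al: "aset s2 ''al'' = {c \<in> C. \<not> E ?x c}" by (simp add: s2_def)
  have "aset s2 ''A'' = {u. u < n \<and> u = ?y}" unfolding s2_def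
    by (rule aset_fill) (use i xy in \<open>auto simp: inp_n bval_SAME agree_def\<close>)
  then have "aset s2 ''A'' = {?y}" using y by auto
  then have A: "aset s3 ''A'' = side C ?x ?y" unfolding s3_def side_def al[symmetric]
    by (intro aset_closure i y) auto
  then show "aset r ''A'' = side C ?x ?y" unfolding r c4_def by simp
  have "aset r ''T'' = {u. u < n \<and> (\<exists>v<n. u \<in> C \<and> E ?x u \<and> v \<in> side C ?x ?y \<and> E v u)}" unfolding r c4_def
  proof (rule aset_fill_ex)
    fix u v r assume *: "u < n" "v < n" "agree {''u'', ''v''} {''T''} s3 r" "reg r ''u'' = u" "reg r ''v'' = v"
    then have "reg r ''x'' = ?x" using xy by (simp add: agree_def)
    then show "bval M r (BAnd (BAnd (IN ''C'' ''u'') (ADJ ''x'' ''u'')) (BAnd (IN ''A'' ''v'') (ADJ ''v'' ''u'')))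
       = (u \<in> C \<and> E ?x u \<and> v \<in> side C ?x ?y \<and> E v u)"
      using * x by (simp add: bval_IN[OF *(3)] bval_ADJ[OF i(3) *(3)] C1 A)
  qed (use i in \<open>auto simp: inp_n\<close>)
  then show "aset r ''T'' = sep C ?x ?y"
    using aset_sub[of s "''C''"] A aset_sub[of s3 "''A''"] unfolding sep_def C by auto
qed

lemma find_code:
  assumes s: "inp s" and S: "S = aset s ''S''" and K: "K = aset s ''K''" "K \<subseteq> S"
  defines "r \<equiv> sem M find_code s"
  defines "m \<equiv> reg r ''mode''" and "x \<equiv> reg r ''x''" and "y \<equiv> reg r ''y''"
  shows "m = 1 \<and> x \<in> S - K \<and> y \<in> S - K \<and> x \<noteq> y \<and> \<not> E x y \<or>
    m = 2 \<and> x \<in> K \<and> y \<in> S - K \<and> \<not> E x y \<and> clique (S - K) \<or>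
    m = 0 \<and> clique (S - K) \<and> (\<forall>x\<in>K. \<forall>y\<in>S - K. E x y)"
proof -
  define b1 where "b1 = BAnd (BAnd (IN ''S'' ''u'') (BNot (IN ''K'' ''u'')))
         (BAnd (BAnd (IN ''S'' ''v'') (BNot (IN ''K'' ''v''))) (BAnd (Less (V ''u'') (V ''v'')) (BNot (ADJ ''u'' ''v''))))"
  define b2 where "b2 = BAnd (IN ''K'' ''u'') (BAnd (BAnd (IN ''S'' ''v'') (BNot (IN ''K'' ''v''))) (BNot (ADJ ''u'' ''v'')))"
  define Q1 where "Q1 u v \<longleftrightarrow> u \<in> S - K \<and> v \<in> S - K \<and> u < v \<and> \<not> E u v" for u v
  define Q2 where "Q2 u v \<longleftrightarrow> u \<in> K \<and> v \<in> S - K \<and> \<not> E u v" for u v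
  define s1 where "s1 = set_reg ''mode'' 0 s"
  define s2 where "s2 = sem M (find_pair ''u'' ''v'' ''mode'' ''x'' ''y'' 1 b1) s1"
  have r: "r = (if reg s2 ''mode'' \<noteq> 0 then s2 else sem M (find_pair ''u'' ''v'' ''mode'' ''x'' ''y'' 2 b2) s2)"
    by (simp add: r_def find_code_def s2_def s1_def b1_def b2_def)
  have i: "inp s1" "inp s2" using s by (simp_all add: s1_def s2_def inp_def)
  have as: "aset s1 = aset s" "aset s2 = aset s" by (auto simp: s1_def s2_def aset_def fun_eq_iff)
  have Sn: "S \<subseteq> {..<n}" unfolding S by (rule aset_sub)
  have B1: "bval M r b1 = Q1 u v" if *: "u < n" "v < n" "agree {''u'', ''v'', ''mode'', ''x'', ''y''} {} s1 r"
    "reg r ''u'' = u" "reg r ''v'' = v" for u v r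
    using that by (auto simp: b1_def Q1_def bval_IN[OF *(3)] bval_ADJ[OF i(1) *(3)] as S K)
  have B2: "bval M r b2 = Q2 u v" if *: "u < n" "v < n" "agree {''u'', ''v'', ''mode'', ''x'', ''y''} {} s2 r"
    "reg r ''u'' = u" "reg r ''v'' = v" for u v r
    using that by (auto simp: b2_def Q2_def bval_IN[OF *(3)] bval_ADJ[OF i(2) *(3)] as S K)
  have cl: "clique (S - K)" if "\<not> (\<exists>u<n. \<exists>v<n. Q1 u v)"
    unfolding clique_def
  proof (intro ballI impI)
    fix a b assume ab: "a \<in> S - K" "b \<in> S - K" "a \<noteq> b"
    then have "a < n" "b < n" using Sn by auto
    then show "E a b" using that ab symE unfolding Q1_def by (metis nat_neq_iff)
  qed
  have d: "distinct [''u'', ''v'', ''mode'', ''x'', ''y'', ''n'']" by simp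
  have f1: "reg s2 ''mode'' = 1 \<and> reg s2 ''x'' < n \<and> reg s2 ''y'' < n \<and> Q1 (reg s2 ''x'') (reg s2 ''y'')"
    if "\<exists>u<n. \<exists>v<n. Q1 u v"
    by (rule find_pair(1)[OF inp_n[OF i(1)] d M1 _ s2_def that]) (rule B1)
  have f2: "reg s2 ''mode'' = reg s1 ''mode'' \<and> reg s2 ''x'' = reg s1 ''x'' \<and> reg s2 ''y'' = reg s1 ''y''"
    if "\<not> (\<exists>u<n. \<exists>v<n. Q1 u v)"
    by (rule find_pair(2)[OF inp_n[OF i(1)] d M1 _ s2_def that]) (rule B1)
  show ?thesis
  proof (cases "\<exists>u<n. \<exists>v<n. Q1 u v")
    case True
    then have "reg s2 ''mode'' = 1 \<and> Q1 (reg s2 ''x'') (reg s2 ''y'')"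
      using f1(1) M1 by simp
    then show ?thesis unfolding m_def x_def y_def r Q1_def by auto
  next
    case False
    then have m0: "reg s2 ''mode'' = 0" using f2 by (simp add: s1_def)
    then have r2: "r = sem M (find_pair ''u'' ''v'' ''mode'' ''x'' ''y'' 2 b2) s2" using r by simp
    show ?thesis
    proof (cases "\<exists>u<n. \<exists>v<n. Q2 u v")
      case True
      have "reg r ''mode'' = 2 \<and> reg r ''x'' < n \<and> reg r ''y'' < n \<and> Q2 (reg r ''x'') (reg r ''y'')"
        by (rule find_pair(1)[OF inp_n[OF i(2)] d M2 _ r2 True]) (rule B2)
      then have "m = 2 \<and> Q2 x y" by (simp add: m_def x_def y_def)
      then show ?thesis using cl[OF False] unfolding Q2_def by auto
    next
      case F2: False
      have "reg r ''mode'' = reg s2 ''mode'' \<and> reg r ''x'' = reg s2 ''x'' \<and> reg r ''y'' = reg s2 ''y''"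
        by (rule find_pair(2)[OF inp_n[OF i(2)] d M2 _ r2 F2]) (rule B2)
      then have "m = 0" using m0 by (simp add: m_def)
      moreover have "\<forall>x\<in>K. \<forall>y\<in>S - K. E x y" using F2 Sn K(2) unfolding Q2_def by blast
      ultimately show ?thesis using cl[OF False] by blast
    qed
  qed
qed

end

context ram
begin

lemma rows_code:
  assumes s: "inp s" and KS: "aset s ''K'' \<subseteq> aset s ''S''" and c: "c < n"
  shows "rows (sem M rows_code s) ''kk'' c =
    (if c \<in> aset s ''C'' then
       if reg s ''mode'' = 0 then aset s ''S''
       else if reg s ''mode'' > 1 \<and> c \<in> aset s ''A'' then aset s ''S'' - aset s ''K'' else aset s ''K''
     else rows s ''kk'' c)"
proof -
  let ?f = "\<lambda>bx b. fill_rows ''u'' ''v'' ''kk'' bx b"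
  let ?C = "aset s ''C''" and ?S = "aset s ''S''" and ?K = "aset s ''K''" and ?A = "aset s ''A''"
  have sub: "{v. v < n \<and> v \<in> aset s a} = aset s a" "{v. v < n \<and> v \<in> aset s a \<and> P v} = {v \<in> aset s a. P v}" for a P
    using aset_sub by auto
  have R1: "rows (sem M (?f (IN ''C'' ''u'') (IN a ''v'')) s) ''kk'' c = (if c \<in> ?C then aset s a else rows s ''kk'' c)"
    if a: "a \<noteq> ''kk''" for a
  proof -
    have "rows (sem M (?f (IN ''C'' ''u'') (IN a ''v'')) s) ''kk'' c = (if c \<in> ?C then {v. v < n \<and> v \<in> aset s a} else rows s ''kk'' c)"
  proof (rule rows_fill_rows)
    fix u r assume *: "u < n" "agree {''u'', ''v''} {''kk''} s r" "reg r ''u'' = u"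
    then show "bval M r (IN ''C'' ''u'') = (u \<in> ?C)" by (simp add: bval_IN[OF *(2)] )
  next
    fix u v r assume *: "u < n" "v < n" "agree {''u'', ''v''} {''kk''} s r" "reg r ''u'' = u" "reg r ''v'' = v"
    then show "bval M r (IN a ''v'') = (v \<in> aset s a)" using a by (simp add: bval_IN[OF *(3)] )
  qed (use s c in \<open>auto simp: inp_n\<close>)
    then show ?thesis unfolding sub(1) .
  qed
  define s1 where "s1 = sem M (?f (BAnd (IN ''C'' ''u'') (IN ''A'' ''u'')) (BAnd (IN ''S'' ''v'') (BNot (IN ''K'' ''v'')))) s"
  have i1: "inp s1" using s by (simp add: s1_def)
  have as: "aset s1 a = aset s a" if "a \<noteq> ''kk''" for a using that by (simp add: s1_def)
  have "rows s1 ''kk'' c = (if c \<in> ?C \<and> c \<in> ?A then {v. v < n \<and> v \<in> ?S \<and> v \<notin> ?K} else rows s ''kk'' c)"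
    unfolding s1_def
  proof (rule rows_fill_rows)
    fix u r assume *: "u < n" "agree {''u'', ''v''} {''kk''} s r" "reg r ''u'' = u"
    then show "bval M r (BAnd (IN ''C'' ''u'') (IN ''A'' ''u'')) = (u \<in> ?C \<and> u \<in> ?A)" by (simp add: bval_IN[OF *(2)] )
  next
    fix u v r assume *: "u < n" "v < n" "agree {''u'', ''v''} {''kk''} s r" "reg r ''u'' = u" "reg r ''v'' = v"
    then show "bval M r (BAnd (IN ''S'' ''v'') (BNot (IN ''K'' ''v''))) = (v \<in> ?S \<and> v \<notin> ?K)" by (simp add: bval_IN[OF *(3)] )
  qed (use s c in \<open>auto simp: inp_n\<close>)
  then have r1: "rows s1 ''kk'' c = (if c \<in> ?C \<and> c \<in> ?A then ?S - ?K else rows s ''kk'' c)"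
    unfolding sub(2) by auto
  have "rows (sem M (?f (BAnd (IN ''C'' ''u'') (BNot (IN ''A'' ''u''))) (IN ''K'' ''v'')) s1) ''kk'' c
     = (if c \<in> ?C \<and> c \<notin> ?A then {v. v < n \<and> v \<in> ?K} else rows s1 ''kk'' c)"
  proof (rule rows_fill_rows)
    fix u r assume *: "u < n" "agree {''u'', ''v''} {''kk''} s1 r" "reg r ''u'' = u"
    then show "bval M r (BAnd (IN ''C'' ''u'') (BNot (IN ''A'' ''u''))) = (u \<in> ?C \<and> u \<notin> ?A)" by (simp add: bval_IN[OF *(2)] as)
  next
    fix u v r assume *: "u < n" "v < n" "agree {''u'', ''v''} {''kk''} s1 r" "reg r ''u'' = u" "reg r ''v'' = v"
    then show "bval M r (IN ''K'' ''v'') = (v \<in> ?K)" by (simp add: bval_IN[OF *(3)] as)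
  qed (use i1 c in \<open>auto simp: inp_n\<close>)
  then have r2: "rows (sem M (?f (BAnd (IN ''C'' ''u'') (BNot (IN ''A'' ''u''))) (IN ''K'' ''v'')) s1) ''kk'' c
     = (if c \<in> ?C then if c \<in> ?A then ?S - ?K else ?K else rows s ''kk'' c)"
    unfolding sub(1) r1 by auto
  show ?thesis
    unfolding rows_code_def using R1[of "''S''"] R1[of "''K''"] r2 M1 by (auto simp: s1_def)
qed

end

context ram_hub
begin

text \<open>The outcomes of the search correspond to \<open>order_inv_hub\<close>,
  \<open>order_inv_cliques\<close> and \<open>order_inv_single\<close>. That \<open>ts\<close> is
  nonempty is the progress on which the number of rounds in \<open>order_phase\<close>
  relies.\<close>

lemma pick_code:
  assumes s: "inp s" and rep: "rep rs s" and inv: "order_inv (rows s ''kk'') rs"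
    and z: "reg s ''z'' < n" "reg s ''z'' \<notin> set rs"
  defines "r \<equiv> sem M pick_code s"
  shows "inp r \<and> (\<exists>ts. ts \<noteq> [] \<and> rep (rs @ ts) r \<and> order_inv (rows r ''kk'') (rs @ ts))"
proof -
  let ?z = "reg s ''z''"
  define U where "U = {..<n} - set rs"
  define C where "C = reach U ?z"
  define K where "K = rows s ''kk'' ?z \<inter> nbhd C"
  have zU: "?z \<in> U" using z by (simp add: U_def)
  have C': "conn C" "C \<subseteq> {..<n}" "C \<subseteq> U" using reach_conn reach_subset[of U ?z] zU by (auto simp: C_def U_def)
  define s1 where "s1 = sem M (fill ''u'' ''al'' (BNot (IN ''pos'' ''u''))) s"
  define s2 where "s2 = sem M comp_code s1"
  define s3 where "s3 = sem M (fill ''u'' ''K'' (BAnd (NZ (At ''kk'' (V ''z'') (V ''u''))) (IN ''S'' ''u''))) s2"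
  define s4 where "s4 = sem M find_code s3"
  define s5 where "s5 = (if reg s4 ''mode'' \<noteq> 0 then sem M sep_code s4 else sem M (fill ''u'' ''T'' (SAME ''u'' ''z'')) s4)"
  define s6 where "s6 = sem M rows_code s5"
  have r: "r = sem M order_code s6"
    by (simp add: r_def pick_code_def s1_def s2_def s3_def s4_def s5_def s6_def)
  have i: "inp s1" "inp s2" "inp s3" "inp s4" "inp s5" "inp s6"
    using s by (simp_all add: s1_def s2_def s3_def s4_def s5_def s6_def)
  have "aset s1 ''al'' = {u. u < n \<and> u \<notin> set rs}" unfolding s1_def
  proof (rule aset_fill)
    fix u r assume *: "u < n" "agree {''u''} {''al''} s r" "reg r ''u'' = u"
    then show "bval M r (BNot (IN ''pos'' ''u'')) = (u \<notin> set rs)" by (simp add: bval_IN[OF *(2)] rep_pos[OF rep])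
  qed (use s in \<open>auto simp: inp_n\<close>)
  then have al: "aset s1 ''al'' = U" by (auto simp: U_def)
  have z1: "reg s1 ''z'' = ?z" by (simp add: s1_def)
  have CS2: "aset s2 ''C'' = C" "aset s2 ''S'' = nbhd C"
    using comp_code[OF i(1)] z1 al zU unfolding s2_def C_def by auto
  have "aset s3 ''K'' = {u. u < n \<and> u \<in> rows s ''kk'' ?z \<and> u \<in> nbhd C}" unfolding s3_def
  proof (rule aset_fill)
    fix u r assume *: "u < n" "agree {''u''} {''K''} s2 r" "reg r ''u'' = u"
    have "reg r ''n'' = n" "reg r ''z'' = ?z" "arr r ''kk'' = arr s ''kk''"
      using *(2) i(2) by (auto simp: agree_def inp_n s1_def s2_def)
    then have "bval M r (NZ (At ''kk'' (V ''z'') (V ''u''))) = (u \<in> rows s ''kk'' ?z)"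
      using * z by (simp add: rows_def)
    then show "bval M r (BAnd (NZ (At ''kk'' (V ''z'') (V ''u''))) (IN ''S'' ''u'')) = (u \<in> rows s ''kk'' ?z \<and> u \<in> nbhd C)"
      using * bval_IN[OF *(2), of "''S''" "''u''"] CS2 by simp
  qed (use i in \<open>auto simp: inp_n\<close>)
  then have K3: "aset s3 ''K'' = K" by (auto simp: K_def rows_def)
  have S3: "aset s3 ''S'' = nbhd C" "aset s3 ''C'' = C" using CS2 by (simp_all add: s3_def)
  have KS: "K \<subseteq> nbhd C" by (simp add: K_def)
  define m x y where "m = reg s4 ''mode''" and "x = reg s4 ''x''" and "y = reg s4 ''y''"
  have cases: "m = 1 \<and> x \<in> nbhd C - K \<and> y \<in> nbhd C - K \<and> x \<noteq> y \<and> \<not> E x y \<or>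
    m = 2 \<and> x \<in> K \<and> y \<in> nbhd C - K \<and> \<not> E x y \<and> clique (nbhd C - K) \<or>
    m = 0 \<and> clique (nbhd C - K) \<and> (\<forall>x\<in>K. \<forall>y\<in>nbhd C - K. E x y)"
    unfolding m_def x_def y_def s4_def by (rule find_code[OF i(3) S3(1)[symmetric] K3[symmetric] KS])
  have S4: "aset s4 ''S'' = nbhd C" "aset s4 ''C'' = C" "aset s4 ''K'' = K" using S3 K3 by (simp_all add: s4_def)
  have S5: "aset s5 ''S'' = nbhd C" "aset s5 ''C'' = C" "aset s5 ''K'' = K" "reg s5 ''mode'' = m" using S4 by (auto simp: s5_def m_def)
  have nC: "nbhd C \<subseteq> {..<n}" unfolding nbhd_def using EV2 by blast
  have AT: "aset s5 ''A'' = side C x y" "aset s5 ''T'' = sep C x y" if "m \<noteq> 0"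
  proof -
    have xy: "x < n" "y < n" using cases that nC KS by auto
    have "s5 = sem M sep_code s4" using that by (simp add: s5_def m_def)
    then show "aset s5 ''A'' = side C x y" "aset s5 ''T'' = sep C x y"
      using sep_code[OF i(4) _ _ S4(2)[symmetric]] xy unfolding x_def y_def by auto
  qed
  have T0: "aset s5 ''T'' = {?z}" if "m = 0"
  proof -
    have "s5 = sem M (fill ''u'' ''T'' (SAME ''u'' ''z'')) s4" using that by (simp add: s5_def m_def)
    moreover have "reg s4 ''z'' = ?z" by (simp add: s4_def s3_def s2_def s1_def)
    ultimately have "aset s5 ''T'' = {u. u < n \<and> u = ?z}"
      using aset_fill[of s4 "''u''" "''T''" "SAME ''u'' ''z''" "\<lambda>u. u = ?z"] i(4)
      by (auto simp: inp_n bval_SAME agree_def)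
    then show ?thesis using z by auto
  qed
  have rows5: "rows s5 ''kk'' = rows s ''kk''"
    by (auto simp: s5_def s4_def s3_def s2_def s1_def)
  have rows6: "rows s6 ''kk'' c = (if c \<in> C then if m = 0 then nbhd C else if m > 1 \<and> c \<in> aset s5 ''A'' then nbhd C - K else K
     else rows s ''kk'' c)" if "c < n" for c
    using rows_code[OF i(5) _ that] S5 KS unfolding s6_def rows5 by auto
  have TC: "aset s5 ''T'' \<subseteq> C" "aset s5 ''T'' \<noteq> {}"
  proof -
    have "sep C x y \<noteq> {}" if "m \<noteq> 0"
      using cases that KS by (intro sep_nonempty C') auto
    then show "aset s5 ''T'' \<subseteq> C" "aset s5 ''T'' \<noteq> {}"
      using AT T0 reach_refl[of ?z U] unfolding C_def sep_def by (cases "m = 0"; auto)+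
  qed
  have T6: "aset s6 ''T'' = aset s5 ''T''" by (simp add: s6_def)
  have rep5: "rep rs s6" using rep unfolding rep_def by (simp add: s6_def s5_def s4_def s3_def s2_def s1_def)
  have "aset s6 ''T'' \<inter> set rs = {}" using TC(1) C'(3) unfolding T6 U_def by blast
  then obtain ts where ts: "distinct ts" "set ts = aset s5 ''T''" "rep (rs @ ts) r"
    using order_code[OF i(6) rep5] T6 unfolding r by auto
  have CU: "C = reach ({..<n} - set rs) ?z" by (simp add: C_def U_def)
  have zz: "?z \<in> {..<n} - set rs" using z by simp
  have Kz: "rows s ''kk'' ?z \<inter> nbhd C = K" "nbhd C - rows s ''kk'' ?z = nbhd C - K" "nbhd C - K \<inter> nbhd C = nbhd C - K"
    by (auto simp: K_def)
  have rows_r: "rows r ''kk'' = rows s6 ''kk''" unfolding r by simp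
  have "order_inv (rows r ''kk'') (rs @ ts)"
    using cases
  proof (elim disjE conjE)
    assume m: "m = 1" and xy: "x \<in> nbhd C - K" "y \<in> nbhd C - K" "x \<noteq> y" "\<not> E x y"
    have xy': "x \<in> nbhd C - rows s ''kk'' ?z" "y \<in> nbhd C - rows s ''kk'' ?z" using xy(1,2) Kz by auto
    have "set ts = sep C x y" using ts(2) AT m by simp
    from order_inv_hub[OF inv zz CU xy' xy(3,4) ts(1) this]
    show ?thesis by (rule order_inv_cong) (simp add: rows_r rows6 m Kz)
  next
    assume m: "m = 2" and xy: "x \<in> K" "y \<in> nbhd C - K" "\<not> E x y" and F: "clique (nbhd C - K)"
    have xy': "x \<in> nbhd C \<inter> rows s ''kk'' ?z" "y \<in> nbhd C - rows s ''kk'' ?z" using xy(1,2) by (auto simp: K_def)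
    have "set ts = sep C x y" using ts(2) AT m by simp
    from order_inv_cliques[OF inv zz CU xy' xy(3) F[folded Kz(2)] ts(1) this]
    show ?thesis by (rule order_inv_cong) (simp add: rows_r rows6 m Kz AT)
  next
    assume m: "m = 0" and F: "clique (nbhd C - K)" and KF: "\<forall>x\<in>K. \<forall>y\<in>nbhd C - K. E x y"
    have "good C (rows s ''kk'' ?z)" using inv zz CU unfolding order_inv_def by auto
    then have "clique K" unfolding good_def Kz by blast
    \<comment> \<open>Both parts are cliques, and the failed second search says that they are
      completely joined.\<close>
    then have cl: "clique (nbhd C)" using F KF symE unfolding clique_def by (metis DiffI)
    have "ts = [?z]" using ts(1,2) T0[OF m] by (metis distinct_card list.size(3,4) length_Suc_conv
      card.empty card.insert finite.emptyI empty_iff length_0_conv list.set(1) list.set(2) singleton_insert_inj_eq insert_not_empty One_nat_def set_empty2)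
    then show ?thesis using order_inv_cong[OF order_inv_single[OF inv zz CU cl]] by (simp add: rows_r rows6 m)
  qed
  moreover have "ts \<noteq> []" using ts(2) TC(2) by auto
  moreover have "inp r" unfolding r using i by simp
  ultimately show ?thesis using ts(3) by blast
qed

lemma order_phase:
  assumes s: "inp s" and s0: "reg s ''cnt'' = 0" "arr s ''pos'' = (\<lambda>_. 0)" "arr s ''kk'' = (\<lambda>_. 0)"
  shows "\<exists>rs. set rs = {..<n} \<and> rep rs (sem M order_phase s) \<and> elim_ok (2 * k + 1) rs"
proof -
  \<comment> \<open>After round \<open>n\<close>, the first alternative already forces a list
    without repetitions to contain all vertices.\<close>
  let ?P = "\<lambda>i r. inp r \<and> (\<exists>rs. rep rs r \<and> order_inv (rows r ''kk'') rs \<and> (i \<le> length rs \<or> set rs = {..<n}))"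
  let ?f = "FFor ''u'' len (FIf (BNot (IN ''pos'' ''u'')) (FAssign ''z'' (V ''u'')) FSkip)"
  have P_set_reg: "?P i (set_reg ''it'' j r) = ?P i r" for i j r
    by (simp add: rep_def inp_def rows_def[abs_def])
  have "?P n (sem M order_phase s)" unfolding order_phase_def
  proof (rule sem_For_inv[where P = ?P])
    show "bd (reg s ''n'') len = n" using s by (simp add: inp_n)
    have "rows s ''kk'' = (\<lambda>_. {})" by (simp add: rows_def s0 fun_eq_iff)
    then have "?P 0 s" using s s0 order_inv_Nil by (auto simp: rep_def intro!: exI[of _ "[]"])
    then show "?P 0 (set_reg ''it'' 0 s)" unfolding P_set_reg .
    fix i r assume i: "i < n" and P: "?P i r"
    from P obtain rs where rs: "inp r" "rep rs r" "order_inv (rows r ''kk'') rs" "i \<le> length rs \<or> set rs = {..<n}" by blast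
    define r1 where "r1 = sem M (FAssign ''z'' len) r"
    define r2 where "r2 = sem M ?f r1"
    have i1: "inp r1" "inp r2" using rs(1) by (simp_all add: r1_def r2_def del: sem.simps)
    have rep2: "rep rs r2" "rows r2 ''kk'' = rows r ''kk''"
      using rs(2) by (simp_all add: rep_def r1_def r2_def del: sem.simps)
    have "(\<forall>u<n. u \<in> set rs) \<and> reg r2 ''z'' = n \<or> reg r2 ''z'' < n \<and> reg r2 ''z'' \<notin> set rs"
      unfolding r2_def
    proof (rule conjunct2[OF sem_For_inv[where P = "\<lambda>j q. agree {''u'', ''z''} {} r1 q \<and>
        ((\<forall>u<j. u \<in> set rs) \<and> reg q ''z'' = n \<or> reg q ''z'' < n \<and> reg q ''z'' \<notin> set rs)"]])
      show "bd (reg r1 ''n'') len = n" using i1 by (simp add: inp_n)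
      show "agree {''u'', ''z''} {} r1 (set_reg ''u'' 0 r1) \<and> ((\<forall>u<0. u \<in> set rs) \<and> reg (set_reg ''u'' 0 r1) ''z'' = n \<or>
           reg (set_reg ''u'' 0 r1) ''z'' < n \<and> reg (set_reg ''u'' 0 r1) ''z'' \<notin> set rs)"
        using rs(1) by (auto simp: r1_def inp_n intro!: agree_set_reg agree_refl)
      fix j q assume j: "j < n" and u: "reg q ''u'' = j" and Q: "agree {''u'', ''z''} {} r1 q \<and>
        ((\<forall>u<j. u \<in> set rs) \<and> reg q ''z'' = n \<or> reg q ''z'' < n \<and> reg q ''z'' \<notin> set rs)"
      have "rep rs r1" using rs(2) by (simp add: rep_def r1_def)
      then have "bval M q (IN ''pos'' ''u'') \<longleftrightarrow> j \<in> set rs"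
        using bval_IN[of "{''u'', ''z''}" "{}" r1 q "''pos''" "''u''"] Q u j rep_pos by auto
      then show "agree {''u'', ''z''} {} r1 (set_reg ''u'' (Suc j) (sem M (FIf (BNot (IN ''pos'' ''u'')) (FAssign ''z'' (V ''u'')) FSkip) q)) \<and>
        ((\<forall>u<Suc j. u \<in> set rs) \<and> reg (set_reg ''u'' (Suc j) (sem M (FIf (BNot (IN ''pos'' ''u'')) (FAssign ''z'' (V ''u'')) FSkip) q)) ''z'' = n \<or>
        reg (set_reg ''u'' (Suc j) (sem M (FIf (BNot (IN ''pos'' ''u'')) (FAssign ''z'' (V ''u'')) FSkip) q)) ''z'' < n \<and>
        reg (set_reg ''u'' (Suc j) (sem M (FIf (BNot (IN ''pos'' ''u'')) (FAssign ''z'' (V ''u'')) FSkip) q)) ''z'' \<notin> set rs)"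
        using Q j u by (auto intro!: agree_set_reg simp: less_Suc_eq)
    qed
    then have "?P (Suc i) (sem M (FIf (Less (V ''z'') len) pick_code FSkip) r2)"
    proof (elim disjE conjE)
      assume a: "\<forall>u<n. u \<in> set rs" "reg r2 ''z'' = n"
      then have "set rs = {..<n}" using rs(2) unfolding rep_def by auto
      then show ?thesis using a i1 rep2 rs(3) by (auto simp: inp_n)
    next
      assume z: "reg r2 ''z'' < n" "reg r2 ''z'' \<notin> set rs"
      then have "set rs \<noteq> {..<n}" by auto
      then have "i \<le> length rs" using rs(4) by blast
      moreover have "sem M (FIf (Less (V ''z'') len) pick_code FSkip) r2 = sem M pick_code r2"
        using z i1 by (simp add: inp_n)
      moreover obtain ts where "inp (sem M pick_code r2)" "ts \<noteq> []" "rep (rs @ ts) (sem M pick_code r2)"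
         "order_inv (rows (sem M pick_code r2) ''kk'') (rs @ ts)"
        using pick_code[OF i1(2) rep2(1) rs(3)[folded rep2(2)] z] by blast
      moreover have "Suc i \<le> length (rs @ ts)" using calculation(1,4) by (cases ts) auto
      ultimately show ?thesis by auto
    qed
    then show "?P (Suc i) (set_reg ''it'' (Suc i) (sem M (FAssign ''z'' len ;; ?f ;; FIf (Less (V ''z'') len) pick_code FSkip) r))"
      unfolding P_set_reg sem.simps(5) r2_def r1_def .
  qed
  then obtain rs where rs: "rep rs (sem M order_phase s)" "order_inv (rows (sem M order_phase s) ''kk'') rs"
     "n \<le> length rs \<or> set rs = {..<n}" by blast
  have "set rs = {..<n}"
  proof (cases "set rs = {..<n}")
    case False
    then have "n \<le> card (set rs)" using rs(1,3) unfolding rep_def by (metis distinct_card)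
    then show ?thesis using rs(1) unfolding rep_def
      by (metis card_lessThan card_seteq finite_lessThan)
  qed
  then show ?thesis using rs unfolding order_inv_def by blast
qed

end

section \<open>Coding independent sets by numbers\<close>

fun val :: "nat \<Rightarrow> nat \<Rightarrow> (nat \<Rightarrow> nat) \<Rightarrow> nat" where
  "val B 0 e = 0"
| "val B (Suc i) e = val B i e + e i * B ^ i"

text \<open>The place value of the last digit \<open>0\<close> among the first \<open>i\<close> digits, or \<open>0\<close> if there is none.\<close>

fun blank :: "nat \<Rightarrow> nat \<Rightarrow> (nat \<Rightarrow> nat) \<Rightarrow> nat" where
  "blank B 0 e = 0"
| "blank B (Suc i) e = (if e i = 0 then B ^ i else blank B i e)"

lemma val_less: "(\<And>j. j < i \<Longrightarrow> e j < B) \<Longrightarrow> 0 < B \<Longrightarrow> val B i e < B ^ i"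
proof (induction i)
  case (Suc i)
  have "val B i e < B ^ i" using Suc by simp
  moreover have "e i * B ^ i \<le> (B - 1) * B ^ i" using Suc.prems(1)[of i] by (intro mult_le_mono1) auto
  moreover have "B ^ i + (B - 1) * B ^ i = B ^ Suc i" using Suc.prems(2) by (cases B) auto
  ultimately show ?case unfolding val.simps by linarith
qed simp

lemma val_cong: "(\<And>j. j < i \<Longrightarrow> e j = e' j) \<Longrightarrow> val B i e = val B i e'"
  by (induction i) auto

lemma val_upd: "j < i \<Longrightarrow> e j = 0 \<Longrightarrow> val B i (e(j := d)) = val B i e + d * B ^ j"
proof (induction i)
  case (Suc i)
  show ?case
  proof (cases "j = i")
    case True
    have "val B i (e(i := d)) = val B i e" by (rule val_cong) auto
    then show ?thesis using True Suc.prems by (simp add: fun_upd_def)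
  qed (use Suc in auto)
qed simp

lemma val_digit:
  assumes "\<And>j. j < i \<Longrightarrow> e j < B" "0 < B" "j < i"
  shows "val B i e div B ^ j mod B = e j"
  using assms
proof (induction i)
  case (Suc i)
  have less: "val B i e < B ^ i" using Suc.prems by (intro val_less) auto
  show ?case
  proof (cases "j = i")
    case True
    then show ?thesis using less Suc.prems by simp
  next
    case False
    then have j: "j < i" using Suc.prems by simp
    then obtain d where d: "i = j + Suc d" using less_iff_Suc_add[of j i] by auto
    have "e i * B ^ i = B ^ j * (B * (e i * B ^ d))" by (simp add: d power_add)
    then have "val B (Suc i) e = val B i e + B ^ j * (B * (e i * B ^ d))" by simp
    then have "val B (Suc i) e div B ^ j = B * (e i * B ^ d) + val B i e div B ^ j"
      using Suc.prems(2) by (simp only: add.commute[of "val B i e"]) (rule div_mult_self4, simp)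
    then show ?thesis using Suc j by simp
  qed
qed simp

lemma blank_pos: "0 < B \<Longrightarrow> 0 < blank B i e \<longleftrightarrow> (\<exists>j<i. e j = 0)"
  by (induction i) (auto simp: less_Suc_eq)

lemma blank_ex: "0 < blank B i e \<Longrightarrow> \<exists>j<i. e j = 0 \<and> blank B i e = B ^ j"
  by (induction i) (auto simp: less_Suc_eq split: if_splits)

locale tuples = elimination "{..<n}" E w rs for n :: nat and E and w and rs +
  fixes L :: nat
  assumes bag_card: "\<And>i I. i < n \<Longrightarrow> I \<subseteq> insert (rs ! i) (NB i) \<Longrightarrow> indep I \<Longrightarrow> card I \<le> L"
begin

abbreviation "B \<equiv> n + 1"
abbreviation "P \<equiv> B ^ L"
abbreviation "code e \<equiv> val B L e"

lemma nn: "nn = n" using dist set_rs by (metis card_lessThan distinct_card)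

text \<open>Since nonzero digits differ, a tuple without blanks codes a set of exactly
  \<open>L\<close> vertices; a smaller set thus always leaves a blank for one more vertex.\<close>

definition tup :: "(nat \<Rightarrow> nat) \<Rightarrow> bool" where
  "tup e \<longleftrightarrow> (\<forall>j<L. e j \<le> n) \<and> (\<forall>j<L. \<forall>j'<L. e j = e j' \<longrightarrow> e j \<noteq> 0 \<longrightarrow> j = j')"

text \<open>The digit \<open>0\<close> of a code is a blank, the digit \<open>u + 1\<close> stands for the vertex \<open>u\<close>. Blanks may occur at
  any position.\<close>

definition Jset :: "(nat \<Rightarrow> nat) \<Rightarrow> nat set" where
  "Jset e = {u. \<exists>j<L. e j = Suc u}"

text \<open>Dropped vertices become blanks in place. The other digits do not move, so the masked
  code can be computed digit by digit; the price is that a table has to be right for every tuple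
  coding the same set.\<close>

definition mask :: "nat set \<Rightarrow> (nat \<Rightarrow> nat) \<Rightarrow> nat \<Rightarrow> nat" where
  "mask S e j = (if e j \<noteq> 0 \<and> e j - 1 \<in> S then e j else 0)"

lemma code_less: "(\<And>j. j < L \<Longrightarrow> e j \<le> n) \<Longrightarrow> code e < P"
  by (rule val_less) (auto simp: less_Suc_eq_le)

lemma tup_mask: "tup e \<Longrightarrow> tup (mask S e)"
  unfolding tup_def mask_def by auto

lemma Jset_mask: "Jset (mask S e) = Jset e \<inter> S"
  unfolding Jset_def mask_def by (auto split: if_splits)

lemma tup_upd: "tup e \<Longrightarrow> j < L \<Longrightarrow> u < n \<Longrightarrow> u \<notin> Jset e \<Longrightarrow> tup (e(j := Suc u))"
  unfolding tup_def Jset_def by auto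

lemma Jset_upd: "j < L \<Longrightarrow> e j = 0 \<Longrightarrow> Jset (e(j := Suc u)) = insert u (Jset e)"
  unfolding Jset_def by (auto split: if_splits) (metis nat.distinct(1))

lemma Jset_full:
  assumes "tup e" "\<And>j. j < L \<Longrightarrow> e j \<noteq> 0"
  shows "card (Jset e) = L"
proof -
  have "Jset e = (\<lambda>j. e j - 1) ` {..<L}"
  proof (intro equalityI subsetI)
    fix u assume "u \<in> Jset e"
    then obtain j where "j < L" "e j = Suc u" unfolding Jset_def by blast
    then show "u \<in> (\<lambda>j. e j - 1) ` {..<L}" by (intro image_eqI[of _ _ j]) auto
  next
    fix u assume "u \<in> (\<lambda>j. e j - 1) ` {..<L}"
    then obtain j where j: "j < L" "u = e j - 1" by auto
    then have "e j = Suc u" using assms(2)[of j] by simp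
    then show "u \<in> Jset e" using j unfolding Jset_def by blast
  qed
  moreover have "inj_on (\<lambda>j. e j - 1) {..<L}"
  proof (rule inj_onI)
    fix x y assume *: "x \<in> {..<L}" "y \<in> {..<L}" "e x - 1 = e y - 1"
    then have "e x = e y" using assms(2)[of x] assms(2)[of y] by simp
    then show "x = y" using assms * unfolding tup_def by auto
  qed
  ultimately show ?thesis by (simp add: card_image)
qed

text \<open>\<open>a\<close> leaves \<open>z\<close> out and \<open>b\<close> takes it, its digit
  \<open>z + 1\<close> being written into a blank of place value \<open>blank B L f\<close>. Both
  are read from the row of \<open>z\<close>; the result is what \<open>z\<close> adds to the row of
  its parent.\<close>

definition cell :: "(nat \<Rightarrow> rat) \<Rightarrow> nat \<Rightarrow> nat set \<Rightarrow> (nat \<Rightarrow> nat) \<Rightarrow> rat" where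
  "cell A z S e = (let f = mask S e; a = A (z * P + code f); b = w z + A (z * P + (code f + (z + 1) * blank B L f))
     in if (\<forall>j<L. f j \<noteq> 0 \<longrightarrow> \<not> E z (f j - 1)) \<and> 0 < blank B L f \<and> a < b then b else a)"

text \<open>The row of the vertex \<open>v\<close> starts at index \<open>v * P\<close>; the roots of the elimination forest push to a
  dummy row \<open>n\<close>. Codes of sets that are not independent or not contained in the bag carry junk.\<close>

definition acc_ok :: "nat \<Rightarrow> (nat \<Rightarrow> rat) \<Rightarrow> bool" where
  "acc_ok m A \<longleftrightarrow> (\<forall>p<n. \<forall>e. tup e \<longrightarrow> indep (Jset e) \<longrightarrow> Jset e \<subseteq> insert (rs ! p) (NB p) \<longrightarrow>
     A (rs ! p * P + code e) = (\<Sum>i | i < n \<and> m \<le> i \<and> par i p. opt (CC i - NN (Jset e))))"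

text \<open>Children come after their parent in the order, so the row of \<open>p\<close> is
  complete once all positions after \<open>p\<close> have pushed.\<close>

lemma acc_row:
  assumes A: "acc_ok m A" and p: "p < n" "m \<le> Suc p" and e: "tup e" "indep (Jset e)" "Jset e \<subseteq> insert (rs ! p) (NB p)"
  shows "A (rs ! p * P + code e) = opt (CC p - {rs ! p} - NN (Jset e))"
proof -
  have "{i. i < n \<and> m \<le> i \<and> par i p} = {i. i < nn \<and> par i p}"
    using par_less p nn by force
  then show ?thesis using A p(1) e acc_opt[of p "Jset e"] unfolding acc_ok_def nn by simp
qed

lemma acc_insert:
  assumes A: "acc_ok m A" and p: "p < n" "m \<le> Suc p"
    and e: "tup e" "indep (insert (rs ! p) (Jset e))" "Jset e \<subseteq> NB p" and j: "j < L" "e j = 0"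
  shows "A (rs ! p * P + (code e + (rs ! p + 1) * B ^ j)) = opt (CC p - {rs ! p} - NN (insert (rs ! p) (Jset e)))"
proof -
  let ?v = "rs ! p" and ?f = "e(j := Suc (rs ! p))"
  have v: "?v < n" "?v \<notin> Jset e" using nth_V[of p] p nn e(3) nth_CC[of p] unfolding nbhd_def by auto
  have Jf: "Jset ?f = insert ?v (Jset e)" using Jset_upd[of j e] j by blast
  have tf: "tup ?f" using tup_upd[of e j] e(1) j(1) v by blast
  have "A (?v * P + code ?f) = opt (CC p - {?v} - NN (Jset ?f))"
    by (rule acc_row[OF A p tf]) (use Jf e in auto)
  then show ?thesis using Jf val_upd[of j L e B "Suc ?v"] j by simp
qed

lemma ok_NN: "(\<forall>j<L. e j \<noteq> 0 \<longrightarrow> \<not> E z (e j - 1)) \<longleftrightarrow> z \<notin> NN (Jset e)"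
proof
  assume l: "\<forall>j<L. e j \<noteq> 0 \<longrightarrow> \<not> E z (e j - 1)"
  show "z \<notin> NN (Jset e)"
  proof
    assume "z \<in> NN (Jset e)"
    then obtain u j where "j < L" "e j = Suc u" "E u z" unfolding NN_def Jset_def by blast
    then show False using l symE by force
  qed
next
  assume r: "z \<notin> NN (Jset e)"
  show "\<forall>j<L. e j \<noteq> 0 \<longrightarrow> \<not> E z (e j - 1)"
  proof (intro allI impI notI)
    fix j assume "j < L" "e j \<noteq> 0" "E z (e j - 1)"
    then have "e j - 1 \<in> Jset e" unfolding Jset_def by force
    then show False using r symE[OF \<open>E z (e j - 1)\<close>] unfolding NN_def by blast
  qed
qed

lemma indep_insert: "u \<in> {..<n} \<Longrightarrow> indep J \<Longrightarrow> u \<notin> NN J \<Longrightarrow> indep (insert u J)"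
  unfolding indep_def NN_def using irrE symE by blast

text \<open>A set in the parent's bag avoids \<open>CC i\<close>, so only its trace on
  \<open>NB i\<close> matters, and masking computes that trace. The rest is the recursion
  \<open>CC_opt\<close> with its optima read from the completed row of
  \<open>rs ! i\<close>.\<close>

lemma cell:
  assumes A: "acc_ok m A" and i: "i < n" "m \<le> Suc i" and p: "par i p"
    and e: "tup e" "indep (Jset e)" "Jset e \<subseteq> insert (rs ! p) (NB p)"
  shows "cell A (rs ! i) (NB i) e = opt (CC i - NN (Jset e))"
proof -
  let ?v = "rs ! i"
  define f where "f = mask (NB i) e"
  have Jf: "Jset f = Jset e \<inter> NB i" unfolding f_def by (rule Jset_mask)
  have tf: "tup f" unfolding f_def by (rule tup_mask[OF e(1)])
  have indf: "indep (Jset f)" using e(2) indep_subset Jf by blast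
  have i': "i < nn" using i nn by simp
  have p': "p < nn" using p unfolding par_def by blast
  have disj: "Jset e \<inter> CC i = {}"
  proof -
    have "CC i \<subseteq> CC p - {rs ! p}" by (rule par_sub[OF i' p])
    moreover have "NB p \<inter> CC p = {}" unfolding nbhd_def by blast
    ultimately show ?thesis using e(3) by blast
  qed
  have goal: "opt (CC i - NN (Jset e)) = opt (CC i - NN (Jset f))"
    unfolding Jf using NN_restrict[OF disj] by simp
  have a: "A (?v * P + code f) = opt (CC i - {?v} - NN (Jset f))"
    by (rule acc_row[OF A i tf indf]) (use Jf in auto)
  show ?thesis
  proof (cases "?v \<in> NN (Jset f)")
    case True
    then have "\<not> (\<forall>j<L. f j \<noteq> 0 \<longrightarrow> \<not> E ?v (f j - 1))" using ok_NN by blast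
    then have "cell A ?v (NB i) e = A (?v * P + code f)" unfolding cell_def f_def[symmetric] Let_def by simp
    then show ?thesis using goal CC_opt[OF i', of "Jset f"] True a by simp
  next
    case False
    have ind: "indep (insert ?v (Jset f))" using indep_insert[OF nth_V[OF i'] indf False] .
    have vJ: "?v \<notin> Jset f" using Jf nth_CC[of i] unfolding nbhd_def by auto
    have "card (insert ?v (Jset f)) \<le> L" by (rule bag_card[OF i(1) _ ind]) (use Jf in auto)
    moreover have "card (insert ?v (Jset f)) = Suc (card (Jset f))"
      using vJ indep_finite[OF indf] by simp
    \<comment> \<open>Together with \<open>rs ! i\<close> the set is still independent and inside
      the bag, so it has at most \<open>L - 1\<close> elements by itself.\<close>
    ultimately have "\<exists>j<L. f j = 0" using Jset_full[OF tf] by force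
    then have bp: "0 < blank B L f" using blank_pos by auto
    then obtain j where j: "j < L" "f j = 0" "blank B L f = B ^ j" using blank_ex by blast
    have b: "A (?v * P + (code f + (?v + 1) * blank B L f)) = opt (CC i - {?v} - NN (insert ?v (Jset f)))"
      unfolding j(3) by (rule acc_insert[OF A i tf ind _ j(1,2)]) (use Jf in auto)
    have "cell A ?v (NB i) e = max (opt (CC i - {?v} - NN (Jset f))) (w ?v + opt (CC i - {?v} - NN (insert ?v (Jset f))))"
      unfolding cell_def f_def[symmetric] Let_def a b using False bp ok_NN by auto
    then show ?thesis using goal CC_opt[OF i', of "Jset f"] False by simp
  qed
qed

lemma acc_ok_start: "acc_ok n (\<lambda>_. 0)"
  unfolding acc_ok_def by (auto intro!: sum.neutral)

text \<open>Row \<open>q\<close> is the parent's, or the dummy row for a root. Position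
  \<open>i\<close> contributes to the sum of its parent only, so all other rows must stay as they
  were.\<close>

lemma acc_ok_step:
  assumes A: "acc_ok (Suc i) A" and i: "i < n"
    and q: "\<And>p. par i p \<Longrightarrow> q = rs ! p" "(\<nexists>p. par i p) \<Longrightarrow> q = n"
    and A': "\<And>c. c < P \<Longrightarrow> A' (q * P + c) = A (q * P + c) + cell A (rs ! i) (NB i) (\<lambda>j. c div B ^ j mod B)"
      "\<And>p c. p < n \<Longrightarrow> p \<noteq> q \<Longrightarrow> c < P \<Longrightarrow> A' (p * P + c) = A (p * P + c)"
  shows "acc_ok i A'"
  unfolding acc_ok_def
proof (intro allI impI)
  fix p e assume p: "p < n" and e: "tup e" "indep (Jset e)" "Jset e \<subseteq> insert (rs ! p) (NB p)"
  let ?I = "\<lambda>m. {j. j < n \<and> m \<le> j \<and> par j p}"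
  have dig: "e j < B" if "j < L" for j using e(1) that unfolding tup_def by (simp add: less_Suc_eq_le)
  have lt: "code e < P" using dig by (intro code_less) (simp add: less_Suc_eq_le)
  have old: "A (rs ! p * P + code e) = (\<Sum>j \<in> ?I (Suc i). opt (CC j - NN (Jset e)))"
    using A p e unfolding acc_ok_def by blast
  show "A' (rs ! p * P + code e) = (\<Sum>j \<in> ?I i. opt (CC j - NN (Jset e)))"
  proof (cases "par i p")
    case True
    have qp: "q = rs ! p" using q True by blast
    have eq: "mask (NB i) (\<lambda>j. code e div B ^ j mod B) j = mask (NB i) e j" if "j < L" for j
      \<comment> \<open>Only the digits below \<open>L\<close> are recovered from the code, but
        \<open>val\<close> and \<open>blank\<close> look no further.\<close>
      unfolding mask_def using val_digit[of L e B j] dig that by simp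
    have v: "val B L (mask (NB i) (\<lambda>j. code e div B ^ j mod B)) = val B L (mask (NB i) e)"
      by (rule val_cong) (rule eq)
    have bl: "l \<le> L \<Longrightarrow> blank B l (mask (NB i) (\<lambda>j. code e div B ^ j mod B)) = blank B l (mask (NB i) e)" for l
      by (induction l) (use eq in auto)
    have "cell A (rs ! i) (NB i) (\<lambda>j. code e div B ^ j mod B) = cell A (rs ! i) (NB i) e"
      unfolding cell_def Let_def v bl[OF order_refl] using eq by simp
    then have "A' (rs ! p * P + code e) = A (rs ! p * P + code e) + opt (CC i - NN (Jset e))"
      using A'(1)[OF lt] cell[OF A i order_refl True e] qp by simp
    moreover have "?I i = insert i (?I (Suc i))" using i True by auto
    moreover have "i \<notin> ?I (Suc i)" "finite (?I (Suc i))" by auto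
    ultimately show ?thesis using old by simp
  next
    case False
    have "rs ! p \<noteq> q"
    proof (cases "\<exists>p'. par i p'")
      case True
      then obtain p' where p': "par i p'" by blast
      then have "p' \<noteq> p" "p' < n" using False nn unfolding par_def by auto
      then show ?thesis using q(1)[OF p'] dist p nn by (simp add: nth_eq_iff_index_eq)
    next
      case False
      then show ?thesis using q(2) nth_V[of p] p nn by auto
    qed
    then have "A' (rs ! p * P + code e) = A (rs ! p * P + code e)"
      using A'(2) nth_V[of p] p nn lt by auto
    moreover have "?I i = ?I (Suc i)" using False by (auto simp: Suc_le_eq) (metis le_neq_implies_less)
    ultimately show ?thesis using old by simp
  qed
qed

end

section \<open>Dynamic programming\<close>

fun powa :: "nat \<Rightarrow> aexp" where
  "powa 0 = N 1"
| "powa (Suc m) = Times (powa m) (Plus len (N 1))"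

lemma okb_powa: "(n + 1) * (n + 1) ^ m < M \<Longrightarrow> okb M n (powa m) \<and> bd n (powa m) = (n + 1) ^ m"
proof (induction m)
  case (Suc m)
  have "(n + 1) * (n + 1) ^ m \<le> (n + 1) * (n + 1) ^ Suc m" by simp
  then have m: "(n + 1) * (n + 1) ^ m < M" using Suc.prems by linarith
  have "n + 1 \<le> (n + 1) * (n + 1) ^ m"
    using mult_le_mono2[of 1 "(n + 1) ^ m" "n + 1"] by (simp only: mult_1_right one_le_power le_add2)
  then have "n + 1 < M" using m by linarith
  then show ?case using Suc.IH[OF m] m by (simp add: mult.commute)
qed auto

lemma bdeg_powa [simp]: "bdeg (powa m) = m"
  by (induction m) auto

text \<open>One pass over the digits yields all that \<open>cell\<close> needs: \<open>t\<close>
  becomes the masked code, \<open>bl\<close> the place value of the last blank, and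
  \<open>ok\<close> tells whether no chosen vertex is adjacent to \<open>z\<close>. The register
  \<open>pw\<close> holds the current place value and \<open>y\<close> the unread digits.\<close>

definition digit_code :: fcom where
  "digit_code =
     FAssign ''d'' (Mod (V ''y'') (Plus len (N 1))) ;;
     FAssign ''y'' (Div (V ''y'') (Plus len (N 1))) ;;
     FIf (BAnd (NZ (V ''d'')) (NZ (Arr ''S'' (Minus (V ''d'') (N 1)))))
       (FAssign ''t'' (Plus (V ''t'') (Times (V ''d'') (V ''pw''))) ;;
        FIf (NZ (At ''adj'' (V ''z'') (Minus (V ''d'') (N 1)))) (FAssign ''ok'' (N 0)) FSkip)
       (FAssign ''bl'' (V ''pw'')) ;;
     FAssign ''pw'' (Times (V ''pw'') (Plus len (N 1)))"

definition digits_code :: "nat \<Rightarrow> fcom" where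
  "digits_code L =
     FAssign ''y'' (V ''c'') ;; FAssign ''t'' (N 0) ;; FAssign ''pw'' (N 1) ;;
     FAssign ''bl'' (N 0) ;; FAssign ''ok'' (N 1) ;;
     FFor ''j'' (N L) digit_code"

definition ACC :: "nat \<Rightarrow> string \<Rightarrow> aexp \<Rightarrow> wexp" where
  "ACC L v i = WArr ''acc'' (Plus (Times (V v) (powa L)) i)"

text \<open>Entry 0 of \<open>x\<close> serves as a rational register. If there is no blank, the
  last comparison reads a meaningless cell, but the conjunct on \<open>bl\<close> already decides
  the test.\<close>

definition cell_code :: "nat \<Rightarrow> fcom" where
  "cell_code L =
     FWStore ''x'' (N 0) (ACC L ''z'' (V ''t'')) ;;
     FIf (BAnd (BAnd (NZ (V ''ok'')) (NZ (V ''bl''))) (WLess (WArr ''x'' (N 0))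
            (WPlus (WArr ''weight'' (V ''z'')) (ACC L ''z'' (Plus (V ''t'') (Times (Plus (V ''z'') (N 1)) (V ''bl'')))))))
       (FWStore ''x'' (N 0)
            (WPlus (WArr ''weight'' (V ''z'')) (ACC L ''z'' (Plus (V ''t'') (Times (Plus (V ''z'') (N 1)) (V ''bl'')))))) FSkip ;;
     FWStore ''acc'' (Plus (Times (V ''par'') (powa L)) (V ''c'')) (WPlus (ACC L ''par'' (V ''c'')) (WArr ''x'' (N 0)))"

definition push_code :: "nat \<Rightarrow> fcom" where
  "push_code L = FFor ''c'' (powa L) (digits_code L ;; cell_code L)"

text \<open>\<open>pos\<close> holds positions plus one, so \<open>i < pos\<close> selects the
  positions from \<open>i\<close> on, that is \<open>V - W i\<close>.\<close>

definition vertex_code :: fcom where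
  "vertex_code =
     FAssign ''z'' (Arr ''ord'' (V ''i'')) ;;
     fill ''u'' ''al'' (Less (V ''i'') (Arr ''pos'' (V ''u''))) ;;
     comp_code"

text \<open>The order is scanned upwards and the last hit wins, which is the neighbour of largest
  position. Without a hit, \<open>par\<close> keeps the index n of the dummy row.\<close>

definition parent_code :: fcom where
  "parent_code = FAssign ''par'' len ;;
     FFor ''j'' len (FIf (NZ (Arr ''S'' (Arr ''ord'' (V ''j'')))) (FAssign ''par'' (Arr ''ord'' (V ''j''))) FSkip)"

text \<open>Positions run from n - 1 down to 0, so that all children have pushed before the row of
  their parent is read.\<close>

definition dp_phase :: "nat \<Rightarrow> fcom" where
  "dp_phase L = FFor ''it'' len
     (FAssign ''i'' (Minus (Minus len (N 1)) (V ''it'')) ;; vertex_code ;; parent_code ;; push_code L)"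

text \<open>Here the digits are packed from place 0 on, so \<open>pw\<close> ends as the place value
  of the first free digit and no search for a blank is needed.\<close>

definition collect_code :: fcom where
  "collect_code = FAssign ''t'' (N 0) ;; FAssign ''pw'' (N 1) ;; FAssign ''ok'' (N 1) ;;
     FFor ''u'' len (FIf (BAnd (IN ''out'' ''u'') (IN ''S'' ''u''))
       (FAssign ''t'' (Plus (V ''t'') (Times (Plus (V ''u'') (N 1)) (V ''pw''))) ;;
        FAssign ''pw'' (Times (V ''pw'') (Plus len (N 1))) ;;
        FIf (ADJ ''z'' ''u'') (FAssign ''ok'' (N 0)) FSkip) FSkip)"

definition select_code :: "nat \<Rightarrow> fcom" where
  "select_code L = FIf (BAnd (NZ (V ''ok'')) (WLess (ACC L ''z'' (V ''t''))
       (WPlus (WArr ''weight'' (V ''z'')) (ACC L ''z'' (Plus (V ''t'') (Times (Plus (V ''z'') (N 1)) (V ''pw'')))))))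
     (FStore ''out'' (V ''z'') (N 1)) FSkip"

definition out_phase :: "nat \<Rightarrow> fcom" where
  "out_phase L = FFor ''i'' len (vertex_code ;; collect_code ;; select_code L)"

definition mwis_code :: "nat \<Rightarrow> fcom" where
  "mwis_code L = order_phase ;; dp_phase L ;; out_phase L"

lemma dp_frames [simp]:
  "asg (digits_code L) = {''y'', ''t'', ''pw'', ''bl'', ''ok'', ''j'', ''d''}" "sto (digits_code L) = {}" "wsto (digits_code L) = {}"
  "asg (cell_code L) = {}" "sto (cell_code L) = {}" "wsto (cell_code L) = {''x'', ''acc''}"
  "asg (push_code L) = {''c'', ''y'', ''t'', ''pw'', ''bl'', ''ok'', ''j'', ''d''}" "sto (push_code L) = {}" "wsto (push_code L) = {''x'', ''acc''}"
  "asg vertex_code = {''z'', ''u'', ''v'', ''r''}" "sto vertex_code = {''al'', ''C'', ''S''}" "wsto vertex_code = {}"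
  "asg parent_code = {''par'', ''j''}" "sto parent_code = {}" "wsto parent_code = {}"
  "asg collect_code = {''t'', ''pw'', ''ok'', ''u''}" "sto collect_code = {}" "wsto collect_code = {}"
  "asg (select_code L) = {}" "sto (select_code L) = {''out''}" "wsto (select_code L) = {}"
  by (auto simp: digits_code_def digit_code_def cell_code_def push_code_def vertex_code_def parent_code_def
      collect_code_def select_code_def)

section \<open>Correctness of the table computation\<close>

locale dp = ram n E M + tuples n E w rs L for n E M w rs L +
  assumes BPM: "(n + 1) * (n + 1) ^ L < M"
begin

lemma PM: "P < M" "B < M"
proof -
  have "P \<le> B * P" "B \<le> B * P"
    using mult_le_mono2[of 1 P B] by (simp_all only: mult_1_right one_le_power le_add2, simp)
  then show "P < M" "B < M" using BPM by linarith+
qed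

lemma pow_less: "i \<le> L \<Longrightarrow> B ^ i < M"
  using power_increasing[of i L B] PM by simp

lemma aval_B [simp]: "reg r ''n'' = n \<Longrightarrow> aval M r (Plus len (N (Suc 0))) = B"
  using PM M1 by (simp add: aval_Plus)

lemma aval_powa [simp]: "reg r ''n'' = n \<Longrightarrow> aval M r (powa L) = P"
  using okb_aval[of M n "powa L" r] okb_powa[OF BPM] by simp

text \<open>There are n + 1 rows of \<open>P\<close> cells, the last being the dummy row; this is
  the address range that \<open>BPM\<close> provides for.\<close>

lemma row_less: "p \<le> n \<Longrightarrow> c < P \<Longrightarrow> p * P + c < M"
proof -
  assume "p \<le> n" "c < P"
  then have "p * P + c < n * P + P" using mult_le_mono1[of p n P] by linarith
  also have "\<dots> = B * P" by simp
  finally show ?thesis using BPM by linarith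
qed

lemma aval_row:
  assumes "reg r ''n'' = n" "reg r v \<le> n" "aval M r i < P"
  shows "aval M r (Plus (Times (V v) (powa L)) i) = reg r v * P + aval M r i"
proof -
  have "reg r v * P + aval M r i < M" by (rule row_less[OF assms(2,3)])
  then show ?thesis using assms by (simp add: aval_Plus)
qed

lemma row_inj: "c < P \<Longrightarrow> c' < P \<Longrightarrow> p * P + c = p' * P + c' \<longleftrightarrow> p = p' \<and> c = (c' :: nat)"
proof -
  assume "c < P" "c' < P"
  then have "(p * P + c) div P = p" "(p * P + c) mod P = c" "(p' * P + c') div P = p'" "(p' * P + c') mod P = c'"
    by auto
  then show ?thesis by metis
qed

lemma wval_ACC: "reg r ''n'' = n \<Longrightarrow> reg r v \<le> n \<Longrightarrow> aval M r i < P \<Longrightarrow>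
    wval M r (ACC L v i) = warr r ''acc'' (reg r v * P + aval M r i)"
  by (simp add: ACC_def aval_row)

lemma digits_code:
  assumes s: "inp s" and c: "reg s ''c'' = c" "c < P" and z: "reg s ''z'' < n"
  defines "r \<equiv> sem M (digits_code L) s" and "f \<equiv> mask (aset s ''S'') (\<lambda>j. c div B ^ j mod B)"
  shows "reg r ''t'' = code f \<and> reg r ''bl'' = blank B L f \<and>
    (reg r ''ok'' \<noteq> 0 \<longleftrightarrow> (\<forall>j<L. f j \<noteq> 0 \<longrightarrow> \<not> E (reg s ''z'') (f j - 1)))"
proof -
  let ?z = "reg s ''z''"
  define s1 where "s1 = set_reg ''ok'' 1 (set_reg ''bl'' 0 (set_reg ''pw'' 1 (set_reg ''t'' 0 (set_reg ''y'' c s))))"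
  let ?X = "{''y'', ''t'', ''pw'', ''bl'', ''ok'', ''j'', ''d''}"
  let ?P = "\<lambda>i q. agree ?X {} s q \<and> reg q ''y'' = c div B ^ i \<and> reg q ''pw'' = B ^ i \<and>
    reg q ''t'' = val B i f \<and> reg q ''bl'' = blank B i f \<and>
    (reg q ''ok'' \<noteq> 0 \<longleftrightarrow> (\<forall>j<i. f j \<noteq> 0 \<longrightarrow> \<not> E ?z (f j - 1)))"
  have "?P L (sem M (FFor ''j'' (N L) digit_code) s1)"
  proof (rule sem_For_inv[where P = ?P])
    show "bd (reg s1 ''n'') (N L) = L" by simp
    show "?P 0 (set_reg ''j'' 0 s1)" unfolding s1_def by (auto intro!: agree_set_reg agree_refl)
    fix i q assume i: "i < L" and P: "?P i q"
    define d where "d = c div B ^ i mod B"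
    have q: "reg q ''n'' = n" "reg q ''z'' = ?z" "arr q = arr s" "reg q ''y'' = c div B ^ i" "reg q ''pw'' = B ^ i"
      "reg q ''t'' = val B i f"
    proof -
      have ag: "agree ?X {} s q" using P by blast
      show "reg q ''n'' = n" using agreeD(1)[OF ag, of "''n''"] inp_n[OF s] by simp
      show "reg q ''z'' = ?z" using agreeD(1)[OF ag, of "''z''"] by simp
      show "arr q = arr s" using agreeD(2)[OF ag] by auto
    qed (use P in blast)+
    have fB: "f j < B" for j unfolding f_def mask_def by (simp add: less_Suc_eq_le)
    have dB: "d < B" "d < M" using PM by (auto simp: d_def intro: less_trans[OF mod_less_divisor])
    have yM: "c div B ^ i < M" "c div B ^ i div B < M"
      using c(2) PM(1) div_le_dividend[of c "B ^ i"] div_le_dividend[of "c div B ^ i" B] by linarith+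
    have Si: "B ^ Suc i < M" using pow_less[of "Suc i"] i by simp
    have vS: "val B i f + f i * B ^ i < M" using val_less[of "Suc i" f B] fB Si by simp
    have ag: "agree ?X {} s (set_reg x v q')" if "x \<in> ?X" "agree ?X {} s q'" for x v q'
      using agree_set_reg that by blast
    have dSi: "c div B ^ Suc i = c div B ^ i div B" by (simp only: power_Suc2 div_mult2_eq)
    define q1 where "q1 = set_reg ''y'' (c div B ^ Suc i) (set_reg ''d'' d q)"
    have s12: "sem M (FAssign ''d'' (Mod (V ''y'') (Plus len (N 1))) ;; FAssign ''y'' (Div (V ''y'') (Plus len (N 1)))) q = q1"
      unfolding q1_def dSi using q yM dB by (simp add: d_def)
    have q1: "agree ?X {} s q1" "reg q1 ''n'' = n" "reg q1 ''z'' = ?z" "arr q1 = arr s" "reg q1 ''d'' = d" "reg q1 ''pw'' = B ^ i"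
      "reg q1 ''t'' = val B i f" "reg q1 ''bl'' = blank B i f" "reg q1 ''y'' = c div B ^ Suc i" "reg q1 ''ok'' = reg q ''ok''"
      using q P by (auto simp: q1_def intro!: ag)
    have dm: "aval M q1 (Minus (V ''d'') (N (Suc 0))) = d - 1" using q1 dB M1 by simp
    have cond: "bval M q1 (BAnd (NZ (V ''d'')) (NZ (Arr ''S'' (Minus (V ''d'') (N 1))))) \<longleftrightarrow> d \<noteq> 0 \<and> d - 1 \<in> aset s ''S''"
    proof -
      have "d \<noteq> 0 \<Longrightarrow> d - 1 < n" using dB(1) by linarith
      then show ?thesis using q1 dm by (auto simp: aset_def)
    qed
    let ?c2 = "FIf (BAnd (NZ (V ''d'')) (NZ (Arr ''S'' (Minus (V ''d'') (N 1)))))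
       (FAssign ''t'' (Plus (V ''t'') (Times (V ''d'') (V ''pw''))) ;;
        FIf (NZ (At ''adj'' (V ''z'') (Minus (V ''d'') (N 1)))) (FAssign ''ok'' (N 0)) FSkip)
       (FAssign ''bl'' (V ''pw''))"
    define q2 where "q2 = sem M ?c2 q1"
    have fi: "f i = (if d \<noteq> 0 \<and> d - 1 \<in> aset s ''S'' then d else 0)"
      unfolding f_def mask_def d_def by simp
    have "agree ?X {} q1 q2" unfolding q2_def by (rule agree_sem) auto
    then have ag2: "agree ?X {} s q2" using agree_trans q1(1) by blast
    have q2: "reg q2 ''t'' = val B (Suc i) f \<and> reg q2 ''bl'' = blank B (Suc i) f \<and>
       (reg q2 ''ok'' \<noteq> 0 \<longleftrightarrow> (\<forall>j<Suc i. f j \<noteq> 0 \<longrightarrow> \<not> E ?z (f j - 1)))"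
    proof (cases "d \<noteq> 0 \<and> d - 1 \<in> aset s ''S''")
      case True
      then have fd: "f i = d" using fi by simp
      have d1: "d - 1 < n" using dB(1) True by linarith
      have tv: "aval M q1 (Plus (V ''t'') (Times (V ''d'') (V ''pw''))) = val B (Suc i) f"
        using q1 vS fd by (simp add: aval.simps(4) mod_add_right_eq)
      define q1' where "q1' = set_reg ''t'' (val B (Suc i) f) q1"
      have "aval M q1' (At ''adj'' (V ''z'') (Minus (V ''d'') (N 1))) = arr s ''adj'' (?z * n + (d - 1))"
        using q1 z d1 dB M1 by (simp add: q1'_def)
      then have b: "bval M q1' (NZ (At ''adj'' (V ''z'') (Minus (V ''d'') (N 1)))) \<longleftrightarrow> E ?z (d - 1)"
        using s z d1 unfolding inp_def by simp
      have "q2 = (if E ?z (d - 1) then set_reg ''ok'' 0 q1' else q1')"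
        unfolding q2_def using cond True tv b by (simp add: q1'_def del: bval.simps)
      then show ?thesis using q1 P True fd by (auto simp: q1'_def less_Suc_eq)
    next
      case False
      then have "f i = 0" using fi by simp
      moreover have "q2 = sem M (FAssign ''bl'' (V ''pw'')) q1"
        unfolding q2_def sem.simps(6) using cond False by argo
      then have "q2 = set_reg ''bl'' (B ^ i) q1" using q1 by simp
      ultimately show ?thesis using q1 P by (auto simp: less_Suc_eq)
    qed
    have q2': "reg q2 ''y'' = c div B ^ Suc i" "reg q2 ''pw'' = B ^ i" "reg q2 ''n'' = n"
      unfolding q2_def using q1 by (simp_all del: sem.simps)
    have "sem M digit_code q = set_reg ''pw'' (B ^ Suc i) q2"
    proof -
      have "aval M q2 (Times (V ''pw'') (Plus len (N 1))) = B ^ Suc i"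
        using q2' Si by (simp add: mult.commute)
      then have "sem M (FAssign ''pw'' (Times (V ''pw'') (Plus len (N 1)))) q2 = set_reg ''pw'' (B ^ Suc i) q2"
        unfolding sem.simps(2) by simp
      then show ?thesis unfolding digit_code_def sem.simps(5) using s12[unfolded sem.simps(5)] q2_def by simp
    qed
    then show "?P (Suc i) (set_reg ''j'' (Suc i) (sem M digit_code q))"
      using q2 q2' ag2 by (auto intro!: ag simp del: val.simps blank.simps power_Suc)
  qed
  moreover have "r = sem M (FFor ''j'' (N L) digit_code) s1"
    unfolding r_def digits_code_def s1_def using c M1 by (simp del: sem.simps(7))
  ultimately show ?thesis by simp
qed

end

context dp
begin

text \<open>The sum is the code of the tuple with \<open>z\<close> written into the blank, so it is
  again a valid index within a row.\<close>

lemma blank_idx: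
  assumes f: "\<And>j. j < L \<Longrightarrow> f j \<le> n" and z: "z < n" and b: "0 < blank B L f"
  shows "code f + (z + 1) * blank B L f < P"
proof -
  obtain j where j: "j < L" "f j = 0" "blank B L f = B ^ j" using blank_ex[OF b] by blast
  have "code (f(j := Suc z)) < P" by (rule code_less) (use f z in auto)
  then show ?thesis using val_upd[of j L f B "Suc z"] j by simp
qed

lemma aval_ext:
  assumes "reg r t + (reg r z + 1) * reg r b < M" "reg r z < n"
  shows "aval M r (Plus (V t) (Times (Plus (V z) (N 1)) (V b))) = reg r t + (reg r z + 1) * reg r b"
proof -
  have zM: "reg r z + 1 < M" using assms(2) PM by simp
  then have z1: "aval M r (Plus (V z) (N 1)) = reg r z + 1" using M1 by (simp add: aval_Plus)
  have "(reg r z + 1) * reg r b < M" using assms(1) by linarith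
  then have "aval M r (Times (Plus (V z) (N 1)) (V b)) = (reg r z + 1) * reg r b"
    unfolding aval.simps(6) z1 by simp
  then show ?thesis using assms(1) by (simp add: aval_Plus)
qed

lemma cell_code:
  assumes s: "reg s ''n'' = n" and c: "reg s ''c'' < P" and z: "reg s ''z'' < n" and p: "reg s ''par'' \<le> n"
    and f: "f = mask S e" "\<And>j. j < L \<Longrightarrow> f j \<le> n" and t: "reg s ''t'' = code f" and bl: "reg s ''bl'' = blank B L f"
    and ok: "reg s ''ok'' \<noteq> 0 \<longleftrightarrow> (\<forall>j<L. f j \<noteq> 0 \<longrightarrow> \<not> E (reg s ''z'') (f j - 1))"
    and wt: "warr s ''weight'' (reg s ''z'') = w (reg s ''z'')"
  shows "warr (sem M (cell_code L) s) ''acc'' = (warr s ''acc'')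
    (reg s ''par'' * P + reg s ''c'' := warr s ''acc'' (reg s ''par'' * P + reg s ''c'') + cell (warr s ''acc'') (reg s ''z'') S e)"
proof -
  let ?z = "reg s ''z''" and ?A = "warr s ''acc''"
  let ?ext = "Plus (V ''t'') (Times (Plus (V ''z'') (N 1)) (V ''bl''))"
  let ?w2 = "WPlus (WArr ''weight'' (V ''z'')) (ACC L ''z'' ?ext)"
  let ?cond = "BAnd (BAnd (NZ (V ''ok'')) (NZ (V ''bl''))) (WLess (WArr ''x'' (N 0)) ?w2)"
  define a where "a = ?A (?z * P + code f)"
  define b where "b = w ?z + ?A (?z * P + (code f + (?z + 1) * blank B L f))"
  define s1 where "s1 = set_warr ''x'' 0 a s"
  have tP: "code f < P" by (rule code_less[OF f(2)])
  have "wval M s (ACC L ''z'' (V ''t'')) = a" unfolding a_def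
    by (subst wval_ACC) (use s z t tP in auto)
  then have s1: "sem M (FWStore ''x'' (N 0) (ACC L ''z'' (V ''t''))) s = s1" by (simp add: s1_def)
  have w2: "wval M s1 ?w2 = b" if "0 < blank B L f"
  proof -
    have idx: "code f + (?z + 1) * blank B L f < P" by (rule blank_idx[OF f(2) z that])
    have "aval M s1 ?ext = code f + (?z + 1) * blank B L f"
      by (subst aval_ext) (use idx PM z t bl in \<open>auto simp: s1_def\<close>)
    then have "wval M s1 (ACC L ''z'' ?ext) = ?A (?z * P + (code f + (?z + 1) * blank B L f))"
      by (subst wval_ACC) (use s z idx in \<open>auto simp: s1_def\<close>)
    then show ?thesis using wt by (simp add: b_def s1_def)
  qed
  have x1: "wval M s1 (WArr ''x'' (N 0)) = a" by (simp add: s1_def)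
  let ?C = "(\<forall>j<L. f j \<noteq> 0 \<longrightarrow> \<not> E ?z (f j - 1)) \<and> 0 < blank B L f \<and> a < b"
  have cond: "bval M s1 ?cond \<longleftrightarrow> ?C"
  proof (cases "0 < blank B L f")
    case True
    then show ?thesis unfolding bval.simps w2[OF True] x1 using ok bl by (simp add: s1_def)
  next
    case False
    then show ?thesis using bl by (simp add: s1_def)
  qed
  define s2 where "s2 = sem M (FIf ?cond (FWStore ''x'' (N 0) ?w2) FSkip) s1"
  have s2: "s2 = (if ?C then set_warr ''x'' 0 b s1 else s1)"
  proof (cases ?C)
    case True
    then have "s2 = sem M (FWStore ''x'' (N 0) ?w2) s1"
      unfolding s2_def sem.simps(6) by (intro if_P iffD2[OF cond])
    then have "s2 = set_warr ''x'' 0 b s1" unfolding sem.simps(4) using w2 True by simp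
    then show ?thesis by (simp only: if_P[OF True])
  next
    case False
    have "s2 = sem M FSkip s1"
      unfolding s2_def sem.simps(6) by (rule if_not_P) (use cond False in blast)
    then have "s2 = s1" unfolding sem.simps(1) .
    then show ?thesis by (simp only: if_not_P[OF False])
  qed
  have X: "warr s2 ''x'' 0 = cell ?A ?z S e" "warr s2 ''acc'' = ?A" "reg s2 = reg s"
    unfolding s2 cell_def f(1)[symmetric] Let_def a_def[symmetric] b_def[symmetric] by (auto simp: s1_def)
  have i: "aval M s2 (Plus (Times (V ''par'') (powa L)) (V ''c'')) = reg s ''par'' * P + reg s ''c''"
    by (subst aval_row) (use X s p c in auto)
  have v: "wval M s2 (ACC L ''par'' (V ''c'')) = ?A (reg s ''par'' * P + reg s ''c'')"
    by (subst wval_ACC) (use X s p c in auto)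
  have "sem M (cell_code L) s = sem M (FWStore ''acc'' (Plus (Times (V ''par'') (powa L)) (V ''c'')) (WPlus (ACC L ''par'' (V ''c'')) (WArr ''x'' (N 0)))) s2"
    unfolding cell_code_def sem.simps(5) s1 s2_def ..
  also have "\<dots> = set_warr ''acc'' (reg s ''par'' * P + reg s ''c'') (?A (reg s ''par'' * P + reg s ''c'') + cell ?A ?z S e) s2"
    unfolding sem.simps(4) wval.simps(3) i v using X by simp
  finally show ?thesis using X by simp
qed

text \<open>\<open>cell\<close> depends only on row \<open>z\<close>. It can therefore be evaluated
  while another row is being overwritten.\<close>

lemma cell_cong:
  assumes "\<And>c. c < P \<Longrightarrow> A' (z * P + c) = A (z * P + c)" "z < n" "\<And>j. j < L \<Longrightarrow> e j \<le> n"
  shows "cell A' z S e = cell A z S e"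
proof -
  have f: "mask S e j \<le> n" if "j < L" for j using assms(3)[OF that] by (simp add: mask_def)
  have 1: "A' (z * P + code (mask S e)) = A (z * P + code (mask S e))"
    by (rule assms(1)) (rule code_less[OF f])
  have 2: "A' (z * P + (code (mask S e) + (z + 1) * blank B L (mask S e))) = A (z * P + (code (mask S e) + (z + 1) * blank B L (mask S e)))"
    if "0 < blank B L (mask S e)"
    by (rule assms(1)) (rule blank_idx[OF f assms(2) that])
  show ?thesis unfolding cell_def Let_def 1 using 2 by (cases "0 < blank B L (mask S e)") auto
qed

lemma push_code:
  assumes s: "inp s" and z: "reg s ''z'' < n" and p: "reg s ''par'' \<le> n" "reg s ''par'' \<noteq> reg s ''z''"
    and wt: "warr s ''weight'' (reg s ''z'') = w (reg s ''z'')"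
  defines "A \<equiv> warr s ''acc''" and "r \<equiv> sem M (push_code L) s"
  shows "\<And>c. c < P \<Longrightarrow> warr r ''acc'' (reg s ''par'' * P + c) = A (reg s ''par'' * P + c) +
      cell A (reg s ''z'') (aset s ''S'') (\<lambda>j. c div B ^ j mod B)"
    and "\<And>p c. p \<noteq> reg s ''par'' \<Longrightarrow> c < P \<Longrightarrow> warr r ''acc'' (p * P + c) = A (p * P + c)"
proof -
  let ?z = "reg s ''z''" and ?p = "reg s ''par''" and ?S = "aset s ''S''"
  let ?dig = "\<lambda>c j. c div B ^ j mod B"
  let ?F = "\<lambda>q::state. reg q ''n'' = n \<and> reg q ''z'' = ?z \<and> reg q ''par'' = ?p \<and> arr q = arr s \<and> warr q ''weight'' = warr s ''weight''"
  let ?P = "\<lambda>i (q::state). ?F q \<and>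
    (\<forall>c<P. warr q ''acc'' (?p * P + c) = A (?p * P + c) + (if c < i then cell A ?z ?S (?dig c) else 0)) \<and>
    (\<forall>p c. p \<noteq> ?p \<longrightarrow> c < P \<longrightarrow> warr q ''acc'' (p * P + c) = A (p * P + c))"
  have "?P P r" unfolding r_def push_code_def
  proof (rule sem_For_inv[where P = ?P])
    show "bd (reg s ''n'') (powa L) = P" using okb_powa[OF BPM] s by (simp add: inp_n)
    show "?P 0 (set_reg ''c'' 0 s)" using s by (simp add: inp_n A_def)
    fix i q assume i: "i < P" and P: "?P i q" and c: "reg q ''c'' = i"
    have F: "reg q ''n'' = n" "reg q ''z'' = ?z" "reg q ''par'' = ?p" "arr q = arr s" "warr q ''weight'' = warr s ''weight''"
      using P by blast+
    have iq: "inp q" using s F(1,4) by (simp add: inp_def)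
    have aq: "aset q ''S'' = ?S" using F(4) by (simp add: aset_def)
    define q1 where "q1 = sem M (digits_code L) q"
    define f where "f = mask ?S (?dig i)"
    have f: "f j \<le> n" for j unfolding f_def mask_def by (simp add: less_Suc_eq_le[symmetric])
    have d: "reg q1 ''t'' = code f \<and> reg q1 ''bl'' = blank B L f \<and>
       (reg q1 ''ok'' \<noteq> 0 \<longleftrightarrow> (\<forall>j<L. f j \<noteq> 0 \<longrightarrow> \<not> E ?z (f j - 1)))"
      using digits_code[OF iq c i] z F(2) aq unfolding q1_def f_def by simp
    have q1: "reg q1 ''n'' = n" "reg q1 ''z'' = ?z" "reg q1 ''par'' = ?p" "reg q1 ''c'' = i"
      "warr q1 = warr q"
      using F c by (auto simp: q1_def)
    have arr1: "arr q1 = arr s" using F(4) by (auto simp: q1_def)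
    define q2 where "q2 = sem M (cell_code L) q1"
    have acc2: "warr q2 ''acc'' = (warr q ''acc'') (?p * P + i := warr q ''acc'' (?p * P + i) + cell (warr q ''acc'') ?z ?S (?dig i))"
      using cell_code[of q1 f ?S "?dig i"] q1 i z p d F(5) wt f f_def unfolding q2_def by simp
    \<comment> \<open>All writes so far went to the row of the parent, which differs from row
      \<open>z\<close>; the value is that of the table before the loop.\<close>
    have same: "cell (warr q ''acc'') ?z ?S (?dig i) = cell A ?z ?S (?dig i)"
      by (rule cell_cong) (use P p z in \<open>auto simp: less_Suc_eq_le[symmetric]\<close>)
    have q2: "reg q2 = reg q1" "arr q2 = arr q1" "warr q2 ''weight'' = warr q1 ''weight''"
      by (auto simp: q2_def)
    have "?F (set_reg ''c'' (Suc i) q2)" using q1 q2 arr1 F by simp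
    moreover have "warr q2 ''acc'' (?p * P + c) = A (?p * P + c) + (if c < Suc i then cell A ?z ?S (?dig c) else 0)" if "c < P" for c
      unfolding acc2 same using P that i row_inj[OF that i, of ?p ?p] by (auto simp: less_Suc_eq)
    moreover have "warr q2 ''acc'' (p * P + c) = A (p * P + c)" if "p \<noteq> ?p" "c < P" for p c
      unfolding acc2 using P that row_inj[OF that(2) i, of p ?p] by auto
    ultimately have "?P (Suc i) (set_reg ''c'' (Suc i) q2)" by simp
    then show "?P (Suc i) (set_reg ''c'' (Suc i) (sem M (digits_code L ;; cell_code L) q))"
      unfolding sem.simps(5) q2_def q1_def .
  qed
  then show "\<And>c. c < P \<Longrightarrow> warr r ''acc'' (?p * P + c) = A (?p * P + c) + cell A ?z ?S (?dig c)"
    and "\<And>p c. p \<noteq> ?p \<Longrightarrow> c < P \<Longrightarrow> warr r ''acc'' (p * P + c) = A (p * P + c)"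
    by auto
qed

lemma rep_rs: "rep rs s \<Longrightarrow> i < n \<Longrightarrow> arr s ''ord'' i = rs ! i \<and> arr s ''pos'' (rs ! i) = Suc i"
  unfolding rep_def using nn by simp

lemma rs_less: "i < n \<Longrightarrow> rs ! i < n"
  using nth_V[of i] nn by auto

lemma vertex_code:
  assumes s: "inp s" and rep: "rep rs s" and i: "reg s ''i'' < n"
  defines "r \<equiv> sem M vertex_code s"
  shows "reg r ''z'' = rs ! reg s ''i''" "aset r ''S'' = NB (reg s ''i'')"
proof -
  let ?i = "reg s ''i''"
  define s1 where "s1 = set_reg ''z'' (rs ! ?i) s"
  define s2 where "s2 = sem M (fill ''u'' ''al'' (Less (V ''i'') (Arr ''pos'' (V ''u'')))) s1"
  have "sem M (FAssign ''z'' (Arr ''ord'' (V ''i''))) s = s1" using rep_rs[OF rep i] by (simp add: s1_def)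
  then have r: "r = sem M comp_code s2" unfolding r_def vertex_code_def sem.simps(5) s2_def by simp
  have i1: "inp s1" "inp s2" using s by (auto simp: s1_def s2_def inp_def)
  have z: "reg s1 ''z'' = rs ! ?i" "reg s2 ''z'' = rs ! ?i" by (auto simp: s1_def s2_def)
  have "aset s2 ''al'' = {u. u < n \<and> ?i < arr s ''pos'' u}" unfolding s2_def
  proof (rule aset_fill)
    fix u r assume "u < n" "agree {''u''} {''al''} s1 r" "reg r ''u'' = u"
    then show "bval M r (Less (V ''i'') (Arr ''pos'' (V ''u''))) = (?i < arr s ''pos'' u)"
      by (simp add: agree_def s1_def)
  qed (use i1 in \<open>auto simp: inp_n\<close>)
  also have "\<dots> = {..<n} - W ?i"
  proof -
    have "?i < arr s ''pos'' u \<longleftrightarrow> u \<notin> W ?i" if "u < n" for u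
    proof -
      obtain j where j: "j < n" "u = rs ! j" using V_nth[of u] \<open>u < n\<close> unfolding nn lessThan_iff by blast
      then show ?thesis using rep_rs[OF rep j(1)] nth_in_W[of j ?i] nn by auto
    qed
    then show ?thesis by auto
  qed
  finally have al: "aset s2 ''al'' = {..<n} - W ?i" .
  have "rs ! ?i \<in> aset s2 ''al''" using al rs_less[OF i] nth_in_W[of ?i ?i] i nn by auto
  then show "aset r ''S'' = NB ?i" using comp_code[OF i1(2)] z al unfolding r by simp
  show "reg r ''z'' = rs ! ?i" unfolding r using z by simp
qed

lemma parent_code:
  assumes s: "inp s" and rep: "rep rs s" and S: "aset s ''S'' = NB i"
  defines "r \<equiv> sem M parent_code s"
  shows "par i p \<Longrightarrow> reg r ''par'' = rs ! p" and "(\<nexists>p. par i p) \<Longrightarrow> reg r ''par'' = n"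
proof -
  let ?P = "\<lambda>j q. agree {''par'', ''j''} {} s q \<and> ((\<forall>l<j. rs ! l \<notin> NB i) \<and> reg q ''par'' = n \<or>
    (\<exists>p<j. rs ! p \<in> NB i \<and> (\<forall>l<j. rs ! l \<in> NB i \<longrightarrow> l \<le> p) \<and> reg q ''par'' = rs ! p))"
  let ?c = "FIf (NZ (Arr ''S'' (Arr ''ord'' (V ''j'')))) (FAssign ''par'' (Arr ''ord'' (V ''j''))) FSkip"
  define s1 where "s1 = set_reg ''par'' n s"
  have r: "r = sem M (FFor ''j'' len ?c) s1" unfolding r_def parent_code_def s1_def using s by (simp add: inp_n del: sem.simps(7))
  have "?P n r" unfolding r
  proof (rule sem_For_inv[where P = ?P])
    show "bd (reg s1 ''n'') len = n" using s by (simp add: s1_def inp_n)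
    show "?P 0 (set_reg ''j'' 0 s1)" by (auto simp: s1_def intro!: agree_set_reg agree_refl)
    fix j q assume j: "j < n" and P: "?P j q" and x: "reg q ''j'' = j"
    have ag: "agree {''par'', ''j''} {} s q" using P by blast
    have arr: "arr q = arr s" using agreeD(2)[OF ag] by auto
    have "arr q ''S'' (rs ! j) \<noteq> 0 \<longleftrightarrow> rs ! j \<in> NB i" using S rs_less[OF j] arr unfolding aset_def by auto
    then have q: "sem M ?c q = (if rs ! j \<in> NB i then set_reg ''par'' (rs ! j) q else q)"
      using rep_rs[OF rep j] arr x by simp
    show "?P (Suc j) (set_reg ''j'' (Suc j) (sem M ?c q))"
    proof (cases "rs ! j \<in> NB i")
      case True
      then have "\<exists>p<Suc j. rs ! p \<in> NB i \<and> (\<forall>l<Suc j. rs ! l \<in> NB i \<longrightarrow> l \<le> p) \<and> rs ! j = rs ! p"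
        by (intro exI[of _ j]) auto
      then show ?thesis unfolding q using True ag by (auto intro!: agree_set_reg)
    next
      case False
      have "(\<forall>l<Suc j. rs ! l \<notin> NB i) = (\<forall>l<j. rs ! l \<notin> NB i)" using False by (auto simp: less_Suc_eq)
      moreover have "(\<exists>p<Suc j. rs ! p \<in> NB i \<and> (\<forall>l<Suc j. rs ! l \<in> NB i \<longrightarrow> l \<le> p) \<and> v = rs ! p) =
         (\<exists>p<j. rs ! p \<in> NB i \<and> (\<forall>l<j. rs ! l \<in> NB i \<longrightarrow> l \<le> p) \<and> v = rs ! p)" for v
        using False by (auto simp: less_Suc_eq)
      ultimately show ?thesis unfolding q using P False by (auto intro!: agree_set_reg)
    qed
  qed
  moreover have iff: "par i p \<longleftrightarrow> p < n \<and> rs ! p \<in> NB i \<and> (\<forall>l<n. rs ! l \<in> NB i \<longrightarrow> l \<le> p)" for p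
    unfolding par_def nn ..
  ultimately have "(\<forall>l<n. rs ! l \<notin> NB i) \<and> reg r ''par'' = n \<or> (\<exists>p. par i p \<and> reg r ''par'' = rs ! p)"
    unfolding iff by blast
  then show "par i p \<Longrightarrow> reg r ''par'' = rs ! p" and "(\<nexists>p. par i p) \<Longrightarrow> reg r ''par'' = n"
    using par_unique[of i p] iff by (elim disjE, blast, blast, elim disjE, blast, blast)
qed

definition ready :: "state \<Rightarrow> bool" where
  "ready s \<longleftrightarrow> inp s \<and> rep rs s \<and> (\<forall>v<n. warr s ''weight'' v = w v)"

lemma ready_sem:
  "ready s \<Longrightarrow> asg c \<inter> {''n'', ''cnt''} = {} \<Longrightarrow> sto c \<inter> {''adj'', ''ord'', ''pos''} = {} \<Longrightarrow> ''weight'' \<notin> wsto c \<Longrightarrow> ready (sem M c s)"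
  unfolding ready_def by (auto simp: rep_def)

lemma ready_set_reg: "x \<noteq> ''n'' \<Longrightarrow> x \<noteq> ''cnt'' \<Longrightarrow> ready (set_reg x v s) = ready s"
  unfolding ready_def by (simp add: inp_def rep_def)

lemma dp_phase:
  assumes s: "ready s" and A: "warr s ''acc'' = (\<lambda>_. 0)"
  shows "ready (sem M (dp_phase L) s) \<and> acc_ok 0 (warr (sem M (dp_phase L) s) ''acc'')"
proof -
  let ?P = "\<lambda>m q. ready q \<and> acc_ok (n - m) (warr q ''acc'')"
  let ?c = "FAssign ''i'' (Minus (Minus len (N 1)) (V ''it'')) ;; vertex_code ;; parent_code ;; push_code L"
  have "?P n (sem M (dp_phase L) s)" unfolding dp_phase_def
  proof (rule sem_For_inv[where P = ?P])
    show "bd (reg s ''n'') len = n" using s by (simp add: ready_def inp_n)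
    show "?P 0 (set_reg ''it'' 0 s)" using s A acc_ok_start by (simp add: ready_set_reg)
    fix m q assume m: "m < n" and P: "?P m q" and it: "reg q ''it'' = m"
    \<comment> \<open>Since \<open>m < n\<close> the subtraction is exact, and
      \<open>Suc i = n - m\<close> says that just the positions after \<open>i\<close> have
      pushed.\<close>
    define i where "i = n - 1 - m"
    have i: "i < n" "Suc i = n - m" using m by (auto simp: i_def)
    define q1 where "q1 = set_reg ''i'' i q"
    define q2 where "q2 = sem M vertex_code q1"
    define q3 where "q3 = sem M parent_code q2"
    define q4 where "q4 = sem M (push_code L) q3"
    have qn: "reg q ''n'' = n" using P by (simp add: ready_def inp_n)
    have "aval M q (Minus (Minus len (N 1)) (V ''it'')) = i"
      using qn it m nM M1 by (simp add: i_def)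
    then have q4: "sem M ?c q = q4" unfolding sem.simps(5) sem.simps(2) q4_def q3_def q2_def q1_def by simp
    have r1: "ready q1" using P by (simp add: q1_def ready_set_reg)
    have r2: "ready q2" unfolding q2_def by (rule ready_sem[OF r1]) auto
    have r3: "ready q3" unfolding q3_def by (rule ready_sem[OF r2]) auto
    have r4: "ready q4" unfolding q4_def by (rule ready_sem[OF r3]) auto
    have vc: "reg q2 ''z'' = rs ! i" "aset q2 ''S'' = NB i"
      using vertex_code[of q1] r1 i unfolding q2_def ready_def by (auto simp: q1_def)
    have pc: "par i p \<Longrightarrow> reg q3 ''par'' = rs ! p" "(\<nexists>p. par i p) \<Longrightarrow> reg q3 ''par'' = n" for p
      using parent_code[of q2 i] r2 vc unfolding q3_def ready_def by auto
    have z3: "reg q3 ''z'' = rs ! i" "aset q3 ''S'' = NB i" using vc by (auto simp: q3_def)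
    \<comment> \<open>The target row is never the row being read: a parent has a smaller position,
      and the dummy row belongs to no vertex.\<close>
    have p3: "reg q3 ''par'' \<le> n \<and> reg q3 ''par'' \<noteq> rs ! i"
    proof (cases "\<exists>p. par i p")
      case True
      then obtain p where p: "par i p" by blast
      then have "p < i" using par_less[of i p] i nn by simp
      then show ?thesis using pc(1)[OF p] rs_less[of p] i dist nn by (auto simp: nth_eq_iff_index_eq)
    next
      case False
      then show ?thesis using pc(2) rs_less[OF i(1)] by auto
    qed
    have A3: "warr q3 ''acc'' = warr q ''acc''" by (simp add: q3_def q2_def q1_def)
    have i3: "inp q3" "warr q3 ''weight'' (reg q3 ''z'') = w (reg q3 ''z'')" "reg q3 ''z'' < n"
      using r3 z3 rs_less[OF i(1)] by (auto simp: ready_def)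
    note pu = push_code[OF i3(1,3) conjunct1[OF p3] _ i3(2)]
    have "acc_ok i (warr q4 ''acc'')"
    proof (rule acc_ok_step[of i "warr q ''acc''" "reg q3 ''par''"])
      show "acc_ok (Suc i) (warr q ''acc'')" using P i by simp
      show "i < n" by fact
      show "reg q3 ''par'' = rs ! p" if "par i p" for p using pc(1) that by blast
      show "reg q3 ''par'' = n" if "\<nexists>p. par i p" using pc(2) that by blast
      show "warr q4 ''acc'' (reg q3 ''par'' * P + c) = warr q ''acc'' (reg q3 ''par'' * P + c) +
          cell (warr q ''acc'') (rs ! i) (NB i) (\<lambda>j. c div B ^ j mod B)" if "c < P" for c
        using pu(1)[OF _ that] p3 z3 A3 unfolding q4_def by simp
      show "warr q4 ''acc'' (p * P + c) = warr q ''acc'' (p * P + c)" if "p \<noteq> reg q3 ''par''" "c < P" for p c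
        using pu(2)[OF _ that] p3 z3 A3 unfolding q4_def by simp
    qed
    then have "?P (Suc m) q4" using r4 by (simp add: i_def)
    then show "?P (Suc m) (set_reg ''it'' (Suc m) (sem M ?c q))"
      unfolding q4 by (simp add: ready_set_reg)
  qed
  then show ?thesis by simp
qed

end

section \<open>Selecting a maximum weight independent set\<close>

context dp
begin

lemma collect_code:
  assumes s: "inp s" and z: "reg s ''z'' < n" and X: "X = aset s ''out'' \<inter> aset s ''S''" "card X \<le> L"
  defines "r \<equiv> sem M collect_code s"
  shows "\<exists>e. tup e \<and> Jset e = X \<and> reg r ''t'' = code e \<and> reg r ''pw'' = B ^ card X \<and> (\<forall>j\<ge>card X. e j = 0) \<and>
    (reg r ''ok'' \<noteq> 0 \<longleftrightarrow> reg s ''z'' \<notin> NN X)"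
proof -
  let ?z = "reg s ''z''"
  let ?F = "{''t'', ''pw'', ''ok'', ''u''}"
  let ?P = "\<lambda>i q. agree ?F {} s q \<and> (\<exists>e. tup e \<and> Jset e = X \<inter> {..<i} \<and> reg q ''t'' = code e \<and>
     reg q ''pw'' = B ^ card (X \<inter> {..<i}) \<and> (\<forall>j\<ge>card (X \<inter> {..<i}). e j = 0) \<and>
     (reg q ''ok'' \<noteq> 0 \<longleftrightarrow> ?z \<notin> NN (X \<inter> {..<i})))"
  let ?b = "FAssign ''t'' (Plus (V ''t'') (Times (Plus (V ''u'') (N 1)) (V ''pw''))) ;;
        FAssign ''pw'' (Times (V ''pw'') (Plus len (N 1))) ;;
        FIf (ADJ ''z'' ''u'') (FAssign ''ok'' (N 0)) FSkip"
  let ?c = "FIf (BAnd (IN ''out'' ''u'') (IN ''S'' ''u'')) ?b FSkip"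
  define s1 where "s1 = set_reg ''ok'' 1 (set_reg ''pw'' 1 (set_reg ''t'' 0 s))"
  have r: "r = sem M (FFor ''u'' len ?c) s1" unfolding r_def collect_code_def s1_def using M1 by (simp del: sem.simps(7))
  have Xn: "X \<subseteq> {..<n}" "finite X" using X(1) aset_sub finite_subset[of X "{..<n}"] by auto
  have code0: "code (\<lambda>_. 0) = 0"
  proof -
    have "val B l (\<lambda>_. 0) = 0" for l by (induction l) auto
    then show ?thesis .
  qed
  have "?P n r" unfolding r
  proof (rule sem_For_inv[where P = ?P])
    show "bd (reg s1 ''n'') len = n" using s by (simp add: s1_def inp_n)
    show "?P 0 (set_reg ''u'' 0 s1)"
      using code0 by (auto simp: s1_def tup_def Jset_def NN_def intro!: agree_set_reg agree_refl exI[of _ "\<lambda>_. 0"])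
    fix i q assume i: "i < n" and P: "?P i q" and u: "reg q ''u'' = i"
    let ?Y = "X \<inter> {..<i}"
    from P have ag: "agree ?F {} s q" by blast
    from P obtain e where e: "tup e" "Jset e = ?Y" "reg q ''t'' = code e" "reg q ''pw'' = B ^ card ?Y"
      "\<forall>j\<ge>card ?Y. e j = 0" "reg q ''ok'' \<noteq> 0 \<longleftrightarrow> ?z \<notin> NN ?Y" by blast
    have qs: "reg q ''n'' = n" "reg q ''z'' = ?z"
      using agreeD(1)[OF ag, of "''n''"] agreeD(1)[OF ag, of "''z''"] inp_n[OF s] by auto
    have cond: "bval M q (BAnd (IN ''out'' ''u'') (IN ''S'' ''u'')) \<longleftrightarrow> i \<in> X"
      using bval_IN[OF ag, of "''out''" "''u''"] bval_IN[OF ag, of "''S''" "''u''"] u i X(1) by simp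
    show "?P (Suc i) (set_reg ''u'' (Suc i) (sem M ?c q))"
    proof (cases "i \<in> X")
      case False
      have "X \<inter> {..<Suc i} = ?Y" using False by (auto simp: less_Suc_eq)
      moreover have "sem M ?c q = q" using cond False by (simp del: bval.simps)
      ultimately show ?thesis using P by (auto intro!: agree_set_reg)
    next
      case True
      define m where "m = card ?Y"
      define e' where "e' = e(m := Suc i)"
      have Y: "X \<inter> {..<Suc i} = insert i ?Y" using True by (auto simp: less_Suc_eq)
      have cY: "card (X \<inter> {..<Suc i}) = Suc m" unfolding Y m_def using Xn by simp
      have "Suc m \<le> card X" unfolding cY[symmetric] by (rule card_mono) (use Xn in auto)
      then have mL: "m < L" using X(2) by simp
      have em: "e m = 0" using e(5) by (simp add: m_def)
      have iJ: "i \<notin> Jset e" using e(2) by auto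
      have te: "tup e'" unfolding e'_def by (rule tup_upd[OF e(1) mL i iJ])
      have Je: "Jset e' = X \<inter> {..<Suc i}" unfolding e'_def Y using Jset_upd[of m e, OF mL em] e(2) by simp
      have cd: "code e' = code e + (i + 1) * B ^ m" unfolding e'_def using val_upd[of m L e B "Suc i", OF mL em] by simp
      have "code e' < P" by (rule code_less) (use te in \<open>auto simp: tup_def\<close>)
      then have lt: "code e + (i + 1) * B ^ m < M" using cd PM by linarith
      define q1 where "q1 = set_reg ''t'' (code e') q"
      define q2 where "q2 = set_reg ''pw'' (B ^ Suc m) q1"
      have "aval M q (Plus (V ''t'') (Times (Plus (V ''u'') (N 1)) (V ''pw''))) = code e'"
        unfolding cd by (subst aval_ext) (use e u i lt in \<open>auto simp: m_def\<close>)
      then have x1: "sem M (FAssign ''t'' (Plus (V ''t'') (Times (Plus (V ''u'') (N 1)) (V ''pw'')))) q = q1"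
        unfolding sem.simps(2) q1_def by simp
      have "B ^ Suc m < M" using pow_less[of "Suc m"] mL by simp
      moreover have "aval M q1 (Plus len (N 1)) = B" using qs by (simp add: q1_def)
      ultimately have "aval M q1 (Times (V ''pw'') (Plus len (N 1))) = B ^ Suc m"
        unfolding aval.simps(6) using e(4) by (simp add: q1_def m_def mult.commute)
      then have x2: "sem M (FAssign ''pw'' (Times (V ''pw'') (Plus len (N 1)))) q1 = q2"
        unfolding sem.simps(2) q2_def by simp
      have ag2: "agree ?F {} s q2" unfolding q2_def q1_def using ag by (auto intro!: agree_set_reg)
      have adj: "bval M q2 (ADJ ''z'' ''u'') \<longleftrightarrow> E ?z i"
        using bval_ADJ[OF s ag2, of "''z''" "''u''"] qs u z i by (simp add: q2_def q1_def)
      define q3 where "q3 = (if E ?z i then set_reg ''ok'' 0 q2 else q2)"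
      have "sem M ?c q = sem M ?b q" unfolding sem.simps(6) by (rule if_P) (use cond True in blast)
      also have "\<dots> = q3" unfolding sem.simps(5) x1 x2 unfolding sem.simps(6) q3_def using adj by simp
      finally have q3: "sem M ?c q = q3" .
      have nn: "?z \<in> NN (X \<inter> {..<Suc i}) \<longleftrightarrow> E ?z i \<or> ?z \<in> NN ?Y" unfolding Y NN_def using symE by blast
      have "reg q3 ''ok'' \<noteq> 0 \<longleftrightarrow> ?z \<notin> NN (X \<inter> {..<Suc i})"
        unfolding nn using e(6) by (auto simp: q3_def q2_def q1_def)
      moreover have "reg q3 ''t'' = code e'" "reg q3 ''pw'' = B ^ card (X \<inter> {..<Suc i})"
        unfolding cY by (auto simp: q3_def q2_def q1_def)
      moreover have "\<forall>j\<ge>card (X \<inter> {..<Suc i}). e' j = 0" unfolding cY e'_def using e(5) m_def by auto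
      moreover have "agree ?F {} s (set_reg ''u'' (Suc i) q3)"
        unfolding q3_def using ag2 by (auto intro!: agree_set_reg)
      ultimately show ?thesis unfolding q3 using te Je by auto
    qed
  qed
  moreover have "X \<inter> {..<n} = X" using Xn by blast
  ultimately show ?thesis by simp
qed

lemma select_code:
  assumes s: "reg s ''n'' = n" and i: "i < n" and z: "reg s ''z'' = rs ! i" and A: "acc_ok 0 (warr s ''acc'')"
    and e: "tup e" "indep (Jset e)" "Jset e \<subseteq> NB i" "\<And>j. j \<ge> card (Jset e) \<Longrightarrow> e j = 0"
    and r: "reg s ''t'' = code e" "reg s ''pw'' = B ^ card (Jset e)" "reg s ''ok'' \<noteq> 0 \<longleftrightarrow> rs ! i \<notin> NN (Jset e)"
    and wt: "warr s ''weight'' (rs ! i) = w (rs ! i)"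
  shows "sem M (select_code L) s = (if picks i (Jset e) then set_arr ''out'' (rs ! i) 1 s else s)"
proof -
  let ?v = "rs ! i" and ?J = "Jset e"
  let ?ext = "Plus (V ''t'') (Times (Plus (V ''z'') (N 1)) (V ''pw''))"
  let ?cond = "BAnd (NZ (V ''ok'')) (WLess (ACC L ''z'' (V ''t'')) (WPlus (WArr ''weight'' (V ''z'')) (ACC L ''z'' ?ext)))"
  have vn: "?v < n" by (rule rs_less[OF i])
  have tP: "code e < P" by (rule code_less) (use e(1) in \<open>auto simp: tup_def\<close>)
  have a: "wval M s (ACC L ''z'' (V ''t'')) = opt (CC i - {?v} - NN ?J)"
  proof -
    have "wval M s (ACC L ''z'' (V ''t'')) = warr s ''acc'' (?v * P + code e)"
      by (subst wval_ACC) (use s z vn r tP in auto)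
    also have "\<dots> = opt (CC i - {?v} - NN ?J)"
      by (rule acc_row[OF A i _ e(1,2)]) (use e(3) in auto)
    finally show ?thesis .
  qed
  have "bval M s ?cond \<longleftrightarrow> picks i ?J"
  proof (cases "?v \<in> NN ?J")
    case True
    then show ?thesis using r(3) unfolding picks_def by simp
  next
    case False
    have ind: "indep (insert ?v ?J)" by (rule indep_insert[OF _ e(2) False]) (use vn in simp)
    have vJ: "?v \<notin> ?J" using e(3) nth_CC[of i] unfolding nbhd_def by auto
    have "card (insert ?v ?J) \<le> L" by (rule bag_card[OF i _ ind]) (use e(3) in auto)
    then have cL: "card ?J < L" using vJ indep_finite[OF e(2)] by simp
    let ?idx = "code e + (?v + 1) * B ^ card ?J"
    have "code (e(card ?J := Suc ?v)) < P" by (rule code_less) (use e(1) vn in \<open>auto simp: tup_def\<close>)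
    then have idx: "?idx < P" using val_upd[of "card ?J" L e B "Suc ?v"] cL e(4) by simp
    have "aval M s ?ext = ?idx"
      by (subst aval_ext) (use idx PM z vn r in auto)
    then have "wval M s (ACC L ''z'' ?ext) = warr s ''acc'' (?v * P + ?idx)"
      by (subst wval_ACC) (use s z vn idx in auto)
    also have "\<dots> = opt (CC i - {?v} - NN (insert ?v ?J))"
      by (rule acc_insert[OF A i _ e(1) ind e(3) cL]) (use e(4) in auto)
    finally have b: "wval M s (WPlus (WArr ''weight'' (V ''z'')) (ACC L ''z'' ?ext)) = w ?v + opt (CC i - {?v} - NN (insert ?v ?J))"
      using z wt by simp
    show ?thesis unfolding bval.simps a b picks_def using False r(3) by simp
  qed
  then have "sem M (select_code L) s = (if picks i ?J then sem M (FStore ''out'' (V ''z'') (N 1)) s else sem M FSkip s)"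
    unfolding select_code_def sem.simps(6) by simp
  then show ?thesis using z M1 by simp
qed

text \<open>The loop maintains that the weight chosen so far plus the best completion equals the
  overall optimum; \<open>greedy_step\<close> says that each decision preserves this.\<close>

lemma out_phase:
  assumes s: "ready s" and A: "acc_ok 0 (warr s ''acc'')" and out: "aset s ''out'' = {}"
  defines "I \<equiv> aset (sem M (out_phase L) s) ''out''"
  shows "indep I \<and> sum w I = opt {..<n}"
proof -
  let ?P = "\<lambda>i q. ready q \<and> warr q ''acc'' = warr s ''acc'' \<and> (let I = aset q ''out'' in
    I \<subseteq> W i \<and> indep I \<and> sum w I + opt ({..<n} - W i - NN I) = opt {..<n})"
  have "?P n (sem M (out_phase L) s)" unfolding out_phase_def
  proof (rule sem_For_inv[where P = ?P])
    show "bd (reg s ''n'') len = n" using s by (simp add: ready_def inp_n)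
    have "aset (set_reg ''i'' 0 s) ''out'' = {}" using out by (simp add: aset_def)
    then show "?P 0 (set_reg ''i'' 0 s)" using s indep_empty by (simp add: ready_set_reg NN_def)
    fix i q assume i: "i < n" and P: "?P i q" and x: "reg q ''i'' = i"
    define I where "I = aset q ''out''"
    define q1 where "q1 = sem M vertex_code q"
    define q2 where "q2 = sem M collect_code q1"
    define q3 where "q3 = sem M (select_code L) q2"
    have rq: "ready q" and accq: "warr q ''acc'' = warr s ''acc''"
      and I: "I \<subseteq> W i" "indep I" "sum w I + opt ({..<n} - W i - NN I) = opt {..<n}"
      using P unfolding I_def Let_def by auto
    have i': "i < nn" using i nn by simp
    have r1: "ready q1" unfolding q1_def by (rule ready_sem[OF rq]) auto
    have r2: "ready q2" unfolding q2_def by (rule ready_sem[OF r1]) auto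
    have r3: "ready q3" unfolding q3_def by (rule ready_sem[OF r2]) auto
    have vc: "reg q1 ''z'' = rs ! i" "aset q1 ''S'' = NB i"
      using vertex_code[of q] rq i x unfolding q1_def ready_def by auto
    define J where "J = I \<inter> NB i"
    have o1: "aset q1 ''out'' = I" by (simp add: q1_def I_def)
    have Ji: "indep J" using indep_subset[OF I(2)] by (auto simp: J_def)
    \<comment> \<open>The chosen vertices that matter for position \<open>i\<close> are independent
      and lie in its bag, so they fit into \<open>L\<close> digits.\<close>
    have Jc: "card J \<le> L" by (rule bag_card[OF i _ Ji]) (auto simp: J_def)
    have z1: "reg q1 ''z'' < n" using vc rs_less[OF i] by simp
    have i1: "inp q1" "inp q2" using r1 r2 by (auto simp: ready_def)
    have JX: "J = aset q1 ''out'' \<inter> aset q1 ''S''" unfolding o1 vc(2) J_def ..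
    obtain e where e: "tup e" "Jset e = J" "reg q2 ''t'' = code e" "reg q2 ''pw'' = B ^ card J" "\<forall>j\<ge>card J. e j = 0"
       "reg q2 ''ok'' \<noteq> 0 \<longleftrightarrow> rs ! i \<notin> NN J"
      using collect_code[OF i1(1) z1 JX Jc, folded q2_def, unfolded vc(1)] by blast
    have acc2: "warr q2 ''acc'' = warr s ''acc''" using accq by (simp add: q2_def q1_def)
    have q3: "q3 = (if picks i J then set_arr ''out'' (rs ! i) 1 q2 else q2)"
      unfolding q3_def e(2)[symmetric]
    proof (rule select_code)
      show "reg q2 ''n'' = n" using i1 by (simp add: inp_n)
      show "reg q2 ''z'' = rs ! i" using vc by (simp add: q2_def)
      show "acc_ok 0 (warr q2 ''acc'')" using A acc2 by simp
      show "warr q2 ''weight'' (rs ! i) = w (rs ! i)" using r2 rs_less[OF i] by (simp add: ready_def)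
    qed (use e i Ji in \<open>auto simp: J_def\<close>)
    have o2: "aset q2 ''out'' = I" using o1 by (simp add: q2_def)
    have o3: "aset q3 ''out'' = (if picks i J then insert (rs ! i) I else I)"
      unfolding q3 using o2 rs_less[OF i] by (auto simp: aset_def)
    note g = greedy_step[OF i' I(1,2) J_def]
    have "?P (Suc i) q3"
    proof (cases "picks i J")
      case True
      have "rs ! i \<notin> I" using I(1) nth_in_W[OF i', of i] by auto
      then have "sum w (insert (rs ! i) I) = w (rs ! i) + sum w I" using indep_finite[OF I(2)] by simp
      then show ?thesis using g I True r3 accq o3 W_Suc[OF i']
        by (auto simp: Let_def q3_def q2_def q1_def)
    next
      case False
      then show ?thesis using g I r3 accq o3 W_Suc[OF i']
        by (auto simp: Let_def q3_def q2_def q1_def)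
    qed
    moreover have "aset (set_reg ''i'' (Suc i) q3) ''out'' = aset q3 ''out''" by (simp add: aset_def)
    ultimately have "?P (Suc i) (set_reg ''i'' (Suc i) q3)" by (simp add: ready_set_reg)
    then show "?P (Suc i) (set_reg ''i'' (Suc i) (sem M (vertex_code ;; collect_code ;; select_code L) q))"
      unfolding sem.simps(5) q3_def q2_def q1_def .
  qed
  moreover have "{..<n} - W n - NN I = {}" using nn set_rs by auto
  ultimately show ?thesis unfolding I_def Let_def using opt_empty by auto
qed

end

section \<open>Running time, word size and the final result\<close>

lemmas code_defs =
  mwis_code_def order_phase_def pick_code_def comp_code_def sep_code_def
  find_code_def rows_code_def order_code_def fill_def fill_ex_def
  fill_rows_def find_pair_def closure_def dp_phase_def vertex_code_def
  parent_code_def push_code_def digits_code_def digit_code_def cell_code_def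
  out_phase_def collect_code_def select_code_def

text \<open>Computing components costs degree 4 in each phase, pushing costs 1 + \<open>L\<close>;
  for \<open>L \<ge> 3\<close> the latter dominates.\<close>

lemma deg_mwis_code: "L \<ge> 3 \<Longrightarrow> deg (mwis_code L) = Suc L"
  by (simp add: code_defs)

lemma wf_mwis_code: "wf (mwis_code L)" "''n'' \<notin> asg (mwis_code L)"
  by (simp_all add: code_defs)

lemma okc_mwis_code:
  assumes "n < M" "L < M" "(n + 1) * (n + 1) ^ L < M"
  shows "okc M n (mwis_code L)"
  using assms okb_powa[OF assms(3)]
  by (simp add: code_defs)

text \<open>The exponent exceeds \<open>L + 1\<close> for the table addresses and is at least 2 for
  the adjacency matrix. The base is at least 2, so even for n = 0 the loop bound \<open>L\<close> is
  below the modulus.\<close>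

lemma modulus_bounds:
  fixes n L :: nat
  defines "M \<equiv> (n + 2) ^ (L + 2)"
  shows "2 < M" "n * n + n < M" "n < M" "L < M" "(n + 1) * (n + 1) ^ L < M"
proof -
  have "(n + 1) ^ Suc L < (n + 2) ^ Suc L" by (rule power_strict_mono) auto
  also have "\<dots> \<le> M" unfolding M_def by (rule power_increasing) auto
  finally show "(n + 1) * (n + 1) ^ L < M" by simp
  have 2: "(n + 2) ^ 2 \<le> M" unfolding M_def by (rule power_increasing) auto
  have "n * n + n + 3 < (n + 2) ^ 2" by (simp add: power2_eq_square)
  then show "2 < M" "n * n + n < M" "n < M" using 2 by linarith+
  have "L + 2 < 2 ^ (L + 2)" by (rule less_exp)
  also have "(2::nat) ^ (L + 2) \<le> M" unfolding M_def by (rule power_mono) auto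
  finally show "L < M" by simp
qed

lemma mwis_code_correct:
  assumes G: "pair_graph G" "pverts G = {..<n}" and free: "K2q_induced_minor_free q G" and q: "q \<ge> 2"
  defines "L \<equiv> 2 * (q - 1) + 1"
  defines "M \<equiv> (n + 2) ^ (L + 2)"
  shows "max_weight_independent_set G w (mwis_output n (sem M (mwis_code L) (mwis_input n G w)))"
proof -
  interpret G: pair_graph G by (rule G(1))
  define E where "E u v \<longleftrightarrow> (u, v) \<in> parcs G" for u v
  have sym: "E v u" if "E u v" for u v
    using G.pair_sym_arcs that unfolding E_def symmetric_def by (auto dest: symD)
  interpret fgraph "{..<n}" E
  proof
    show "\<not> E v v" for v using G.pair_no_loops unfolding E_def by force
    show "E u v \<Longrightarrow> u \<in> {..<n}" for u v using G.in_arcsD1 G(2) unfolding E_def by blast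
  qed (use sym in auto)
  note mb = modulus_bounds[where n = n and L = L, folded M_def]
  have indep_iff: "indep I \<longleftrightarrow> independent_set G I" for I
    unfolding indep_def independent_set_def E_def G(2) ..
  have conn_iff: "conn D \<longleftrightarrow> (\<forall>a\<in>D. \<forall>b\<in>D. (a, b) \<in> (parcs G \<inter> D \<times> D)\<^sup>*)" for D
  proof -
    have "{(a, b). E a b \<and> a \<in> D \<and> b \<in> D} = parcs G \<inter> D \<times> D" unfolding E_def by auto
    then show ?thesis unfolding conn_def by simp
  qed
  interpret hb: ram_hub n E M "q - 1"
  proof
    show "2 < M" "n * n + n < M" by (rule mb)+
    show "1 \<le> q - 1" using q by simp
    fix A B I
    assume h: "conn A" "conn B" "A \<subseteq> {..<n}" "B \<subseteq> {..<n}" "A \<inter> B = {}" "anti A B" "indep I" "I \<inter> (A \<union> B) = {}"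
      "\<And>i. i \<in> I \<Longrightarrow> \<exists>a\<in>A. E a i" "\<And>i. i \<in> I \<Longrightarrow> \<exists>b\<in>B. E b i"
    have "card I < q"
    proof (rule K2q_free_hub_bound[OF G(1) free, of A B I])
      show "parcs G \<inter> A \<times> B = {}" using h(6) unfolding anti_def E_def by auto
    qed (use h q G(2) in \<open>auto simp: conn_iff indep_iff E_def\<close>)
    then show "card I \<le> q - 1" by simp
  qed
  define s0 where "s0 = mwis_input n G w"
  have inp0: "hb.inp s0"
    unfolding hb.inp_def
  proof (intro conjI allI impI)
    show "reg s0 ''n'' = n" by (simp add: s0_def mwis_input_def)
    fix u v assume uv: "u < n" "v < n"
    then have "u * n + v < n * n" "(u * n + v) div n = u" "(u * n + v) mod n = v"
      using hb.idx_less by auto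
    then show "(arr s0 ''adj'' (u * n + v) \<noteq> 0) = E u v" by (simp add: s0_def mwis_input_def E_def)
  qed
  define s1 where "s1 = sem M order_phase s0"
  have "\<exists>rs. set rs = {..<n} \<and> hb.rep rs s1 \<and> hb.elim_ok (2 * (q - 1) + 1) rs"
    unfolding s1_def by (rule hb.order_phase[OF inp0]) (auto simp: s0_def mwis_input_def)
  then obtain rs where rs: "set rs = {..<n}" "hb.rep rs s1" "hb.elim_ok L rs" unfolding L_def by blast
  have len: "length rs = n" using rs(1,2) unfolding hb.rep_def by (metis card_lessThan distinct_card)
  \<comment> \<open>The order is known only as the list that the ordering phase leaves in memory, so
    the locale can be interpreted only now; its bag condition is the bound from
    \<open>elim_ok\<close>.\<close>
  interpret d: dp n E M w rs L
  proof
    show "distinct rs" using rs(2) unfolding hb.rep_def by blast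
    show "set rs = {..<n}" by (rule rs(1))
    show "(n + 1) * (n + 1) ^ L < M" by (rule mb)
    fix i I assume "i < n" "I \<subseteq> insert (rs ! i) (nbhd (reach ({..<n} - set (take i rs)) (rs ! i)))" "indep I"
    then show "card I \<le> L" using rs(3) len unfolding hb.elim_ok_def alpha_le_def hb.bag_def by blast
  qed
  have ready1: "d.ready s1"
    unfolding d.ready_def
  proof (intro conjI allI impI)
    show "hb.inp s1" unfolding s1_def using inp0 by simp
    show "hb.rep rs s1" by (rule rs(2))
    show "warr s1 ''weight'' v = w v" if "v < n" for v using that by (simp add: s1_def s0_def mwis_input_def)
  qed
  define s2 where "s2 = sem M (dp_phase L) s1"
  have "warr s1 ''acc'' = (\<lambda>_. 0)" by (simp add: s1_def s0_def mwis_input_def)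
  from d.dp_phase[OF ready1 this] have r2: "d.ready s2" "d.acc_ok 0 (warr s2 ''acc'')" unfolding s2_def by auto
  have "''out'' \<notin> sto (dp_phase L)" by (simp add: dp_phase_def)
  then have "arr s2 ''out'' = arr s0 ''out''" by (simp add: s2_def s1_def)
  then have "hb.aset s2 ''out'' = {}" by (simp add: hb.aset_def s0_def mwis_input_def)
  from d.out_phase[OF r2 this] obtain I where I: "I = hb.aset (sem M (out_phase L) s2) ''out''" "indep I" "sum w I = d.opt {..<n}"
    by blast
  have out: "mwis_output n (sem M (mwis_code L) s0) = I"
    unfolding I(1) mwis_output_def hb.aset_def mwis_code_def sem.simps(5) s2_def s1_def ..
  have "sum w J \<le> sum w I" if "independent_set G J" for J
    using that d.opt_ge[of J "{..<n}"] I(3) unfolding indep_iff[symmetric] indep_def by auto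
  then show ?thesis unfolding max_weight_independent_set_def s0_def[symmetric] out using I(2) indep_iff by blast
qed

theorem corollary3p15:
  fixes q :: nat
  assumes "q \<ge> 2"
  shows "mwis_solvable_in_time {G. K2q_induced_minor_free q G} (\<lambda>n. real n ^ (2 * q))"
proof -
  define L where "L = 2 * (q - 1) + 1"
  obtain K where K: "\<And>n. tb n (mwis_code L) \<le> K * (n + 2) ^ deg (mwis_code L)" using tb_poly by blast
  have "deg (mwis_code L) = 2 * q" using deg_mwis_code[of L] assms unfolding L_def by simp
  then have K': "tb n (mwis_code L) \<le> K * (n + 2) ^ (2 * q)" for n using K[of n] by simp
  have "(\<lambda>n. real (tb n (mwis_code L))) \<in> O(\<lambda>n. real n ^ (2 * q))"
  \<comment> \<open>For n >= 1, n + 2 is at most 3n, which gives the factor 3^(2q).\<close>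
  proof (rule bigoI[of _ "real K * 3 ^ (2 * q)"])
    show "\<forall>\<^sub>F n in sequentially. norm (real (tb n (mwis_code L))) \<le> real K * 3 ^ (2 * q) * norm (real n ^ (2 * q))"
      using eventually_ge_at_top[of 1]
    proof eventually_elim
      case (elim n)
      have "(n + 2) ^ (2 * q) \<le> (3 * n) ^ (2 * q)" using elim by (intro power_mono) auto
      then have "tb n (mwis_code L) \<le> K * (3 * n) ^ (2 * q)" using K'[of n] by (meson le_trans mult_le_mono2)
      then have "real (tb n (mwis_code L)) \<le> real (K * (3 * n) ^ (2 * q))" by (rule of_nat_mono)
      then show ?case by (simp add: power_mult_distrib)
    qed
  qed
  moreover have "\<exists>t s. exec ((n + 2) ^ (L + 2)) (compile (mwis_code L)) (mwis_input n G w) t s \<and> t \<le> tb n (mwis_code L) \<and>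
       max_weight_independent_set G w (mwis_output n s)"
    if G: "pair_graph G" "pverts G = {..<n}" "K2q_induced_minor_free q G" for n G w
  proof -
    note mb = modulus_bounds[where n = n and L = L]
    have "1 < (n + 2) ^ (L + 2)" using mb(1) by linarith
    then obtain t where "exec ((n + 2) ^ (L + 2)) (compile (mwis_code L)) (mwis_input n G w) t
        (sem ((n + 2) ^ (L + 2)) (mwis_code L) (mwis_input n G w)) \<and> t \<le> tb n (mwis_code L)"
      using exec_compile[OF wf_mwis_code(1) okc_mwis_code[OF mb(3,4,5)] wf_mwis_code(2), of "mwis_input n G w"]
      by (auto simp: mwis_input_def)
    then show ?thesis using mwis_code_correct[OF G assms, folded L_def] by blast
  qed
  ultimately show ?thesis unfolding mwis_solvable_in_time_def
    by (intro exI[of _ "compile (mwis_code L)"] exI[of _ "L + 2"] exI[of _ "\<lambda>n. tb n (mwis_code L)"]) auto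
qed

end
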